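(* Let $\mathcal{E}_n$ denote the elliptic curve over $\mathbb{Q}(t)$ given by $y^2 = x^3 + t^n + \frac{1}{t^n}$. Then: (i) The Mordell--Weil group $\mathcal{E}_1(\mathbb{C}(t))$ has rank $r_1 = 0$. (ii) The splitting field of $\mathcal{E}_2$ over $\mathbb{Q}(t)$ is $\mathcal{K}_2 = \mathbb{Q}(\zeta_3, 2^{1/3})$, so that $\mathcal{E}_2(\mathbb{C}(t)) = \mathcal{E}_2(\mathcal{K}_2(t))$; this group has rank $r_2 = 4$, and the four points $$P_1 = \left(2^{1/3},\, t + 1/t\right),\quad P_2 = \left(\zeta_3\, 2^{1/3},\, t + 1/t\right),\quad P_3 = \left(-2^{1/3},\, t - 1/t\right),\quad P_4 = \left(-\zeta_3^2\, 2^{1/3},\, t - 1/t\right)$$ form a set of independent generators of $\mathcal{E}_2(\mathcal{K}_2(t))$.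
   Context: For an elliptic curve $\mathcal{E}$ over $k(t)$ with $k\subset\mathbb{C}$ a number field, and a field $K$ with $k(t)\subseteq K\subseteq \mathbb{C}(t)$, $\mathcal{E}(K)$ denotes the group of $K$-rational points (a finitely generated abelian group, the Mordell--Weil lattice when $K=\mathbb{C}(t)$, with the Néron--Tate/Shioda height pairing). The splitting field of $\mathcal{E}$ over $k(t)$ is the smallest subfield $\mathcal{K}\subset\mathbb{C}$ which is a finite extension of $k$ and satisfies $\mathcal{E}(\mathbb{C}(t)) = \mathcal{E}(\mathcal{K}(t))$. Here $\zeta_3 = \frac{\mathrm{i}\sqrt{3}-1}{2}$ and $2^{1/3}$ is the real cube root of $2$. *)

theory Defs
  imports
    "HOL-Algebra.Algebra"
    "HOL-Algebra.Algebraic_Closure_Type"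
    "HOL-Analysis.Analysis"
begin

section \<open>Elliptic curves in short Weierstrass form\<close>

datatype 'a weierstrass = Weierstrass (wcoeff_a: 'a) (wcoeff_b: 'a)

datatype 'a ec_point = Infinity | Affine 'a 'a

text \<open>The curve \<open>Weierstrass a b\<close> is $y^2 = x^3 + a x + b$; over a field of characteristic 0
  every elliptic curve has such an equation.\<close>

definition elliptic_curve_over :: "'a::field set \<Rightarrow> 'a weierstrass \<Rightarrow> bool" where
  "elliptic_curve_over F E \<longleftrightarrow>
     wcoeff_a E \<in> F \<and> wcoeff_b E \<in> F \<and> 4 * wcoeff_a E ^ 3 + 27 * wcoeff_b E ^ 2 \<noteq> 0"

definition rational_points :: "'a::field weierstrass \<Rightarrow> 'a set \<Rightarrow> 'a ec_point set" where
  "rational_points E F =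
     insert Infinity {Affine x y | x y. x \<in> F \<and> y \<in> F \<and> y ^ 2 = x ^ 3 + wcoeff_a E * x + wcoeff_b E}"

text \<open>The chord-tangent law. In the last equation, if \<open>x1 = x2\<close> and both points lie on the curve,
  then \<open>y1 = y2 \<noteq> 0\<close>, so the slope is that of the tangent line.\<close>

fun ec_add :: "'a::field weierstrass \<Rightarrow> 'a ec_point \<Rightarrow> 'a ec_point \<Rightarrow> 'a ec_point" where
  "ec_add E Infinity Q = Q"
| "ec_add E P Infinity = P"
| "ec_add E (Affine x1 y1) (Affine x2 y2) =
     (if x1 = x2 \<and> y1 = - y2 then Infinity
      else
        let m = (if x1 = x2 then (3 * x1 ^ 2 + wcoeff_a E) / (2 * y1) else (y2 - y1) / (x2 - x1));
            x3 = m ^ 2 - x1 - x2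
        in Affine x3 (m * (x1 - x3) - y1))"

text \<open>\<open>E(F)\<close>, written multiplicatively following HOL-Algebra: the multiple \<open>n P\<close> is \<open>P [^] n\<close>.\<close>

definition rational_points_group :: "'a::field weierstrass \<Rightarrow> 'a set \<Rightarrow> 'a ec_point monoid" where
  "rational_points_group E F =
     \<lparr>carrier = rational_points E F, monoid.mult = ec_add E, one = Infinity\<rparr>"


section \<open>Independence and rank in abelian groups\<close>

definition int_independent :: "('g, 'm) monoid_scheme \<Rightarrow> 'g set \<Rightarrow> bool" where
  "int_independent G S \<longleftrightarrow>
     finite S \<and> S \<subseteq> carrier G \<and>
     (\<forall>c :: 'g \<Rightarrow> int. finprod G (\<lambda>P. P [^]\<^bsub>G\<^esub> c P) S = \<one>\<^bsub>G\<^esub> \<longrightarrow> (\<forall>P\<in>S. c P = 0))"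

text \<open>The supremum of the sizes of the finite independent sets, i.e. the torsion-free rank.
  It is taken in \<open>enat\<close>, so that a finite value also says that the sizes are bounded.\<close>

definition abelian_rank :: "('g, 'm) monoid_scheme \<Rightarrow> enat" where
  "abelian_rank G = (SUP S \<in> {S. int_independent G S}. enat (card S))"

definition independent_generators :: "('g, 'm) monoid_scheme \<Rightarrow> 'g set \<Rightarrow> bool" where
  "independent_generators G S \<longleftrightarrow> int_independent G S \<and> generate G S = carrier G"


section \<open>Function fields and the splitting field\<close>

abbreviation complex_field :: "complex ring" where
  "complex_field \<equiv> ring_of_type_algebra"

text \<open>The field \<open>\<complex>(t)\<close> is the type \<open>complex poly fract\<close>.\<close>

type_synonym ratfun = "complex poly fract"

definition ratfun_const :: "complex \<Rightarrow> ratfun" where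
  "ratfun_const c = to_fract [:c:]"

definition tvar :: ratfun where
  "tvar = to_fract [:0, 1:]"

text \<open>For a subfield \<open>K\<close> of \<open>\<complex>\<close>, this is the subfield \<open>K(t)\<close> of \<open>\<complex>(t)\<close>.\<close>

definition ratfuns_over :: "complex set \<Rightarrow> ratfun set" where
  "ratfuns_over K = {Fract p q | p q. set (coeffs p) \<subseteq> K \<and> set (coeffs q) \<subseteq> K \<and> q \<noteq> 0}"

text \<open>Here \<open>k\<close> is a number field, \<open>E\<close> is defined over \<open>k(t)\<close>, and \<open>K\<close> is a finite extension of \<open>k\<close>
  inside \<open>\<complex>\<close> with \<open>E(\<complex>(t)) = E(K(t))\<close>; the splitting field is the least such \<open>K\<close>.\<close>

definition splits_over :: "complex set \<Rightarrow> ratfun weierstrass \<Rightarrow> complex set \<Rightarrow> bool" where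
  "splits_over k E K \<longleftrightarrow>
     subfield K complex_field \<and> k \<subseteq> K \<and> ring.finite_dimension complex_field k K \<and>
     rational_points E UNIV = rational_points E (ratfuns_over K)"

definition is_splitting_field :: "complex set \<Rightarrow> ratfun weierstrass \<Rightarrow> complex set \<Rightarrow> bool" where
  "is_splitting_field k E K \<longleftrightarrow> splits_over k E K \<and> (\<forall>L. splits_over k E L \<longrightarrow> K \<subseteq> L)"


section \<open>The curves and points\<close>

definition curve_E :: "nat \<Rightarrow> ratfun weierstrass" where
  "curve_E n = Weierstrass 0 (tvar ^ n + 1 / tvar ^ n)"

definition zeta3 :: complex where
  "zeta3 = (\<i> * complex_of_real (sqrt 3) - 1) / 2"

definition cbrt2 :: complex where
  "cbrt2 = complex_of_real (root 3 2)"

definition field_K2 :: "complex set" where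
  "field_K2 = generate_field complex_field (\<rat> \<union> {zeta3, cbrt2})"

definition point_P1 :: "ratfun ec_point" where
  "point_P1 = Affine (ratfun_const cbrt2) (tvar + 1 / tvar)"

definition point_P2 :: "ratfun ec_point" where
  "point_P2 = Affine (ratfun_const (zeta3 * cbrt2)) (tvar + 1 / tvar)"

definition point_P3 :: "ratfun ec_point" where
  "point_P3 = Affine (ratfun_const (- cbrt2)) (tvar - 1 / tvar)"

definition point_P4 :: "ratfun ec_point" where
  "point_P4 = Affine (ratfun_const (- (zeta3 ^ 2) * cbrt2)) (tvar - 1 / tvar)"


section \<open>Well-definedness of the data\<close>

lemma tvar_nonzero: "tvar \<noteq> 0"
  unfolding tvar_def by simp

lemma tvar_power: "tvar ^ n = to_fract (Polynomial.monom 1 n)"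
proof (induction n)
  case (Suc n)
  have "tvar ^ Suc n = to_fract ([:0, 1:] * Polynomial.monom 1 n)"
    using Suc by (simp only: power_Suc tvar_def to_fract_mult)
  also have "[:0, 1:] * Polynomial.monom 1 n = (Polynomial.monom 1 (Suc n) :: complex poly)"
    by (simp add: monom_Suc)
  finally show ?case .
qed simp

lemma curve_E_coeff:
  "tvar ^ n + 1 / tvar ^ n = Fract (Polynomial.monom 1 (2 * n) + 1) (Polynomial.monom 1 n)"
proof -
  have *: "Fract p q = to_fract p / to_fract q" if "q \<noteq> 0" for p q :: "complex poly"
    using that by (simp add: to_fract_def)
  have "Fract (Polynomial.monom 1 (2 * n) + 1) (Polynomial.monom 1 n) = (tvar ^ (2 * n) + 1) / tvar ^ n"
    by (subst *) (simp_all add: tvar_power)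
  also have "\<dots> = tvar ^ n + 1 / tvar ^ n"
    using tvar_nonzero unfolding mult_2 power_add by (simp add: field_simps)
  finally show ?thesis ..
qed

lemma elliptic_curve_E: "elliptic_curve_over (ratfuns_over \<rat>) (curve_E n)"
proof -
  have "set (coeffs (Polynomial.monom 1 (2 * n) + 1 :: complex poly)) \<subseteq> \<rat>"
    and "set (coeffs (Polynomial.monom 1 n :: complex poly)) \<subseteq> \<rat>"
    by (auto simp: coeffs_def coeff_monom Polynomial.coeff_1)
  hence b: "tvar ^ n + 1 / tvar ^ n \<in> ratfuns_over \<rat>"
    unfolding curve_E_coeff ratfuns_over_def
    by (intro CollectI exI conjI) (rule refl, auto)
  have zero: "0 \<in> ratfuns_over \<rat>"
    unfolding ratfuns_over_def Zero_fract_def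
    by (intro CollectI exI[of _ 0] exI[of _ 1] conjI) (simp_all add: coeffs_def)
  have "poly (Polynomial.monom 1 (2 * n) + 1 :: complex poly) 1 \<noteq> 0"
    by (simp add: poly_monom)
  hence "(Polynomial.monom 1 (2 * n) + 1 :: complex poly) \<noteq> 0"
    by (metis poly_0)
  hence "tvar ^ n + 1 / tvar ^ n \<noteq> 0"
    unfolding curve_E_coeff by (simp add: Zero_fract_def eq_fract)
  moreover have "(27 :: ratfun) \<noteq> 0"
  proof -
    have "to_fract (of_nat m :: complex poly) = of_nat m" for m
      by (induction m) simp_all
    from this[of 27] have "(27 :: ratfun) = to_fract 27"
      by simp
    moreover have "to_fract (27 :: complex poly) \<noteq> 0"
      unfolding to_fract_eq_0_iff by simp
    ultimately show ?thesis
      by metis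
  qed
  ultimately show ?thesis
    using b zero by (simp add: elliptic_curve_over_def curve_E_def)
qed

end

theory Submission
  imports Defs
begin

text \<open>
  A point \<open>(x, y)\<close> of \<open>y\<^sup>2 = x\<^sup>3 + f\<close> over \<open>\<complex>(t)\<close> is a map from the curve \<open>w\<^sup>6 = f\<close> to the constant curve
  \<open>Y\<^sup>2 = X\<^sup>3 + 1\<close>, and pulling back \<open>dX / Y\<close> gives an injective homomorphism \<open>logd\<close> from the
  Mordell-Weil group to \<open>\<complex>(t)\<close>; in particular it yields associativity of the chord-tangent law. For
  \<open>f = t\<^sup>2 + t\<^sup>-\<^sup>2\<close> the image consists of holomorphic differentials \<open>(a + b t + c t\<^sup>2) / (t\<^sup>4 + 1)\<close>. The part
  odd under \<open>t \<mapsto> - t\<close> comes from the first curve by \<open>t \<mapsto> t\<^sup>2\<close>, and the parts symmetric and antisymmetric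
  under \<open>t \<mapsto> 1 / t\<close> come from \<open>y\<^sup>2 = x\<^sup>3 + s\<^sup>2 - 2\<close> by \<open>s = t + 1 / t\<close>, directly or after \<open>t \<mapsto> \<i> t\<close>.

  On these two quotients \<open>logd\<close> is a complex number times a fixed function, and its image is bounded
  away from 0: if the number is small, then \<open>1 / X\<^sup>3 = f / x\<^sup>3\<close> cannot grow from 0 at a zero or pole of \<open>f\<close> to
  a pole along a ray. For the first curve the image is a module over \<open>\<int>[\<zeta>\<^sub>1\<^sub>2]\<close>, whose multiplication by
  \<open>1 - \<zeta>\<^sub>1\<^sub>2\<close> contracts, so it is 0. For \<open>f = s\<^sup>2 - 2\<close> the bound is sharp enough that, since every complex
  number is within \<open>1 / sqrt 3\<close> of \<open>\<int>[\<zeta>\<^sub>3]\<close>, the point \<open>(2\<^sup>1\<^sup>/\<^sup>3, s)\<close> generates over \<open>\<int>[\<zeta>\<^sub>3]\<close>. This determines the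
  group of the second curve up to division by 2, which the duplication formula excludes.
\<close>

section \<open>Rational functions\<close>

text \<open>No sixth root of f is ever formed: g = f / x^3, which is 1 / X^3, satisfies g'^6 = 729
  logd^6 f g^5 (1 + g)^3 (\<open>coord_ode\<close>), an equation over \<complex>(t). Along a path it
  bounds the growth of |g|, and an explicit h growing at least as fast keeps |g| finite. The gap
  around 0 obtained in this way does the work usually left to heights; no finiteness of the
  Mordell-Weil group is presupposed. The argument needs a pole of g to run into. If g is a
  polynomial, degrees decide: impossible on the first curve, and for f = s^2 - 2 only constant x
  with x^3 = 2, where logd = c / (s^2 - 2) with 729 c^6 = 256. Reduction modulo Z[zeta3] leaves at
  most 1/27 of that, whence the threshold 256/27. On the first curve any positive threshold would
  do, so its constants are crude. The factor 2 arises because adding to a point its image under an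
  involution isolates a component only doubled. Modulo 2, Z[zeta3] consists of 0 and the cube roots
  of unity, so the 15 classes to exclude contain points with constant x or sums of two of these, all
  with x-coordinate A / t^2 + B.\<close>

lemma ratfun_cases:
  fixes x :: "'a::{field_gcd} poly fract"
  obtains p q where "x = to_fract p / to_fract q" "q \<noteq> 0" "coprime p q"
proof (rule that[of "fst (quot_of_fract x)" "snd (quot_of_fract x)"])
  show "x = to_fract (fst (quot_of_fract x)) / to_fract (snd (quot_of_fract x))"
    by (metis Fract_conv_to_fract Fract_quot_of_fract)
qed (auto simp: coprime_quot_of_fract)

lemma to_fract_quot_eq_iff:
  fixes p q p' q' :: "'a::idom"
  assumes "q \<noteq> 0" "q' \<noteq> 0"
  shows "to_fract p / to_fract q = to_fract p' / to_fract q' \<longleftrightarrow> p * q' = p' * q"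
  using assms by (metis Fract_conv_to_fract eq_fract(1))

lemma to_fract_power [simp]: "to_fract (x ^ n) = to_fract x ^ n"
  by (induction n) auto

lemma to_fract_of_nat [simp]: "to_fract (of_nat n) = of_nat n"
  by (induction n) auto

lemma to_fract_numeral [simp]: "to_fract (numeral n) = numeral n"
  by (metis of_nat_numeral to_fract_of_nat)

lemma ratfun_const_simps [simp]:
  "ratfun_const 0 = 0" "ratfun_const 1 = 1"
  "ratfun_const (a + b) = ratfun_const a + ratfun_const b"
  "ratfun_const (a - b) = ratfun_const a - ratfun_const b"
  "ratfun_const (- a) = - ratfun_const a"
  "ratfun_const (a * b) = ratfun_const a * ratfun_const b"
  "ratfun_const a = ratfun_const b \<longleftrightarrow> a = b"
  unfolding ratfun_const_def
  by (simp_all flip: to_fract_add to_fract_diff to_fract_uminus to_fract_mult one_pCons)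

lemma ratfun_const_power [simp]: "ratfun_const (a ^ n) = ratfun_const a ^ n"
  by (induction n) auto

lemma ratfun_const_of_nat [simp]: "ratfun_const (of_nat n) = of_nat n"
  by (induction n) auto

lemma ratfun_const_of_int [simp]: "ratfun_const (of_int n) = of_int n"
  by (cases n) (auto simp del: of_nat_Suc)

lemma ratfun_const_numeral [simp]: "ratfun_const (numeral n) = numeral n"
  by (metis of_nat_numeral ratfun_const_of_nat)

lemma ratfun_const_eq_0_iff [simp]: "ratfun_const a = 0 \<longleftrightarrow> a = 0"
  by (metis ratfun_const_simps(1,7))

lemma ratfun_const_divide [simp]: "ratfun_const (a / b) = ratfun_const a / ratfun_const b"
proof (cases "b = 0")
  case False
  have "ratfun_const (a / b) * ratfun_const b = ratfun_const a"
    using False by (simp flip: ratfun_const_simps(6))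
  thus ?thesis using False by (simp add: nonzero_eq_divide_eq)
qed auto

lemma ratfun_numeral_eq_0_iff [simp]: "(numeral n :: ratfun) \<noteq> 0"
  by (metis ratfun_const_numeral ratfun_const_eq_0_iff zero_neq_numeral)

lemma to_fract_pCons: "to_fract (pCons a p) = ratfun_const a + tvar * to_fract p"
proof -
  have "pCons a p = [:a:] + [:0, 1:] * p" by simp
  thus ?thesis by (simp only: to_fract_add to_fract_mult ratfun_const_def tvar_def)
qed

subsection \<open>The derivation\<close>

definition rat_deriv :: "'a::field_gcd poly fract \<Rightarrow> 'a poly fract" where
  "rat_deriv x = (let (p, q) = quot_of_fract x
     in to_fract (pderiv p * q - p * pderiv q) / to_fract q ^ 2)"

lemma rat_deriv_to_fract_quot:
  assumes "q \<noteq> 0"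
  shows "rat_deriv (to_fract p / to_fract q) = to_fract (pderiv p * q - p * pderiv q) / to_fract q ^ 2"
proof -
  define x where "x = to_fract p / to_fract q"
  obtain r s where rs: "quot_of_fract x = (r, s)" by fastforce
  have s: "s \<noteq> 0" using snd_quot_of_fract_nonzero[of x] rs by simp
  have "to_fract r / to_fract s = x"
    using Fract_quot_of_fract[of x] by (simp add: rs Fract_conv_to_fract)
  hence eq: "p * s = r * q" using s assms by (simp add: x_def to_fract_quot_eq_iff)
  have d: "pderiv p * s + p * pderiv s = pderiv r * q + r * pderiv q"
    using arg_cong[OF eq, of pderiv] by (simp add: pderiv_mult algebra_simps)
  have "((pderiv p * q - p * pderiv q) * s\<^sup>2 - (pderiv r * s - r * pderiv s) * q\<^sup>2) =
      q * s * (pderiv p * s + p * pderiv s - (pderiv r * q + r * pderiv q))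
      - (p * s - r * q) * (s * pderiv q + q * pderiv s)"
    by (simp add: algebra_simps power2_eq_square)
  also have "\<dots> = 0" unfolding d eq by simp
  finally have "(pderiv r * s - r * pderiv s) * q\<^sup>2 = (pderiv p * q - p * pderiv q) * s\<^sup>2"
    by simp
  moreover have "rat_deriv x = to_fract (pderiv r * s - r * pderiv s) / to_fract (s\<^sup>2)"
    by (simp add: rat_deriv_def rs)
  ultimately show ?thesis
    using to_fract_quot_eq_iff[of "s\<^sup>2" "q\<^sup>2"] s assms by (simp add: x_def[symmetric] del: to_fract_mult to_fract_diff)
qed

lemma rat_deriv_to_fract [simp]: "rat_deriv (to_fract p) = to_fract (pderiv p)"
  using rat_deriv_to_fract_quot[of 1 p] by simp

lemma rat_deriv_const [simp]: "rat_deriv (ratfun_const c) = 0"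
  by (simp add: ratfun_const_def pderiv_pCons)

lemma rat_deriv_tvar [simp]: "rat_deriv tvar = 1"
  by (simp add: tvar_def pderiv_pCons flip: one_pCons)

lemma rat_deriv_add [simp]: "rat_deriv (x + y) = rat_deriv x + rat_deriv y"
proof -
  obtain p q where x: "x = to_fract p / to_fract q" "q \<noteq> 0" by (rule ratfun_cases)
  obtain r s where y: "y = to_fract r / to_fract s" "s \<noteq> 0" by (rule ratfun_cases)
  have "x + y = to_fract (p * s + r * q) / to_fract (q * s)"
    using x y by (simp add: add_frac_eq)
  hence 1: "rat_deriv (x + y) = to_fract (pderiv (p * s + r * q) * (q * s) - (p * s + r * q) * pderiv (q * s))
      / to_fract (q * s) ^ 2"
    using x y rat_deriv_to_fract_quot[of "q * s" "p * s + r * q"] by simp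
  show ?thesis unfolding 1 unfolding x(1) y(1) using x(2) y(2)
    by (simp add: rat_deriv_to_fract_quot pderiv_add pderiv_mult divide_simps)
       (simp add: algebra_simps power2_eq_square)
qed

lemma rat_deriv_mult [simp]: "rat_deriv (x * y) = rat_deriv x * y + x * rat_deriv y"
proof -
  obtain p q where x: "x = to_fract p / to_fract q" "q \<noteq> 0" by (rule ratfun_cases)
  obtain r s where y: "y = to_fract r / to_fract s" "s \<noteq> 0" by (rule ratfun_cases)
  have "x * y = to_fract (p * r) / to_fract (q * s)"
    using x y by simp
  hence 1: "rat_deriv (x * y) = to_fract (pderiv (p * r) * (q * s) - (p * r) * pderiv (q * s))
      / to_fract (q * s) ^ 2"
    using x y rat_deriv_to_fract_quot[of "q * s" "p * r"] by simp
  show ?thesis unfolding 1 unfolding x(1) y(1) using x(2) y(2)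
    by (simp add: rat_deriv_to_fract_quot pderiv_add pderiv_mult divide_simps)
       (simp add: algebra_simps power2_eq_square)
qed

lemma rat_deriv_0 [simp]: "rat_deriv 0 = 0" and rat_deriv_1 [simp]: "rat_deriv 1 = 0"
  using rat_deriv_to_fract[of 0] rat_deriv_to_fract[of 1] by simp_all

lemma rat_deriv_of_nat [simp]: "rat_deriv (of_nat n) = 0"
  by (induction n) auto

lemma rat_deriv_numeral [simp]: "rat_deriv (numeral n) = 0"
  by (metis of_nat_numeral rat_deriv_of_nat)

lemma rat_deriv_minus [simp]: "rat_deriv (- x) = - rat_deriv x"
proof -
  have "rat_deriv (- x) + rat_deriv x = 0" by (simp flip: rat_deriv_add)
  thus ?thesis by (simp add: eq_neg_iff_add_eq_0)
qed

lemma rat_deriv_diff [simp]: "rat_deriv (x - y) = rat_deriv x - rat_deriv y"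
  using rat_deriv_add[of x "- y"] by simp

lemma rat_deriv_power: "rat_deriv (x ^ n) = of_nat n * x ^ (n - 1) * rat_deriv x"
proof (induction n)
  case (Suc n)
  thus ?case by (cases n) (simp_all add: algebra_simps)
qed simp

lemma rat_deriv_divide:
  assumes "y \<noteq> 0"
  shows "rat_deriv (x / y) = (rat_deriv x * y - x * rat_deriv y) / y ^ 2"
proof -
  have "rat_deriv x = rat_deriv (x / y * y)" using assms by simp
  also have "\<dots> = rat_deriv (x / y) * y + x / y * rat_deriv y" by (simp only: rat_deriv_mult)
  finally show ?thesis using assms by (simp add: field_simps power2_eq_square)
qed

text \<open>In lowest terms p' q = p q' forces q to divide q', which degrees forbid unless q' = 0;
  then p' = 0 as well.\<close>

lemma rat_deriv_eq_0_iff: "rat_deriv x = 0 \<longleftrightarrow> (\<exists>c. x = ratfun_const c)"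
proof
  assume 0: "rat_deriv x = 0"
  obtain p q where x: "x = to_fract p / to_fract q" and q: "q \<noteq> 0" and "coprime p q"
    by (rule ratfun_cases)
  from 0 q have eq: "pderiv p * q = p * pderiv q"
    by (simp add: x rat_deriv_to_fract_quot flip: to_fract_mult)
  hence "q dvd p * pderiv q" by (metis dvd_triv_right)
  with \<open>coprime p q\<close> have "q dvd pderiv q"
    using coprime_commute coprime_dvd_mult_right_iff by blast
  hence "pderiv q = 0"
    by (metis not_dvd_pderiv pderiv_eq_0_iff gr0I)
  then obtain d where d: "q = [:d:]" by (meson degree_0_id pderiv_eq_0_iff degree_eq_zeroE)
  with eq q have "pderiv p = 0" by (simp add: pderiv_pCons)
  then obtain c where c: "p = [:c:]" by (meson pderiv_eq_0_iff degree_eq_zeroE)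
  have "x = ratfun_const (c / d)" using x c d by (simp add: ratfun_const_def[symmetric])
  thus "\<exists>c. x = ratfun_const c" ..
qed auto

subsection \<open>Substitution\<close>

definition nonconst :: "ratfun \<Rightarrow> bool" where
  "nonconst \<phi> \<longleftrightarrow> (\<forall>c. \<phi> \<noteq> ratfun_const c)"

definition poly_subst :: "ratfun \<Rightarrow> complex poly \<Rightarrow> ratfun" where
  "poly_subst \<phi> p = poly (map_poly ratfun_const p) \<phi>"

lemma poly_subst_pCons [simp]: "poly_subst \<phi> (pCons a p) = ratfun_const a + \<phi> * poly_subst \<phi> p"
  by (simp add: poly_subst_def map_poly_pCons)

lemma poly_subst_0 [simp]: "poly_subst \<phi> 0 = 0"
  by (simp add: poly_subst_def)

lemma poly_subst_1 [simp]: "poly_subst \<phi> 1 = 1"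
  by (simp add: one_pCons)

lemma poly_subst_add [simp]: "poly_subst \<phi> (p + q) = poly_subst \<phi> p + poly_subst \<phi> q"
  by (induction p q rule: poly_induct2) (simp_all add: algebra_simps)

lemma poly_subst_smult [simp]: "poly_subst \<phi> (Polynomial.smult c p) = ratfun_const c * poly_subst \<phi> p"
  by (induction p) (simp_all add: algebra_simps)

lemma poly_subst_mult [simp]: "poly_subst \<phi> (p * q) = poly_subst \<phi> p * poly_subst \<phi> q"
  by (induction p) (simp_all add: algebra_simps)

lemma poly_subst_tvar [simp]: "poly_subst tvar p = to_fract p"
  by (induction p) (simp_all add: to_fract_pCons)

text \<open>A rational function algebraic over \<complex> is constant: splitting off a root c of p
  leaves the factor \<open>\<phi> - ratfun_const c\<close>, which is nonzero.\<close>

lemma poly_subst_eq_0_iff: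
  assumes "nonconst \<phi>"
  shows "poly_subst \<phi> p = 0 \<longleftrightarrow> p = 0"
proof
  show "poly_subst \<phi> p = 0 \<Longrightarrow> p = 0"
  proof (induction "Polynomial.degree p" arbitrary: p)
    case 0
    then obtain c where "p = [:c:]" by (metis degree_eq_zeroE)
    thus ?case using 0 by simp
  next
    case (Suc n)
    then obtain c where "poly p c = 0"
      using fundamental_theorem_of_algebra[of p] by (auto simp: constant_degree)
    then obtain q where q: "p = [:-c, 1:] * q" by (metis dvdE poly_eq_0_iff_dvd)
    have "q \<noteq> 0" using q Suc.hyps by auto
    hence "n = Polynomial.degree q" using Suc.hyps(2) unfolding q by (subst (asm) degree_mult_eq) auto
    moreover have "poly_subst \<phi> q = 0"
    proof -
      have "(\<phi> - ratfun_const c) * poly_subst \<phi> q = 0"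
        using Suc.prems unfolding q poly_subst_mult by (simp add: algebra_simps)
      thus ?thesis using assms by (auto simp: nonconst_def)
    qed
    ultimately have "q = 0" using Suc.hyps(1) by blast
    thus ?case using q by simp
  qed
qed auto

text \<open>Composition x(\<phi>). It is a field homomorphism only if no denominator is sent to 0,
  which \<open>nonconst\<close> guarantees.\<close>

definition rat_subst :: "ratfun \<Rightarrow> ratfun \<Rightarrow> ratfun" where
  "rat_subst \<phi> x = poly_subst \<phi> (fst (quot_of_fract x)) / poly_subst \<phi> (snd (quot_of_fract x))"

context
  fixes \<phi> :: ratfun
  assumes nonconst: "nonconst \<phi>"
begin

lemma rat_subst_quot:
  assumes "q \<noteq> 0"
  shows "rat_subst \<phi> (to_fract p / to_fract q) = poly_subst \<phi> p / poly_subst \<phi> q"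
proof -
  define x where "x = to_fract p / to_fract q"
  define p' q' where "p' = fst (quot_of_fract x)" and "q' = snd (quot_of_fract x)"
  have q': "q' \<noteq> 0" by (simp add: q'_def)
  have "to_fract p' / to_fract q' = to_fract p / to_fract q"
    using Fract_conv_to_fract[of p' q'] by (simp add: p'_def q'_def flip: x_def)
  hence "p' * q = p * q'" using to_fract_quot_eq_iff assms q' by blast
  hence "poly_subst \<phi> p' * poly_subst \<phi> q = poly_subst \<phi> p * poly_subst \<phi> q'"
    by (metis poly_subst_mult)
  thus ?thesis unfolding rat_subst_def x_def[symmetric] p'_def[symmetric] q'_def[symmetric]
    using assms q' nonconst by (simp add: poly_subst_eq_0_iff frac_eq_eq)
qed

lemma rat_subst_to_fract [simp]: "rat_subst \<phi> (to_fract p) = poly_subst \<phi> p"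
  using rat_subst_quot[of 1 p] by simp

lemma rat_subst_const [simp]: "rat_subst \<phi> (ratfun_const c) = ratfun_const c"
  by (simp add: ratfun_const_def)

lemma rat_subst_tvar [simp]: "rat_subst \<phi> tvar = \<phi>"
  by (simp add: tvar_def)

lemma rat_subst_add [simp]: "rat_subst \<phi> (x + y) = rat_subst \<phi> x + rat_subst \<phi> y"
proof -
  obtain p q where x: "x = to_fract p / to_fract q" "q \<noteq> 0" by (rule ratfun_cases)
  obtain r s where y: "y = to_fract r / to_fract s" "s \<noteq> 0" by (rule ratfun_cases)
  have "x + y = to_fract (p * s + r * q) / to_fract (q * s)"
    using x y by (simp add: add_frac_eq)
  thus ?thesis using x y rat_subst_quot[of "q * s" "p * s + r * q"]
    by (simp add: rat_subst_quot add_frac_eq poly_subst_eq_0_iff[OF nonconst])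
qed

lemma rat_subst_mult [simp]: "rat_subst \<phi> (x * y) = rat_subst \<phi> x * rat_subst \<phi> y"
proof -
  obtain p q where x: "x = to_fract p / to_fract q" "q \<noteq> 0" by (rule ratfun_cases)
  obtain r s where y: "y = to_fract r / to_fract s" "s \<noteq> 0" by (rule ratfun_cases)
  have "x * y = to_fract (p * r) / to_fract (q * s)"
    using x y by simp
  thus ?thesis using x y rat_subst_quot[of "q * s" "p * r"]
    by (simp add: rat_subst_quot)
qed

lemma rat_subst_0 [simp]: "rat_subst \<phi> 0 = 0" and rat_subst_1 [simp]: "rat_subst \<phi> 1 = 1"
  using rat_subst_const[of 0] rat_subst_const[of 1] by (simp_all del: rat_subst_const)

lemma rat_subst_numeral [simp]: "rat_subst \<phi> (numeral n) = numeral n"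
  using rat_subst_const[of "numeral n"] by (simp del: rat_subst_const)

lemma rat_subst_minus [simp]: "rat_subst \<phi> (- x) = - rat_subst \<phi> x"
proof -
  have "rat_subst \<phi> (- x) + rat_subst \<phi> x = 0" by (simp flip: rat_subst_add)
  thus ?thesis by (simp add: eq_neg_iff_add_eq_0)
qed

lemma rat_subst_diff [simp]: "rat_subst \<phi> (x - y) = rat_subst \<phi> x - rat_subst \<phi> y"
  using rat_subst_add[of x "- y"] by simp

lemma rat_subst_power [simp]: "rat_subst \<phi> (x ^ n) = rat_subst \<phi> x ^ n"
  by (induction n) auto

lemma rat_subst_eq_0_iff [simp]: "rat_subst \<phi> x = 0 \<longleftrightarrow> x = 0"
proof -
  obtain p q where x: "x = to_fract p / to_fract q" "q \<noteq> 0" by (rule ratfun_cases)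
  thus ?thesis by (simp add: rat_subst_quot poly_subst_eq_0_iff[OF nonconst])
qed

lemma rat_subst_eq_iff [simp]: "rat_subst \<phi> x = rat_subst \<phi> y \<longleftrightarrow> x = y"
  using rat_subst_eq_0_iff[of "x - y"] by (simp del: rat_subst_eq_0_iff)

lemma rat_subst_divide [simp]: "rat_subst \<phi> (x / y) = rat_subst \<phi> x / rat_subst \<phi> y"
proof (cases "y = 0")
  case False
  have "rat_subst \<phi> (x / y) * rat_subst \<phi> y = rat_subst \<phi> x"
    using False by (simp flip: rat_subst_mult)
  thus ?thesis using False by (simp add: nonzero_eq_divide_eq)
qed simp

lemma rat_deriv_poly_subst: "rat_deriv (poly_subst \<phi> p) = poly_subst \<phi> (pderiv p) * rat_deriv \<phi>"
  by (induction p) (simp_all add: pderiv_pCons algebra_simps)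

lemma rat_deriv_subst: "rat_deriv (rat_subst \<phi> x) = rat_subst \<phi> (rat_deriv x) * rat_deriv \<phi>"
proof -
  obtain p q where x: "x = to_fract p / to_fract q" and q: "q \<noteq> 0" by (rule ratfun_cases)
  have q': "poly_subst \<phi> q \<noteq> 0" using q by (simp add: poly_subst_eq_0_iff[OF nonconst])
  show ?thesis
    using q q' by (simp add: x rat_deriv_divide rat_deriv_poly_subst field_simps)
qed

end

lemma nonconst_iff_deriv: "nonconst \<phi> \<longleftrightarrow> rat_deriv \<phi> \<noteq> 0"
  by (auto simp: nonconst_def rat_deriv_eq_0_iff)

lemma nonconst_tvar: "nonconst tvar"
  by (simp add: nonconst_iff_deriv)

lemma rat_subst_id [simp]: "rat_subst tvar x = x"
proof -
  obtain p q where x: "x = to_fract p / to_fract q" "q \<noteq> 0" by (rule ratfun_cases)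
  thus ?thesis by (simp add: nonconst_tvar)
qed

subsection \<open>Orders of vanishing\<close>

text \<open>Only finite points are covered; questions at infinity are moved to 0 by t ->
  1/t.\<close>

definition rord :: "complex \<Rightarrow> ratfun \<Rightarrow> int" where
  "rord z x = int (Polynomial.order z (fst (quot_of_fract x))) - int (Polynomial.order z (snd (quot_of_fract x)))"

lemma rord_quot:
  assumes "p \<noteq> 0" "q \<noteq> 0"
  shows "rord z (to_fract p / to_fract q) = int (Polynomial.order z p) - int (Polynomial.order z q)"
proof -
  define x where "x = to_fract p / to_fract q"
  obtain r s where rs: "quot_of_fract x = (r, s)" by fastforce
  have s: "s \<noteq> 0" using snd_quot_of_fract_nonzero[of x] rs by simp
  have "to_fract r / to_fract s = x"
    using Fract_quot_of_fract[of x] by (simp add: rs Fract_conv_to_fract)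
  hence eq: "p * s = r * q" using s assms by (simp add: x_def to_fract_quot_eq_iff)
  hence "r \<noteq> 0" using s assms by auto
  hence "Polynomial.order z p + Polynomial.order z s = Polynomial.order z r + Polynomial.order z q"
    using arg_cong[OF eq, of "Polynomial.order z"] s assms by (simp add: order_mult)
  thus ?thesis unfolding x_def[symmetric] by (simp add: rord_def rs)
qed

lemma rord_to_fract: "p \<noteq> 0 \<Longrightarrow> rord z (to_fract p) = int (Polynomial.order z p)"
  using rord_quot[of p 1 z] by simp

lemma rord_mult:
  assumes "x \<noteq> 0" "y \<noteq> 0"
  shows "rord z (x * y) = rord z x + rord z y"
proof -
  obtain p q where x: "x = to_fract p / to_fract q" "q \<noteq> 0" by (rule ratfun_cases)
  obtain r s where y: "y = to_fract r / to_fract s" "s \<noteq> 0" by (rule ratfun_cases)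
  have [simp]: "p \<noteq> 0" "r \<noteq> 0" using assms x y by auto
  show ?thesis using x y rord_quot[of "p * r" "q * s" z]
    by (simp add: rord_quot order_mult)
qed

lemma rord_const [simp]: "c \<noteq> 0 \<Longrightarrow> rord z (ratfun_const c) = 0"
  by (auto simp: ratfun_const_def rord_to_fract order_0I)

lemma rord_numeral [simp]: "rord z (numeral n) = 0"
  using rord_const[of "numeral n" z] by (simp del: rord_const)

lemma rord_1 [simp]: "rord z 1 = 0"
  using rord_const[of 1 z] by (simp del: rord_const)

lemma rord_divide: "x \<noteq> 0 \<Longrightarrow> y \<noteq> 0 \<Longrightarrow> rord z (x / y) = rord z x - rord z y"
  using rord_mult[of "x / y" y z] by auto

lemma rord_power: "x \<noteq> 0 \<Longrightarrow> rord z (x ^ n) = int n * rord z x"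
  by (induction n) (auto simp: rord_mult algebra_simps)

lemma rord_minus [simp]: "rord z (- x) = rord z x"
  using rord_mult[of "-1" x z] rord_const[of "-1" z]
  by (cases "x = 0") (auto simp del: rord_const)

definition rord_ge :: "complex \<Rightarrow> int \<Rightarrow> ratfun \<Rightarrow> bool" where
  "rord_ge z k x \<longleftrightarrow> x = 0 \<or> k \<le> rord z x"

lemma rord_ge_add:
  assumes "rord_ge z k x" "rord_ge z k y"
  shows "rord_ge z k (x + y)"
proof (cases "x = 0 \<or> y = 0 \<or> x + y = 0")
  case False
  obtain p q where x: "x = to_fract p / to_fract q" "q \<noteq> 0" by (rule ratfun_cases)
  obtain r s where y: "y = to_fract r / to_fract s" "s \<noteq> 0" by (rule ratfun_cases)
  have [simp]: "p \<noteq> 0" "r \<noteq> 0" using False x y by auto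
  have xy: "x + y = to_fract (p * s + r * q) / to_fract (q * s)"
    using x y by (simp add: add_frac_eq)
  have nz: "p * s + r * q \<noteq> 0"
  proof
    assume "p * s + r * q = 0"
    thus False using False unfolding xy by (simp del: to_fract_add to_fract_mult)
  qed
  define m where "m = min (Polynomial.order z (p * s)) (Polynomial.order z (r * q))"
  have "[:-z, 1:] ^ m dvd p * s" "[:-z, 1:] ^ m dvd r * q"
    using x y by (auto simp: m_def order_divides)
  hence "[:-z, 1:] ^ m dvd p * s + r * q" by (rule dvd_add)
  hence "m \<le> Polynomial.order z (p * s + r * q)" using nz by (simp add: order_divides)
  moreover have "k + int (Polynomial.order z (q * s)) \<le> m"
    using assms False x y by (auto simp: rord_ge_def rord_quot order_mult m_def)
  ultimately show ?thesis using nz x y unfolding xy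
    by (simp add: rord_ge_def rord_quot del: to_fract_add to_fract_mult)
qed (use assms in \<open>auto simp: rord_ge_def\<close>)

lemma rord_ge_minus [simp]: "rord_ge z k (- x) \<longleftrightarrow> rord_ge z k x"
  by (simp add: rord_ge_def)

lemma rord_ge_diff: "rord_ge z k x \<Longrightarrow> rord_ge z k y \<Longrightarrow> rord_ge z k (x - y)"
  using rord_ge_add[of z k x "- y"] by simp

lemma rord_ge_mult: "rord_ge z k x \<Longrightarrow> rord_ge z l y \<Longrightarrow> rord_ge z (k + l) (x * y)"
  by (auto simp: rord_ge_def rord_mult)

lemma rord_ge_mono: "rord_ge z k x \<Longrightarrow> l \<le> k \<Longrightarrow> rord_ge z l x"
  by (auto simp: rord_ge_def)

lemma rord_ge_rord: "rord_ge z (rord z x) x"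
  by (auto simp: rord_ge_def)

lemma rord_ge_to_fract [simp]: "rord_ge z 0 (to_fract p)"
  by (cases "p = 0") (auto simp: rord_ge_def rord_to_fract)

lemma rord_ge_divide:
  "rord_ge z k x \<Longrightarrow> y \<noteq> 0 \<Longrightarrow> rord_ge z (k - rord z y) (x / y)"
  by (auto simp: rord_ge_def rord_divide)

text \<open>The ultrametric equality: were the order of x + y larger, x = (x + y) - y would have an
  order above its own.\<close>

lemma rord_add_eq:
  assumes "x \<noteq> 0" "rord_ge z k y" "rord z x < k"
  shows "x + y \<noteq> 0" "rord z (x + y) = rord z x"
proof -
  show nz: "x + y \<noteq> 0"
  proof
    assume "x + y = 0"
    hence "y = - x" by (simp add: eq_neg_iff_add_eq_0 add.commute)
    thus False using assms by (auto simp: rord_ge_def)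
  qed
  have "rord_ge z (rord z x) (x + y)"
    using assms by (intro rord_ge_add) (auto simp: rord_ge_def)
  moreover have "\<not> rord_ge z (min k (rord z (x + y))) x" if "rord z (x + y) > rord z x"
    using assms that by (auto simp: rord_ge_def)
  moreover have "rord_ge z (min k (rord z (x + y))) ((x + y) - y)"
    using assms(2) by (intro rord_ge_diff) (auto intro: rord_ge_mono simp: rord_ge_def)
  ultimately show "rord z (x + y) = rord z x" using nz by (force simp: rord_ge_def)
qed

lemma rord_ge_deriv:
  assumes "rord_ge z k x"
  shows "rord_ge z (k - 1) (rat_deriv x)"
proof (cases "x = 0")
  case False
  obtain p q where x: "x = to_fract p / to_fract q" and q: "q \<noteq> 0" by (rule ratfun_cases)
  have p: "p \<noteq> 0" using False x by auto
  have deriv: "rord_ge z (int (Polynomial.order z r) - 1) (to_fract (pderiv r))" if "r \<noteq> 0" for r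
  proof -
    have "pderiv r = 0 \<or> Polynomial.order z (pderiv r) = Polynomial.order z r - 1
        \<or> Polynomial.order z r = 0"
      using order_pderiv[OF that, of z] that by (cases "poly r z = 0") (auto simp: order_0I)
    thus ?thesis
      by (auto simp: rord_ge_def rord_to_fract)
  qed
  have o: "rord_ge z (int (Polynomial.order z r)) (to_fract r)" for r
    using rord_ge_rord[of z "to_fract r"] by (cases "r = 0") (auto simp: rord_to_fract rord_ge_def)
  have 1: "rord_ge z (int (Polynomial.order z p) - 1 + int (Polynomial.order z q)) (to_fract (pderiv p) * to_fract q)"
    using deriv[OF p] o by (rule rord_ge_mult)
  have 2: "rord_ge z (int (Polynomial.order z p) - 1 + int (Polynomial.order z q)) (to_fract p * to_fract (pderiv q))"
    using rord_ge_mult[OF o[of p] deriv[OF q]] by (simp add: algebra_simps)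
  have "rord_ge z (int (Polynomial.order z p) - 1 + int (Polynomial.order z q) - rord z (to_fract q ^ 2)) (rat_deriv x)"
    unfolding x using rord_ge_divide[OF rord_ge_diff[OF 1 2], of "to_fract q ^ 2"] q
    by (simp add: rat_deriv_to_fract_quot)
  moreover have "k \<le> int (Polynomial.order z p) - int (Polynomial.order z q)"
    using assms False p q by (simp add: x rord_ge_def rord_quot)
  ultimately show ?thesis
    using q by (elim rord_ge_mono) (simp add: rord_power rord_to_fract)
qed (auto simp: rord_ge_def)

text \<open>Order 0 is the bound at which nothing is lost, in contrast to
  \<open>rord_ge_deriv\<close>: the reduced denominator q does not vanish at z, and neither does the
  denominator q^2 of the derivative.\<close>

lemma rord_ge_0_deriv:
  assumes "rord_ge z 0 x"
  shows "rord_ge z 0 (rat_deriv x)"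
proof -
  obtain p q where x: "x = to_fract p / to_fract q" "q \<noteq> 0" "coprime p q" by (rule ratfun_cases)
  have "poly q z \<noteq> 0"
  proof
    assume z: "poly q z = 0"
    hence pz: "poly p z \<noteq> 0" using x(3) by (metis coprime_poly_0)
    hence "Polynomial.order z p = 0" "p \<noteq> 0" by (auto simp: order_root)
    moreover have "Polynomial.order z q > 0" using z x by (simp add: order_root)
    ultimately show False using assms x by (auto simp: rord_ge_def rord_quot)
  qed
  hence "rord z (to_fract q ^ 2) = 0" using x(2) by (simp add: rord_power rord_to_fract order_0I)
  moreover have "rord_ge z (0 - rord z (to_fract q ^ 2)) (rat_deriv x)"
    unfolding x(1) rat_deriv_to_fract_quot[OF x(2)] using x(2) by (intro rord_ge_divide) (auto simp del: to_fract_diff to_fract_mult)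
  ultimately show ?thesis by simp
qed

text \<open>A reduced denominator without zeros in \<complex> is constant.\<close>

lemma rord_ge_0_imp_poly:
  assumes "\<And>z. rord_ge z 0 x"
  obtains p where "x = to_fract p"
proof -
  obtain p q where x: "x = to_fract p / to_fract q" "q \<noteq> 0" "coprime p q" by (rule ratfun_cases)
  have "poly q z \<noteq> 0" for z
  proof
    assume z: "poly q z = 0"
    hence pz: "poly p z \<noteq> 0" using x(3) by (metis coprime_poly_0)
    hence "Polynomial.order z p = 0" "p \<noteq> 0" by (auto simp: order_root)
    moreover have "Polynomial.order z q > 0" using z x by (simp add: order_root)
    ultimately show False using assms[of z] x by (auto simp: rord_ge_def rord_quot)
  qed
  hence "Polynomial.degree q = 0" by (meson fundamental_theorem_of_algebra_alt constant_degree fundamental_theorem_of_algebra)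
  then obtain c where c: "q = [:c:]" by (metis degree_eq_zeroE)
  hence "x = to_fract (Polynomial.smult (1 / c) p)"
    using x to_fract_quot_eq_iff[of q 1 p "Polynomial.smult (1 / c) p"] by simp
  thus ?thesis by (rule that)
qed

lemma poly_degree_le_2:
  assumes "Polynomial.degree p \<le> 2"
  shows "p = [:Polynomial.coeff p 0, Polynomial.coeff p 1, Polynomial.coeff p 2:]"
proof (rule poly_eqI)
  have "Polynomial.coeff p n = 0" if "n > 2" for n using that assms by (intro coeff_eq_0) simp
  thus "Polynomial.coeff p n = Polynomial.coeff [:Polynomial.coeff p 0, Polynomial.coeff p 1, Polynomial.coeff p 2:] n" for n
    by (auto simp: coeff_pCons numeral_2_eq_2 split: nat.splits)
qed

lemma rord_to_fract_nonroot: "poly p z \<noteq> 0 \<Longrightarrow> rord z (to_fract p) = 0"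
  by (subst rord_to_fract) (auto simp: order_0I)

lemma rord_to_fract_simple_root:
  assumes "poly p z = 0" "poly (pderiv p) z \<noteq> 0"
  shows "rord z (to_fract p) = 1"
proof -
  have p: "p \<noteq> 0" "pderiv p \<noteq> 0" using assms by auto
  have "Polynomial.order z p \<noteq> 0" using p assms by (simp add: order_root)
  moreover have "Polynomial.order z (pderiv p) = 0" using assms by (simp add: order_0I)
  ultimately have "Polynomial.order z p = 1" using order_pderiv[of p z] p assms by auto
  thus ?thesis using p by (simp add: rord_to_fract)
qed

section \<open>Mordell curves over the rational functions\<close>

subsection \<open>The chord-tangent law and derivations\<close>

text \<open>Division of the difference of the two curve equations by x2 - x1. This second relation
  for the slope keeps the later identities polynomial, within reach of Groebner bases.\<close>

lemma chord_slope:
  fixes x1 :: "'a::field"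
  assumes "y1 ^ 2 = x1 ^ 3 + f" "y2 ^ 2 = x2 ^ 3 + f" "x1 \<noteq> x2" "m * (x2 - x1) = y2 - y1"
  shows "m * (y1 + y2) = x1 ^ 2 + x1 * x2 + x2 ^ 2"
proof -
  have "(x2 - x1) * (m * (y1 + y2)) = (y2 - y1) * (y1 + y2)" using assms(4) by Groebner_Basis.algebra
  also have "\<dots> = (x2 - x1) * (x1 ^ 2 + x1 * x2 + x2 ^ 2)" using assms(1,2) by Groebner_Basis.algebra
  finally show ?thesis using assms(3) by simp
qed

lemma chord_on_curve:
  fixes x1 :: "'a::field"
  assumes "y1 ^ 2 = x1 ^ 3 + f" "m * (y1 + y2) = x1 ^ 2 + x1 * x2 + x2 ^ 2" "m * (x2 - x1) = y2 - y1"
    "x3 = m ^ 2 - x1 - x2" "y3 = m * (x1 - x3) - y1"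
  shows "y3 ^ 2 = x3 ^ 3 + f"
  using assms by Groebner_Basis.algebra

text \<open>Translation invariance of dX / Y as a formal identity: the derivatives are unknowns
  subject to the relations of \<open>logd_deriv\<close>, with w1, w2 the values of
  \<open>logd\<close> and one common L. The identity holds after multiplication by x2 - x1, since dm
  is known only in that multiple.\<close>

lemma chord_deriv:
  fixes x1 :: "'a::field"
  assumes "m * (y1 + y2) = x1 ^ 2 + x1 * x2 + x2 ^ 2" "x1 \<noteq> x2" "m * (x2 - x1) = y2 - y1"
    and 3: "x3 = m ^ 2 - x1 - x2" "y3 = m * (x1 - x3) - y1"
    and d: "dx1 = w1 * y1 + 2 * x1 * L" "2 * dy1 = 3 * x1 ^ 2 * w1 + 6 * y1 * L"
      "dx2 = w2 * y2 + 2 * x2 * L" "2 * dy2 = 3 * x2 ^ 2 * w2 + 6 * y2 * L"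
      "dm * (x2 - x1) + m * (dx2 - dx1) = dy2 - dy1"
      "dx3 = 2 * m * dm - dx1 - dx2"
  shows "dx3 = (w1 + w2) * y3 + 2 * x3 * L"
proof -
  have "2 * (dm * (x2 - x1)) = 2 * dy2 - 2 * dy1 - 2 * m * (dx2 - dx1)" using d(5) by Groebner_Basis.algebra
  hence dm: "2 * (dm * (x2 - x1)) = 3 * x2 ^ 2 * w2 + 6 * y2 * L - 3 * x1 ^ 2 * w1 - 6 * y1 * L
     - 2 * m * (w2 * y2 + 2 * x2 * L - w1 * y1 - 2 * x1 * L)"
    unfolding d by (simp add: algebra_simps)
  have "(x2 - x1) * dx3 = m * (2 * (dm * (x2 - x1))) - (x2 - x1) * (dx1 + dx2)"
    using d(6) by Groebner_Basis.algebra
  also have "\<dots> = (x2 - x1) * ((w1 + w2) * y3 + 2 * x3 * L)"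
    unfolding dm 3 d(1,3) using assms(1,3) by Groebner_Basis.algebra
  finally show ?thesis using assms(2) by simp
qed

lemma tangent_on_curve:
  fixes x1 :: "'a::field"
  assumes "y1 ^ 2 = x1 ^ 3 + f" "2 * y1 * m = 3 * x1 ^ 2"
    "x3 = m ^ 2 - x1 - x1" "y3 = m * (x1 - x3) - y1"
  shows "y3 ^ 2 = x3 ^ 3 + f"
  using assms by Groebner_Basis.algebra

text \<open>The analogue of \<open>chord_deriv\<close> for doubling; dm comes from differentiating
  the equation of the tangent slope.\<close>

lemma tangent_deriv:
  fixes x1 :: "'a::field"
  assumes "2 * y1 * m = 3 * x1 ^ 2" "y1 \<noteq> 0"
    and 3: "x3 = m ^ 2 - x1 - x1" "y3 = m * (x1 - x3) - y1"
    and d: "dx1 = w * y1 + 2 * x1 * L" "2 * dy1 = 3 * x1 ^ 2 * w + 6 * y1 * L"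
      "2 * dy1 * m + 2 * y1 * dm = 6 * x1 * dx1"
      "dx3 = 2 * m * dm - dx1 - dx1"
  shows "dx3 = (w + w) * y3 + 2 * x3 * L"
proof -
  have dm: "2 * y1 * dm = 6 * x1 * (w * y1 + 2 * x1 * L) - (3 * x1 ^ 2 * w + 6 * y1 * L) * m"
    using d by Groebner_Basis.algebra
  have "y1 * dx3 = m * (2 * y1 * dm) - 2 * y1 * dx1" using d(4) by Groebner_Basis.algebra
  also have "\<dots> = y1 * ((w + w) * y3 + 2 * x3 * L)"
    unfolding dm 3 d(1) using assms(1) by Groebner_Basis.algebra
  finally show ?thesis using assms(2) by simp
qed

subsection \<open>The logarithmic derivative on points\<close>

text \<open>The first assumption excludes points with x = 0. The second excludes y = 0 (c = -1), and
  for general c it excludes constant X^3, which makes \<open>logd\<close> injective. For c = 0 its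
  premise says x^3 = 0, hence the form of the conclusion.\<close>

locale mordell_curve =
  fixes f :: ratfun
  assumes nonsquare: "y ^ 2 \<noteq> f"
    and noncube: "x ^ 3 = ratfun_const c * f \<Longrightarrow> x = 0"
begin

abbreviation "E \<equiv> Weierstrass 0 f"

abbreviation "points \<equiv> rational_points E UNIV"

abbreviation "G \<equiv> rational_points_group E UNIV"

text \<open>With w^6 = f, X = x / w^2 and Y = y / w^3 one has dX / Y = w logd dt; dropping the
  factor w leaves an element of \<complex>(t).\<close>

fun logd :: "ratfun ec_point \<Rightarrow> ratfun" where
  "logd Infinity = 0"
| "logd (Affine x y) = (rat_deriv x - x * rat_deriv f / (3 * f)) / y"

fun opp :: "ratfun ec_point \<Rightarrow> ratfun ec_point" where
  "opp Infinity = Infinity"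
| "opp (Affine x y) = Affine x (- y)"

lemma f_nz [simp]: "f \<noteq> 0"
  using nonsquare[of 0] by simp

lemma mem_points [simp]:
  "Infinity \<in> points" "Affine x y \<in> points \<longleftrightarrow> y ^ 2 = x ^ 3 + f"
  by (auto simp: rational_points_def)

lemma coord_nz:
  assumes "y ^ 2 = x ^ 3 + f"
  shows "x \<noteq> 0" "y \<noteq> 0"
proof -
  show "x \<noteq> 0" using assms nonsquare[of y] by auto
  show "y \<noteq> 0"
  proof
    assume "y = 0"
    hence "x ^ 3 = ratfun_const (-1) * f" using assms by (simp add: eq_neg_iff_add_eq_0)
    hence "x = 0" by (rule noncube)
    thus False using assms \<open>y = 0\<close> by simp
  qed
qed

text \<open>The two forms dX / Y and 2 dY / (3 X^2) of the same differential, with L = w' / w. The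
  second one serves where y vanishes.\<close>

lemma logd_deriv:
  assumes "y ^ 2 = x ^ 3 + f"
  defines "L \<equiv> rat_deriv f / (6 * f)"
  shows "rat_deriv x = logd (Affine x y) * y + 2 * x * L"
    and "2 * rat_deriv y = 3 * x ^ 2 * logd (Affine x y) + 6 * y * L"
proof -
  have y: "y \<noteq> 0" using assms coord_nz by blast
  show 1: "rat_deriv x = logd (Affine x y) * y + 2 * x * L"
    using y by (simp add: L_def divide_simps)
  have "rat_deriv f = 6 * f * L" by (simp add: L_def)
  moreover have "2 * y * rat_deriv y = 3 * x ^ 2 * rat_deriv x + rat_deriv f"
    using arg_cong[OF assms(1), of rat_deriv] by (simp add: rat_deriv_power)
  ultimately have "y * (2 * rat_deriv y) = y * (3 * x ^ 2 * logd (Affine x y) + 6 * y * L)"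
    unfolding 1 using assms(1) by Groebner_Basis.algebra
  thus "2 * rat_deriv y = 3 * x ^ 2 * logd (Affine x y) + 6 * y * L" using y by simp
qed

lemma logd_eqI:
  assumes "y ^ 2 = x ^ 3 + f" "rat_deriv x = w * y + 2 * x * (rat_deriv f / (6 * f))"
  shows "logd (Affine x y) = w"
proof -
  have "rat_deriv f / (3 * f) = 2 * (rat_deriv f / (6 * f))" by (simp add: divide_simps)
  hence "x * rat_deriv f / (3 * f) = 2 * x * (rat_deriv f / (6 * f))" by (metis mult.assoc mult.left_commute times_divide_eq_right)
  thus ?thesis using assms(2) coord_nz[OF assms(1)] by simp
qed

lemma ec_add_points_logd:
  assumes "P \<in> points" "Q \<in> points"
  shows "ec_add E P Q \<in> points \<and> logd (ec_add E P Q) = logd P + logd Q"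
proof (cases P; cases Q)
  fix x1 y1 x2 y2 assume PQ: "P = Affine x1 y1" "Q = Affine x2 y2"
  define L where "L = rat_deriv f / (6 * f)"
  have c: "y1 ^ 2 = x1 ^ 3 + f" "y2 ^ 2 = x2 ^ 3 + f" using assms PQ by auto
  note d1 = logd_deriv[OF c(1), folded L_def] and d2 = logd_deriv[OF c(2), folded L_def]
  consider "x1 = x2" "y1 = - y2" | "x1 = x2" "y1 \<noteq> - y2" | "x1 \<noteq> x2" by blast
  thus ?thesis
  proof cases
    case 1
    thus ?thesis unfolding PQ by (simp add: field_simps)
  next
    case 2
    have "(y1 - y2) * (y1 + y2) = 0" using c 2(1) by Groebner_Basis.algebra
    hence y: "y1 = y2" using 2 by (auto simp: eq_neg_iff_add_eq_0)
    define m where "m = 3 * x1 ^ 2 / (2 * y1)"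
    define x3 where "x3 = m ^ 2 - x1 - x1"
    define y3 where "y3 = m * (x1 - x3) - y1"
    have y1: "y1 \<noteq> 0" using coord_nz c by blast
    have sum: "ec_add E P Q = Affine x3 y3"
      using 2 y by (simp add: PQ x3_def y3_def m_def Let_def)
    have m: "2 * y1 * m = 3 * x1 ^ 2" using y1 by (simp add: m_def)
    have on: "y3 ^ 2 = x3 ^ 3 + f" by (rule tangent_on_curve[OF c(1) m x3_def y3_def])
    have "2 * rat_deriv y1 * m + 2 * y1 * rat_deriv m = 6 * x1 * rat_deriv x1"
      using arg_cong[OF m, of rat_deriv] by (simp add: rat_deriv_power algebra_simps)
    moreover have "rat_deriv x3 = 2 * m * rat_deriv m - rat_deriv x1 - rat_deriv x1"
      by (simp add: x3_def rat_deriv_power)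
    ultimately have "rat_deriv x3 = (logd P + logd P) * y3 + 2 * x3 * L"
      unfolding PQ by (rule tangent_deriv[OF m y1 x3_def y3_def d1])
    hence "logd (Affine x3 y3) = logd P + logd P" unfolding L_def by (rule logd_eqI[OF on])
    thus ?thesis unfolding sum using on 2 y PQ by simp
  next
    case 3
    define m where "m = (y2 - y1) / (x2 - x1)"
    define x3 where "x3 = m ^ 2 - x1 - x2"
    define y3 where "y3 = m * (x1 - x3) - y1"
    have sum: "ec_add E P Q = Affine x3 y3"
      using 3 by (simp add: PQ x3_def y3_def m_def Let_def)
    have m: "m * (x2 - x1) = y2 - y1" using 3 by (simp add: m_def)
    note k = chord_slope[OF c 3 m]
    have on: "y3 ^ 2 = x3 ^ 3 + f" by (rule chord_on_curve[OF c(1) k m x3_def y3_def])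
    have "rat_deriv m * (x2 - x1) + m * (rat_deriv x2 - rat_deriv x1) = rat_deriv y2 - rat_deriv y1"
      using arg_cong[OF m, of rat_deriv] by (simp add: rat_deriv_power algebra_simps)
    moreover have "rat_deriv x3 = 2 * m * rat_deriv m - rat_deriv x1 - rat_deriv x2"
      by (simp add: x3_def rat_deriv_power)
    ultimately have "rat_deriv x3 = (logd P + logd Q) * y3 + 2 * x3 * L"
      unfolding PQ by (rule chord_deriv[OF k 3 m x3_def y3_def d1 d2])
    hence "logd (Affine x3 y3) = logd P + logd Q" unfolding L_def by (rule logd_eqI[OF on])
    thus ?thesis unfolding sum using on by simp
  qed
qed (use assms in auto)

lemmas ec_add_points = ec_add_points_logd[THEN conjunct1]
lemmas logd_ec_add = ec_add_points_logd[THEN conjunct2]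

lemma opp_points: "P \<in> points \<Longrightarrow> opp P \<in> points"
  by (cases P) auto

lemma logd_opp: "logd (opp P) = - logd P"
  by (cases P) auto

text \<open>A vanishing \<open>logd\<close> makes X^3 = x^3 / f constant, which
  \<open>noncube\<close> excludes.\<close>

lemma logd_eq_0:
  assumes "P \<in> points" "logd P = 0"
  shows "P = Infinity"
proof (cases P)
  case (Affine x y)
  have c: "y ^ 2 = x ^ 3 + f" using assms Affine by auto
  note nz = coord_nz[OF c]
  have "rat_deriv x = x * rat_deriv f / (3 * f)" using assms(2) nz by (simp add: Affine)
  hence "rat_deriv (x ^ 3 / f) = 0"
    by (simp add: rat_deriv_divide rat_deriv_power field_simps power3_eq_cube power2_eq_square)
  then obtain k where "x ^ 3 / f = ratfun_const k" by (auto simp: rat_deriv_eq_0_iff)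
  hence "x ^ 3 = ratfun_const k * f" by (simp add: field_simps)
  thus ?thesis using noncube nz by blast
qed

lemma logd_inj:
  assumes "P \<in> points" "Q \<in> points" "logd P = logd Q"
  shows "P = Q"
proof -
  have "ec_add E P (opp Q) = Infinity"
    using assms by (intro logd_eq_0 ec_add_points) (auto simp: logd_ec_add opp_points logd_opp)
  thus ?thesis by (cases P; cases Q) (auto simp: Let_def split: if_splits)
qed

subsection \<open>The Mordell-Weil group\<close>

lemma G_simps [simp]: "carrier G = points" "monoid.mult G = ec_add E" "one G = Infinity"
  by (simp_all add: rational_points_group_def)

lemma comm_group_G: "comm_group G"
proof (rule comm_groupI)
  fix P Q R assume "P \<in> carrier G" "Q \<in> carrier G" "R \<in> carrier G"
  hence PQR: "P \<in> points" "Q \<in> points" "R \<in> points" by auto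
  show "P \<otimes>\<^bsub>G\<^esub> Q \<otimes>\<^bsub>G\<^esub> R = P \<otimes>\<^bsub>G\<^esub> (Q \<otimes>\<^bsub>G\<^esub> R)"
    unfolding G_simps using PQR by (intro logd_inj) (auto simp: ec_add_points logd_ec_add add.assoc)
next
  fix P Q assume "P \<in> carrier G" "Q \<in> carrier G"
  hence PQ: "P \<in> points" "Q \<in> points" by auto
  show "P \<otimes>\<^bsub>G\<^esub> Q = Q \<otimes>\<^bsub>G\<^esub> P"
    unfolding G_simps using PQ by (intro logd_inj) (auto simp: ec_add_points logd_ec_add add.commute)
next
  fix P assume "P \<in> carrier G"
  hence P: "P \<in> points" by auto
  have "ec_add E (opp P) P = Infinity"
    using P by (intro logd_inj) (auto simp: ec_add_points logd_ec_add opp_points logd_opp)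
  thus "\<exists>Q\<in>carrier G. Q \<otimes>\<^bsub>G\<^esub> P = \<one>\<^bsub>G\<^esub>" using P opp_points by auto
qed (auto simp: ec_add_points)

sublocale G: comm_group G by (rule comm_group_G)

lemma logd_pow_nat: "P \<in> points \<Longrightarrow> logd (P [^]\<^bsub>G\<^esub> (n::nat)) = of_nat n * logd P"
proof (induction n)
  case (Suc n)
  have "P [^]\<^bsub>G\<^esub> n \<in> carrier G" using Suc.prems by (intro G.nat_pow_closed) simp
  thus ?case using Suc by (simp add: logd_ec_add algebra_simps)
qed simp

lemma inv_eq_opp: "P \<in> points \<Longrightarrow> inv\<^bsub>G\<^esub> P = opp P"
  by (rule G.inv_equality)
     (auto intro!: logd_inj simp: ec_add_points logd_ec_add opp_points logd_opp)

lemma logd_pow_int: "P \<in> points \<Longrightarrow> logd (P [^]\<^bsub>G\<^esub> (n::int)) = of_int n * logd P"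
proof -
  assume P: "P \<in> points"
  have "P [^]\<^bsub>G\<^esub> k \<in> points" for k :: nat using G.nat_pow_closed[of P k] P by simp
  thus ?thesis
    using P by (cases n rule: int_cases2) (simp_all add: int_pow_int G.int_pow_neg_int logd_pow_nat inv_eq_opp logd_opp)
qed

lemma pow_int_points: "P \<in> points \<Longrightarrow> P [^]\<^bsub>G\<^esub> (n::int) \<in> points"
  using G.int_pow_closed[of P n] by simp

lemma logd_finprod:
  "finite S \<Longrightarrow> g \<in> S \<rightarrow> points \<Longrightarrow> logd (finprod G g S) = (\<Sum>P\<in>S. logd (g P))"
proof (induction S rule: finite_induct)
  case (insert P S)
  have "finprod G g S \<in> points" using G.finprod_closed[of g S] insert.prems by (auto simp: Pi_iff)
  thus ?case using insert by (simp add: logd_ec_add Pi_iff)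
qed simp

end

text \<open>At a simple zero of f the order 1 is divisible neither by 2 nor by 3.\<close>

lemma mordell_curveI:
  assumes "f \<noteq> 0" "rord z f = 1"
  shows "mordell_curve f"
proof
  fix y
  show "y ^ 2 \<noteq> f"
  proof
    assume *: "y ^ 2 = f"
    hence "y \<noteq> 0" using assms by auto
    hence "rord z f = 2 * rord z y" using * by (auto simp: rord_power)
    thus False using assms by presburger
  qed
next
  fix x c assume *: "x ^ 3 = ratfun_const c * f"
  show "x = 0"
  proof (rule ccontr)
    assume x: "x \<noteq> 0"
    hence c: "c \<noteq> 0" using * by auto
    have "3 * rord z x = rord z (ratfun_const c * f)" using x by (simp add: rord_power flip: *)
    also have "\<dots> = 1" using assms c by (simp add: rord_mult)
    finally show False by presburger
  qed
qed

subsection \<open>Twisted substitutions\<close>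

text \<open>Pullback along \<phi> followed by the scaling (x, y) -> (a x, b y), which for b^2 = a^3
  leads from f to b^2 f(\<phi>). Quotient maps, automorphisms of \<complex>(t) and multiplication by
  \<open>zeta3\<close> are all of this kind.\<close>

fun twist :: "ratfun \<Rightarrow> complex \<Rightarrow> complex \<Rightarrow> ratfun ec_point \<Rightarrow> ratfun ec_point" where
  "twist \<phi> a b Infinity = Infinity"
| "twist \<phi> a b (Affine x y) = Affine (ratfun_const a * rat_subst \<phi> x) (ratfun_const b * rat_subst \<phi> y)"

text \<open>The scaling contributes a / b and the chain rule contributes \<phi>'; the constant b^2
  drops out of f' / f.\<close>

lemma twist_logd:
  assumes "mordell_curve f" "mordell_curve g" "nonconst \<phi>"
    and b: "b ^ 2 = a ^ 3" "b \<noteq> 0" "g = ratfun_const (b ^ 2) * rat_subst \<phi> f"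
    and P: "P \<in> rational_points (Weierstrass 0 f) UNIV"
  shows "twist \<phi> a b P \<in> rational_points (Weierstrass 0 g) UNIV"
    and "mordell_curve.logd g (twist \<phi> a b P) =
           ratfun_const (a / b) * rat_subst \<phi> (mordell_curve.logd f P) * rat_deriv \<phi>"
proof -
  interpret f: mordell_curve f by fact
  interpret g: mordell_curve g by fact
  have "twist \<phi> a b P \<in> rational_points (Weierstrass 0 g) UNIV \<and> g.logd (twist \<phi> a b P) =
           ratfun_const (a / b) * rat_subst \<phi> (f.logd P) * rat_deriv \<phi>"
  proof (cases P)
    case (Affine x y)
    have c: "y ^ 2 = x ^ 3 + f" using P Affine by simp
    have y: "y \<noteq> 0" using f.coord_nz[OF c] by simp
    have "ratfun_const (b ^ 2) * rat_subst \<phi> (y ^ 2) = ratfun_const (a ^ 3) * rat_subst \<phi> (x ^ 3) + g"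
      using assms(3) unfolding b(3) b(1) c by (simp add: algebra_simps)
    hence on: "(ratfun_const b * rat_subst \<phi> y) ^ 2 = (ratfun_const a * rat_subst \<phi> x) ^ 3 + g"
      using assms(3) by (simp add: power_mult_distrib)
    have g': "rat_deriv g / (3 * g) = rat_subst \<phi> (rat_deriv f / (3 * f)) * rat_deriv \<phi>"
    proof -
    define c where "c = b ^ 2"
    have "c \<noteq> 0" "g = ratfun_const c * rat_subst \<phi> f" using b(2,3) by (simp_all add: c_def)
    thus ?thesis using assms(3) by (simp add: rat_deriv_subst)
  qed
    have "g.logd (twist \<phi> a b P) =
        (ratfun_const a * rat_deriv (rat_subst \<phi> x) - ratfun_const a * rat_subst \<phi> x * (rat_deriv g / (3 * g)))
         / (ratfun_const b * rat_subst \<phi> y)"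
      by (simp add: Affine)
    also have "\<dots> = ratfun_const (a / b) * rat_subst \<phi> (f.logd P) * rat_deriv \<phi>"
      unfolding g' using y b(2) assms(3) by (simp add: Affine rat_deriv_subst divide_simps) (simp add: algebra_simps)
    finally show ?thesis using on by (simp add: Affine)
  qed (use assms(3) in simp)
  thus "twist \<phi> a b P \<in> rational_points (Weierstrass 0 g) UNIV"
    and "g.logd (twist \<phi> a b P) = ratfun_const (a / b) * rat_subst \<phi> (f.logd P) * rat_deriv \<phi>"
    by auto
qed

text \<open>An element \<open>A + B t\<close> of a quadratic extension that is fixed by the nontrivial automorphism
  has \<open>B = 0\<close>.\<close>

lemma fixed_imp_in_range_subst:
  assumes \<phi>: "nonconst \<phi>" and \<psi>: "nonconst \<psi>" "rat_subst \<psi> \<phi> = \<phi>" "\<psi> \<noteq> tvar"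
    and quad: "tvar ^ 2 = rat_subst \<phi> T * tvar + rat_subst \<phi> M"
    and x: "rat_subst \<psi> x = x"
  obtains x' where "x = rat_subst \<phi> x'"
proof -
  have fix_F: "rat_subst \<psi> (rat_subst \<phi> a) = rat_subst \<phi> a" for a
  proof -
    have p: "rat_subst \<psi> (poly_subst \<phi> p) = poly_subst \<phi> p" for p
      by (induction p) (use \<psi> in simp_all)
    obtain p q where "a = to_fract p / to_fract q" "q \<noteq> 0" by (rule ratfun_cases)
    thus ?thesis using \<phi> \<psi> by (simp add: p)
  qed
  define T' M' where "T' = rat_subst \<phi> T" and "M' = rat_subst \<phi> M"
  have t: "tvar ^ 2 = T' * tvar + M'" using quad by (simp add: T'_def M'_def)
  have \<psi>2: "\<psi> ^ 2 = T' * \<psi> + M'"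
    using arg_cong[OF quad, of "rat_subst \<psi>"] \<psi> by (simp add: fix_F T'_def M'_def)
  \<comment> \<open>t and \<psi> are the two roots of the quadratic equation, so \<psi> is the
    conjugate T' - t.\<close>
  have "(tvar - \<psi>) * (tvar + \<psi> - T') = 0" using t \<psi>2 by Groebner_Basis.algebra
  hence "tvar + \<psi> - T' = 0" using \<psi>(3) unfolding mult_eq_0_iff by auto
  hence conj: "\<psi> = T' - tvar" by (simp add: algebra_simps)
  have S: "\<exists>A B. to_fract p = rat_subst \<phi> A + rat_subst \<phi> B * tvar" for p
  proof (induction p)
    case 0
    show ?case using \<phi> by (intro exI[of _ 0]) simp
  next
    case (pCons c p)
    then obtain A B where AB: "to_fract p = rat_subst \<phi> A + rat_subst \<phi> B * tvar" by blast
    have "to_fract (pCons c p) = ratfun_const c + rat_subst \<phi> A * tvar + rat_subst \<phi> B * (tvar ^ 2)"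
      by (simp add: to_fract_pCons AB algebra_simps power2_eq_square)
    also have "\<dots> = rat_subst \<phi> (ratfun_const c + B * M) + rat_subst \<phi> (A + B * T) * tvar"
      unfolding quad using \<phi> by (simp add: algebra_simps)
    finally show ?case by blast
  qed
  obtain p q where pq: "x = to_fract p / to_fract q" "q \<noteq> 0" by (rule ratfun_cases)
  obtain A B where AB: "to_fract p = rat_subst \<phi> A + rat_subst \<phi> B * tvar" using S by blast
  obtain C D where CD: "to_fract q = rat_subst \<phi> C + rat_subst \<phi> D * tvar" using S by blast
  have q': "rat_subst \<psi> (to_fract q) = rat_subst \<phi> C + rat_subst \<phi> D * \<psi>"
    unfolding CD using \<psi> by (simp add: fix_F)
  have q'_nz: "rat_subst \<psi> (to_fract q) \<noteq> 0" using pq(2) \<psi> rat_subst_eq_0_iff to_fract_eq_0_iff by blast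
  \<comment> \<open>The norm of C + D t. Multiplication by the conjugate makes the denominator an
    element of the subfield.\<close>
  define N where "N = C ^ 2 + C * D * T - D ^ 2 * M"
  have norm: "to_fract q * rat_subst \<psi> (to_fract q) = rat_subst \<phi> N"
    unfolding q' unfolding CD conj N_def using t \<phi> unfolding T'_def M'_def
    by (simp only: rat_subst_add rat_subst_diff rat_subst_mult rat_subst_power) Groebner_Basis.algebra
  have N: "rat_subst \<phi> N \<noteq> 0" using norm q'_nz pq(2) by (metis mult_eq_0_iff to_fract_eq_0_iff)
  define A' B' where "A' = (A * C + A * D * T - B * D * M) / N" and "B' = (B * C - A * D) / N"
  have "x = to_fract p * rat_subst \<psi> (to_fract q) / rat_subst \<phi> N"
    using q'_nz pq(2) by (simp add: pq(1) flip: norm)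
  also have "to_fract p * rat_subst \<psi> (to_fract q) =
      rat_subst \<phi> (A * C + A * D * T - B * D * M) + rat_subst \<phi> (B * C - A * D) * tvar"
    unfolding q' unfolding AB conj using t \<phi> unfolding T'_def M'_def
    by (simp only: rat_subst_add rat_subst_diff rat_subst_mult rat_subst_power) Groebner_Basis.algebra
  finally have x_eq: "x = rat_subst \<phi> A' + rat_subst \<phi> B' * tvar"
    using \<phi> by (simp add: A'_def B'_def add_divide_distrib)
  have "rat_subst \<phi> A' + rat_subst \<phi> B' * \<psi> = rat_subst \<phi> A' + rat_subst \<phi> B' * tvar"
    using x \<psi> by (simp add: x_eq fix_F)
  hence "rat_subst \<phi> B' = 0" using \<psi>(3) by simp
  thus ?thesis using x_eq that by simp
qed

section \<open>The curves\<close>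

definition F1 :: ratfun where "F1 = tvar + 1 / tvar"
definition F2 :: ratfun where "F2 = tvar ^ 2 + 1 / tvar ^ 2"
definition F3 :: ratfun where "F3 = tvar ^ 2 - 2"

definition q1 :: "complex poly" where "q1 = [:1, 0, 1:]"
definition q2 :: "complex poly" where "q2 = [:1, 0, 0, 0, 1:]"
definition q3 :: "complex poly" where "q3 = [:-2, 0, 1:]"

lemma to_fract_q: "to_fract q1 = tvar ^ 2 + 1" "to_fract q2 = tvar ^ 4 + 1" "to_fract q3 = tvar ^ 2 - 2"
  by (simp_all add: q1_def q2_def q3_def to_fract_pCons algebra_simps eval_nat_numeral)

lemma F_eq: "F1 = to_fract q1 / tvar" "F2 = to_fract q2 / tvar ^ 2" "F3 = to_fract q3"
  using tvar_nonzero by (simp_all add: to_fract_q F1_def F2_def F3_def field_simps eval_nat_numeral)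

lemma q_nz [simp]: "q1 \<noteq> 0" "q2 \<noteq> 0" "q3 \<noteq> 0"
  by (simp_all add: q1_def q2_def q3_def)

lemma tvar_poly_nz [simp]: "tvar ^ 2 + 1 \<noteq> 0" "tvar ^ 4 + 1 \<noteq> 0" "tvar ^ 2 - 2 \<noteq> 0"
  unfolding to_fract_q[symmetric] by simp_all

lemma F_nz [simp]: "F1 \<noteq> 0" "F2 \<noteq> 0" "F3 \<noteq> 0"
  using tvar_nonzero unfolding F_eq by auto

lemma rord_tvar: "rord z tvar = (if z = 0 then 1 else 0)"
  unfolding tvar_def by (auto intro!: rord_to_fract_nonroot rord_to_fract_simple_root simp: pderiv_pCons)

lemma rord_F1_0: "rord 0 F1 = -1"
  unfolding F_eq by (subst rord_divide) (auto simp: tvar_nonzero rord_tvar rord_to_fract_nonroot q1_def)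

lemma rord_F1: "poly q1 z = 0 \<Longrightarrow> rord z F1 = 1"
  unfolding F_eq by (subst rord_divide)
     (auto simp: tvar_nonzero rord_tvar rord_to_fract_simple_root q1_def pderiv_pCons)

lemma rord_F2_0: "rord 0 F2 = -2"
  unfolding F_eq by (subst rord_divide) (auto simp: tvar_nonzero rord_tvar rord_power rord_to_fract_nonroot q2_def)

lemma rord_F2: "z \<noteq> 0 \<Longrightarrow> rord z F2 = (if poly q2 z = 0 then 1 else 0)"
  unfolding F_eq by (subst rord_divide)
     (auto simp: tvar_nonzero rord_tvar rord_power rord_to_fract_simple_root rord_to_fract_nonroot
        q2_def pderiv_pCons)

lemma rord_F3: "poly q3 z = 0 \<Longrightarrow> rord z F3 = 1"
  unfolding F_eq by (intro rord_to_fract_simple_root) (auto simp: q3_def pderiv_pCons)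

lemma exists_root: "\<exists>z. poly q1 z = 0" "\<exists>z. z \<noteq> 0 \<and> poly q2 z = 0" "\<exists>z. poly q3 z = 0"
proof -
  show "\<exists>z. poly q1 z = 0"
    by (rule exI[of _ \<i>]) (simp add: q1_def)
  have "\<not> constant (poly q2)" "\<not> constant (poly q3)"
    by (simp_all add: constant_degree q2_def q3_def)
  then obtain z w where z: "poly q2 z = 0" and w: "poly q3 w = 0"
    using fundamental_theorem_of_algebra by meson
  have "z \<noteq> 0" using z by (auto simp: q2_def)
  thus "\<exists>z. z \<noteq> 0 \<and> poly q2 z = 0" "\<exists>z. poly q3 z = 0" using z w by blast+
qed

interpretation E1: mordell_curve F1
  using exists_root(1) rord_F1 mordell_curveI[OF F_nz(1)] by blast

interpretation E2: mordell_curve F2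
  using exists_root(2) rord_F2 mordell_curveI[OF F_nz(2)] by metis

interpretation E3: mordell_curve F3
  using exists_root(3) rord_F3 mordell_curveI[OF F_nz(3)] by blast

lemma curve_E_eq: "curve_E 1 = E1.E" "curve_E 2 = E2.E"
  by (simp_all add: curve_E_def F1_def F2_def)

subsection \<open>The logarithmic derivative on the second curve\<close>

text \<open>Here x^3 dominates f, so that 2 ord y = 3 ord x.\<close>

lemma (in mordell_curve) rord_poles:
  assumes "y ^ 2 = x ^ 3 + f" "rord z x < 0" "3 * rord z x < rord z f"
  obtains k where "k > 0" "rord z x = - 2 * k" "rord z y = - 3 * k"
proof -
  note nz = coord_nz[OF assms(1)]
  have "2 * rord z y = rord z (x ^ 3 + f)" using nz by (simp add: rord_power flip: assms(1))
  also have "\<dots> = rord z (x ^ 3)"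
    using nz assms by (intro rord_add_eq) (auto simp: rord_ge_def rord_power)
  finally have "2 * rord z y = 3 * rord z x" using nz by (simp add: rord_power)
  thus ?thesis using assms(2) by (intro that[of "rord z x - rord z y"]) presburger+
qed

text \<open>Holomorphy of the pulled back differential, place by place. At a pole of orders 2k and
  3k, d / y has order at least k - 1. At 0, if x is regular, the pole of F2 forces ord y = -1. At
  other points q2 absorbs the simple poles of F2' / F2, and where y vanishes the form 2 dY / (3 X^2)
  takes over.\<close>

lemma E2_logd_regular:
  assumes c: "y ^ 2 = x ^ 3 + F2"
  shows "rord_ge z 0 (to_fract q2 * E2.logd (Affine x y))"
proof -
  note nz = E2.coord_nz[OF c]
  define L where "L = rat_deriv F2 / (3 * F2)"
  have L: "rord_ge z (-1) L"
  proof -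
    have "rord_ge z (rord z F2 - 1 - rord z (3 * F2)) L"
      unfolding L_def by (intro rord_ge_divide rord_ge_deriv rord_ge_rord) auto
    thus ?thesis by (simp add: rord_mult)
  qed
  define d where "d = rat_deriv x - x * L"
  have d: "rord_ge z (rord z x - 1) d"
    unfolding d_def using rord_ge_deriv[OF rord_ge_rord, of z x] rord_ge_mult[OF rord_ge_rord[of z x] L]
    by (intro rord_ge_diff) auto
  have logd: "E2.logd (Affine x y) = d / y" by (simp add: d_def L_def)
  have poles: "rord_ge z 0 (to_fract q2 * (d / y))" if neg: "rord z x < 0" "3 * rord z x < rord z F2"
  proof -
    obtain k where k: "k > 0" "rord z x = - 2 * k" "rord z y = - 3 * k"
      using E2.rord_poles[OF c neg] by blast
    have "rord_ge z (0 + (rord z x - 1 - rord z y)) (to_fract q2 * (d / y))"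
      using nz d by (intro rord_ge_mult rord_ge_divide) auto
    thus ?thesis by (rule rord_ge_mono) (use k in simp)
  qed
  have y2: "2 * rord z y = rord z (x ^ 3 + F2)" using nz by (simp add: rord_power flip: c)
  show ?thesis
  proof (cases "z = 0")
    case True
    show ?thesis
    proof (cases "rord z x < 0")
      case neg: True
      show ?thesis unfolding logd using neg True by (intro poles) (auto simp: rord_F2_0)
    next
      case False
      have "rord z (F2 + x ^ 3) = rord z F2"
        using False True nz by (intro rord_add_eq[where k = 0]) (auto simp: rord_ge_def rord_F2_0 rord_power)
      hence y: "rord z y = -1" using y2 True by (simp add: add.commute rord_F2_0)
      have "rord_ge z (0 + (rord z x - 1 - rord z y)) (to_fract q2 * (d / y))"
        using nz d by (intro rord_ge_mult rord_ge_divide) auto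
      thus ?thesis unfolding logd by (rule rord_ge_mono) (use y False in simp)
    qed
  next
    case z: False
    have F2_bounds: "0 \<le> rord z F2" "rord z F2 \<le> 1" using z by (auto simp: rord_F2)
    have q2: "rord z (to_fract q2) = rord z F2"
      using z unfolding F_eq by (simp add: rord_divide rord_power tvar_nonzero rord_tvar)
    show ?thesis
    proof (cases "rord z x < 0")
      case True
      thus ?thesis unfolding logd using F2_bounds by (intro poles) auto
    next
      case False
      have "rord_ge z 0 (x ^ 3 + F2)"
        using False F2_bounds nz by (intro rord_ge_add) (auto simp: rord_ge_def rord_power)
      moreover have "x ^ 3 + F2 \<noteq> 0" using nz unfolding c[symmetric] by simp
      ultimately have y: "rord z y \<ge> 0" using y2 by (simp add: rord_ge_def)
      have qL: "rord_ge z 0 (to_fract q2 * L)"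
      proof (cases "poly q2 z = 0")
        case True
        thus ?thesis using rord_ge_mult[OF rord_ge_rord[of z "to_fract q2"] L] z
          by (simp add: q2 rord_F2)
      next
        case False
        have "rord_ge z 0 (rat_deriv F2)"
          using F2_bounds by (intro rord_ge_0_deriv) (auto simp: rord_ge_def)
        hence "rord_ge z (0 - rord z (3 * F2)) L" unfolding L_def by (intro rord_ge_divide) auto
        hence "rord_ge z 0 L" using False z by (simp add: rord_mult rord_F2)
        thus ?thesis using rord_ge_mult[of z 0 "to_fract q2" 0 L] by simp
      qed
      have qd: "rord_ge z 0 (to_fract q2 * d)"
      proof -
        have "rord_ge z (0 + 0) (x * (to_fract q2 * L))"
          using False by (intro rord_ge_mult qL) (auto simp: rord_ge_def)
        moreover have "rord_ge z 0 (rat_deriv x)"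
          using False by (intro rord_ge_0_deriv) (simp add: rord_ge_def)
        hence "rord_ge z 0 (to_fract q2 * rat_deriv x)"
          using rord_ge_mult[OF rord_ge_to_fract] by fastforce
        ultimately have "rord_ge z 0 (to_fract q2 * rat_deriv x - x * (to_fract q2 * L))"
          by (intro rord_ge_diff) auto
        thus ?thesis by (simp add: d_def algebra_simps)
      qed
      show ?thesis
      proof (cases "rord z y = 0")
        case True
        have "rord_ge z (0 - rord z y) (to_fract q2 * d / y)"
          using nz qd by (intro rord_ge_divide) auto
        thus ?thesis unfolding logd using True by simp
      next
        case ypos: False
        \<comment> \<open>Otherwise x^3 + F2 has the order of F2, at most 1, while y^2 has order at
          least 2.\<close>
        have x0: "rord z x = 0"
        proof (rule ccontr)
          assume "rord z x \<noteq> 0"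
          hence xp: "rord z x \<ge> 1" using False by simp
          have "rord z (F2 + x ^ 3) = rord z F2"
            using nz xp F2_bounds by (intro rord_add_eq[where k = 3]) (auto simp: rord_ge_def rord_power)
          thus False using y2 ypos y F2_bounds by (simp add: add.commute)
        qed
        define e where "e = 2 * rat_deriv y - 3 * y * L"
        have e: "3 * x ^ 2 * (d / y) = e"
        proof -
          have "2 * rat_deriv y = 3 * x ^ 2 * E2.logd (Affine x y) + 6 * y * (rat_deriv F2 / (6 * F2))"
            by (rule E2.logd_deriv[OF c])
          thus ?thesis unfolding logd by (simp add: e_def L_def divide_simps)
        qed
        have "rord_ge z (0 + 0) (y * (to_fract q2 * L))"
          using y by (intro rord_ge_mult qL) (auto simp: rord_ge_def)
        moreover have "rord_ge z 0 (rat_deriv y)"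
          using y by (intro rord_ge_0_deriv) (simp add: rord_ge_def)
        hence "rord_ge z (0 + 0) (to_fract q2 * rat_deriv y)"
          by (intro rord_ge_mult rord_ge_to_fract)
        ultimately have "rord_ge z 0 (to_fract q2 * rat_deriv y + to_fract q2 * rat_deriv y
            - (y * (to_fract q2 * L) + y * (to_fract q2 * L) + y * (to_fract q2 * L)))"
          unfolding add_0_right by (intro rord_ge_diff rord_ge_add)
        hence "rord_ge z 0 (to_fract q2 * e)" by (simp add: e_def algebra_simps)
        hence "rord_ge z (0 - rord z (3 * x ^ 2)) (to_fract q2 * e / (3 * x ^ 2))"
          using nz by (intro rord_ge_divide) auto
        moreover have "to_fract q2 * e / (3 * x ^ 2) = to_fract q2 * (d / y)"
          using nz by (simp flip: e)
        moreover have "rord z (3 * x ^ 2) = 0" using nz x0 by (simp add: rord_mult rord_power)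
        ultimately show ?thesis unfolding logd by simp
      qed
    qed
  qed
qed

text \<open>The degree is the pole order at infinity, seen at 0 after t -> 1/t.\<close>

lemma rord_0_poly_subst_inverse:
  "p \<noteq> 0 \<Longrightarrow> rord 0 (poly_subst (1 / tvar) p) = - int (Polynomial.degree p)"
proof (induction p)
  case (pCons a p)
  show ?case
  proof (cases "p = 0")
    case True
    thus ?thesis using pCons by simp
  next
    case False
    have nc: "nonconst (1 / tvar)"
      using tvar_nonzero by (simp add: nonconst_iff_deriv rat_deriv_divide)
    have nz: "poly_subst (1 / tvar) p \<noteq> 0" using False nc by (simp add: poly_subst_eq_0_iff)
    have o: "rord 0 (1 / tvar * poly_subst (1 / tvar) p) = - int (Suc (Polynomial.degree p))"
      using pCons False nz tvar_nonzero by (simp add: rord_mult rord_divide rord_tvar)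
    have "rord 0 (1 / tvar * poly_subst (1 / tvar) p + ratfun_const a) =
        rord 0 (1 / tvar * poly_subst (1 / tvar) p)"
      unfolding ratfun_const_def
      using nz tvar_nonzero by (intro rord_add_eq[where k = 0]) (simp_all only: o rord_ge_to_fract, simp_all)
    thus ?thesis using False o by (simp add: add.commute)
  qed
qed simp

lemma nonconst_simps:
  "nonconst (1 / tvar)" "nonconst (- tvar)" "nonconst (tvar ^ 2)" "nonconst (tvar + 1 / tvar)"
  "c \<noteq> 0 \<Longrightarrow> nonconst (ratfun_const c * tvar)"
proof -
  have "rat_deriv (tvar + 1 / tvar) = (tvar ^ 2 - 1) / tvar ^ 2"
    using tvar_nonzero by (simp add: rat_deriv_divide field_simps power2_eq_square)
  moreover have "tvar ^ 2 - 1 = to_fract [:-1, 0, 1:]"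
    by (simp add: to_fract_pCons power2_eq_square)
  ultimately show "nonconst (tvar + 1 / tvar)" using tvar_nonzero by (simp add: nonconst_iff_deriv)
qed (use tvar_nonzero in \<open>auto simp: nonconst_iff_deriv rat_deriv_divide rat_deriv_power\<close>)

lemma F2_inverse: "rat_subst (1 / tvar) F2 = F2"
  by (simp add: F2_def nonconst_simps power_one_over)

lemma E2_iota:
  assumes "P \<in> E2.points"
  shows "twist (1 / tvar) 1 1 P \<in> E2.points"
    "E2.logd (twist (1 / tvar) 1 1 P) = - rat_subst (1 / tvar) (E2.logd P) / tvar ^ 2"
  using twist_logd[OF E2.mordell_curve_axioms E2.mordell_curve_axioms nonconst_simps(1), of 1 1 P] assms
    tvar_nonzero by (simp_all add: F2_inverse rat_deriv_divide)

lemma E2_logd_poly: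
  assumes "P \<in> E2.points"
  obtains N where "to_fract q2 * E2.logd P = to_fract N"
proof (cases P)
  case Infinity
  thus ?thesis using that[of 0] by simp
next
  case (Affine x y)
  hence "rord_ge z 0 (to_fract q2 * E2.logd P)" for z
    using assms unfolding Affine by (intro E2_logd_regular) simp
  thus ?thesis using rord_ge_0_imp_poly that by metis
qed

text \<open>Regularity at infinity is regularity at 0 for the image of P under t -> 1/t: with
  numerator N for P, the numerator for the image is - t^2 N(1/t), a polynomial only if N has degree
  at most 2.\<close>

lemma E2_logd_form:
  assumes "P \<in> E2.points"
  obtains a b c where
    "E2.logd P = (ratfun_const a + ratfun_const b * tvar + ratfun_const c * tvar ^ 2) / to_fract q2"
proof -
  obtain N where N: "to_fract q2 * E2.logd P = to_fract N" by (rule E2_logd_poly[OF assms])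
  obtain N' where N': "to_fract q2 * E2.logd (twist (1 / tvar) 1 1 P) = to_fract N'"
    by (rule E2_logd_poly[OF E2_iota(1)[OF assms]])
  have "Polynomial.degree N \<le> 2"
  proof (cases "N = 0")
    case False
    define S where "S = rat_subst (1 / tvar) (E2.logd P)"
    have "(1 / tvar ^ 4 + 1) * S = poly_subst (1 / tvar) N"
      using arg_cong[OF N, of "rat_subst (1 / tvar)"]
      by (simp add: to_fract_q nonconst_simps power_one_over S_def del: to_fract_mult)
    hence "(1 + tvar ^ 4) * S = tvar ^ 4 * poly_subst (1 / tvar) N"
      using tvar_nonzero by (simp add: field_simps)
    moreover have "to_fract N' = - ((1 + tvar ^ 4) * S) / tvar ^ 2"
      unfolding N'[symmetric] E2_iota(2)[OF assms] S_def[symmetric] to_fract_q by (simp add: add.commute)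
    ultimately have "to_fract N' = - (tvar ^ 2 * poly_subst (1 / tvar) N)"
      using tvar_nonzero by (simp add: eval_nat_numeral)
    hence "tvar ^ 2 * poly_subst (1 / tvar) N = to_fract (- N')" by simp
    hence "rord_ge 0 0 (tvar ^ 2 * poly_subst (1 / tvar) N)" by (simp only: rord_ge_to_fract)
    moreover have "poly_subst (1 / tvar) N \<noteq> 0"
      using False by (simp add: poly_subst_eq_0_iff nonconst_simps)
    ultimately show ?thesis
      using False tvar_nonzero
      by (simp add: rord_ge_def rord_mult rord_power rord_tvar rord_0_poly_subst_inverse)
  qed simp
  then obtain a b c where "N = [:a, b, c:]" using poly_degree_le_2 by blast
  hence "to_fract N = ratfun_const a + ratfun_const b * tvar + ratfun_const c * tvar ^ 2"
    by (simp add: to_fract_pCons algebra_simps power2_eq_square)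
  thus ?thesis using N that by (metis nonzero_mult_div_cancel_left to_fract_eq_0_iff q_nz(2))
qed

section \<open>A comparison principle\<close>

text \<open>The inequality \<open>n'^6 \<le> K n^5 (1 + n)^3\<close> separates: it bounds the growth of \<open>\<Psi> n\<close>, where
  \<open>\<Psi>\<close> measures arc length for \<open>dX / Y\<close> on the curve \<open>Y^2 = X^3 + 1\<close>, in terms of \<open>n = 1 / X^3\<close>.\<close>

lemma arc_length_function:
  obtains \<Psi> :: "real \<Rightarrow> real" where
    "continuous_on {0..} \<Psi>" "strict_mono_on {0..} \<Psi>"
    "\<And>v. v > 0 \<Longrightarrow> (\<Psi> has_real_derivative inverse (6 * root 6 v ^ 5 * sqrt (1 + v))) (at v)"
proof -
  define \<phi> :: "real \<Rightarrow> real" where "\<phi> = (\<lambda>u. inverse (sqrt (1 + u ^ 6)))"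
  \<comment> \<open>Starting at -1 instead of 0 makes 0 an interior point, so that \<Phi> is
    differentiable and hence continuous there.\<close>
  define \<Phi> where "\<Phi> = (\<lambda>x. integral {-1..x} \<phi>)"
  have pos: "1 + u ^ 6 > 0" for u :: real
    by (rule add_pos_nonneg) (auto intro: zero_le_even_power)
  have cont: "continuous_on A \<phi>" for A
    unfolding \<phi>_def using pos by (intro continuous_intros) (auto simp: less_le)
  have deriv: "(\<Phi> has_real_derivative \<phi> t) (at t)" if "t > -1" for t
  proof -
    have "(\<Phi> has_real_derivative \<phi> t) (at t within {-1..t + 1})"
      unfolding \<Phi>_def using that by (intro integral_has_real_derivative[OF cont]) auto
    moreover have "at t within {-1..t + 1} = at t" using that by (intro at_within_interior) auto
    ultimately show ?thesis by simp
  qed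
  have mono: "\<Phi> x < \<Phi> y" if "0 \<le> x" "x < y" for x y
    using that pos by (intro DERIV_pos_imp_increasing[OF that(2)]) (auto intro!: exI deriv simp: \<phi>_def)
  show ?thesis
  proof (rule that[of "\<lambda>v. \<Phi> (root 6 v)"])
    have "isCont \<Phi> t" if "t \<ge> 0" for t using deriv[of t] that by (auto intro: DERIV_isCont)
    hence "isCont (\<lambda>v. \<Phi> (root 6 v)) v" if "v \<ge> 0" for v
      using that by (intro isCont_o2[OF isCont_real_root]) auto
    thus "continuous_on {0..} (\<lambda>v. \<Phi> (root 6 v))" by (auto intro!: continuous_at_imp_continuous_on)
    show "strict_mono_on {0..} (\<lambda>v. \<Phi> (root 6 v))"
      by (auto simp: strict_mono_on_def intro!: mono)
    show "((\<lambda>v. \<Phi> (root 6 v)) has_real_derivative inverse (6 * root 6 v ^ 5 * sqrt (1 + v))) (at v)"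
      if "v > 0" for v
    proof -
      have "root 6 v > -1" using real_root_gt_zero[of 6 v] that by linarith
      hence "((\<lambda>v. \<Phi> (root 6 v)) has_real_derivative \<phi> (root 6 v) * inverse (real 6 * root 6 v ^ (6 - Suc 0))) (at v)"
        using that by (intro DERIV_chain2[OF deriv DERIV_real_root]) auto
      thus ?thesis using that by (simp add: \<phi>_def mult.commute)
    qed
  qed
qed

text \<open>The growth bound behaves like n^(5/6) near 0, where G and h may both start, and is not
  Lipschitz there. Under \<Psi> the dependence on n disappears: \<Psi>(|G|) grows at rate at most
  K^(1/6) / 6, and \<Psi>(h) at least at that rate.\<close>

lemma growth_comparison:
  fixes G G' :: "real \<Rightarrow> complex" and h h' K :: "real \<Rightarrow> real"
  assumes r: "a \<le> r"
    and G: "continuous_on {a..r} G"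
      "\<And>s. a < s \<Longrightarrow> s < r \<Longrightarrow> (G has_vector_derivative G' s) (at s)"
      "\<And>s. a < s \<Longrightarrow> s < r \<Longrightarrow> norm (G' s) ^ 6 \<le> K s * norm (G s) ^ 5 * (1 + norm (G s)) ^ 3"
    and h: "continuous_on {a..r} h"
      "\<And>s. a < s \<Longrightarrow> s < r \<Longrightarrow> (h has_real_derivative h' s) (at s)"
      "\<And>s. a < s \<Longrightarrow> s < r \<Longrightarrow> h s > 0"
      "\<And>s. a < s \<Longrightarrow> s < r \<Longrightarrow> h' s \<ge> 0"
      "\<And>s. a < s \<Longrightarrow> s < r \<Longrightarrow> K s * h s ^ 5 * (1 + h s) ^ 3 \<le> h' s ^ 6"
    and K: "\<And>s. a < s \<Longrightarrow> s < r \<Longrightarrow> K s \<ge> 0"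
    and start: "norm (G a) \<le> h a"
  shows "norm (G r) \<le> h r"
proof (rule ccontr)
  assume contra: "\<not> norm (G r) \<le> h r"
  hence ar: "a < r" using start r by (cases "a = r") auto
  obtain \<Psi> :: "real \<Rightarrow> real" where \<Psi>: "continuous_on {0..} \<Psi>" "strict_mono_on {0..} \<Psi>"
    "\<And>v. v > 0 \<Longrightarrow> (\<Psi> has_real_derivative inverse (6 * root 6 v ^ 5 * sqrt (1 + v))) (at v)"
    using arc_length_function by blast
  have cont: "continuous_on {a..r} (\<lambda>s. norm (G s))" "continuous_on {a..r} h"
    using G(1) h(1) by (auto intro!: continuous_on_norm)
  \<comment> \<open>Its supremum is the last time with |G| \<le> h. Afterwards |G| > h > 0, so the
    norm of G is differentiable.\<close>
  define S where "S = {s \<in> {a..r}. norm (G s) \<le> h s}"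
  have "closed S"
    unfolding S_def using cont by (intro continuous_on_closed_Collect_le) auto
  moreover have "a \<in> S" using start ar by (simp add: S_def)
  moreover have bdd: "bdd_above S" by (auto simp: S_def)
  ultimately have "Sup S \<in> S" by (intro closed_contains_Sup) auto
  define c where "c = Sup S"
  have c: "a \<le> c" "c \<le> r" "norm (G c) \<le> h c" using \<open>Sup S \<in> S\<close> by (auto simp: c_def S_def)
  have cr: "c < r" using c contra by (cases "c = r") auto
  have above: "norm (G s) > h s" if "c < s" "s \<le> r" for s
  proof (rule ccontr)
    assume "\<not> norm (G s) > h s"
    hence "s \<in> S" using that c by (simp add: S_def)
    hence "s \<le> c" unfolding c_def by (intro cSup_upper bdd)
    thus False using that by simp
  qed
  have h_pos: "h s > 0" if "c < s" "s < r" for s using h(3)[of s] that c by simp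
  have h_nonneg: "h s \<ge> 0" if "c \<le> s" "s \<le> r" for s
  proof -
    have cl: "closure {c<..<r} = {c..r}" by (rule closure_greaterThanLessThan[OF cr])
    show ?thesis
    proof (rule continuous_ge_on_closure[of "{c<..<r}" h s 0])
      show "continuous_on (closure {c<..<r}) h"
        unfolding cl by (rule continuous_on_subset[OF h(1)]) (use c in auto)
      show "s \<in> closure {c<..<r}" unfolding cl using that by simp
      show "h x \<ge> 0" if "x \<in> {c<..<r}" for x using h_pos[of x] that by simp
    qed
  qed
  define D where "D = (\<lambda>s. \<Psi> (norm (G s)) - \<Psi> (h s))"
  have "D c \<ge> D r"
  proof (rule DERIV_nonpos_imp_decreasing_open[where f = D])
    show "c \<le> r" by fact
    show "continuous_on {c..r} D"
      unfolding D_def using c h_nonneg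
      by (intro continuous_on_diff continuous_on_compose2[OF \<Psi>(1)] continuous_on_subset[OF cont(1)]
          continuous_on_subset[OF cont(2)]) auto
  next
    fix s assume s: "c < s" "s < r"
    hence s': "a < s" "s < r" using c r by auto
    have hs: "h s > 0" and ns: "norm (G s) > 0" using h(3) s' above[of s] s by force+
    define n where "n = norm (G s)"
    define n' where "n' = inner (G' s) (sgn (G s))"
    have "((\<lambda>r. norm (G r)) has_derivative (\<lambda>t. inner (t *\<^sub>R G' s) (sgn (G s)))) (at s)"
      using diff_chain_at[OF G(2)[OF s', unfolded has_vector_derivative_def] has_derivative_norm[of "G s"]] ns
      by (simp add: o_def)
    hence dn: "((\<lambda>r. norm (G r)) has_real_derivative n') (at s)"
      by (simp add: has_field_derivative_def n'_def mult.commute[of _ "inner _ _"])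
    have "n' \<le> norm (G' s) * norm (sgn (G s))" unfolding n'_def by (rule norm_cauchy_schwarz)
    hence n'_le: "n' \<le> norm (G' s)" using ns by (simp add: norm_sgn)
    define k where "k = root 6 (K s)"
    have k: "k ^ 6 = K s" "k \<ge> 0" using K[OF s'] by (auto simp: k_def)
    have sixth: "(k * (root 6 v ^ 5 * sqrt (1 + v))) ^ 6 = K s * v ^ 5 * (1 + v) ^ 3" if "v > 0" for v
    proof -
      have "(root 6 v ^ 5) ^ 6 = (root 6 v ^ 6) ^ 5" by (simp flip: power_mult)
      also have "\<dots> = v ^ 5" using that by simp
      finally have "(root 6 v ^ 5) ^ 6 = v ^ 5" .
      moreover have "sqrt (1 + v) ^ 6 = (sqrt (1 + v) ^ 2) ^ 3" by (simp flip: power_mult)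
      hence "sqrt (1 + v) ^ 6 = (1 + v) ^ 3" using that by simp
      ultimately show ?thesis by (simp add: power_mult_distrib k)
    qed
    have pos: "root 6 v ^ 5 * sqrt (1 + v) > 0" if "v > 0" for v :: real using that by simp
    have "norm (G' s) ^ 6 \<le> (k * (root 6 n ^ 5 * sqrt (1 + n))) ^ 6"
      using G(3)[OF s'] ns by (subst sixth) (auto simp: n_def)
    hence "norm (G' s) \<le> k * (root 6 n ^ 5 * sqrt (1 + n))"
      using k by (subst (asm) power_mono_iff) (auto simp: n_def)
    hence 1: "inverse (6 * root 6 n ^ 5 * sqrt (1 + n)) * n' \<le> k / 6"
    proof -
      define m where "m = root 6 n ^ 5 * sqrt (1 + n)"
      have "m > 0" using pos[of n] ns unfolding m_def n_def by blast
      moreover have "n' \<le> k * m" using calculation n'_le \<open>norm (G' s) \<le> _\<close> by (simp add: m_def)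
      ultimately have "inverse (6 * m) * n' \<le> k / 6" by (simp add: field_simps)
      thus ?thesis by (simp add: m_def mult.assoc)
    qed
    have "(k * (root 6 (h s) ^ 5 * sqrt (1 + h s))) ^ 6 \<le> h' s ^ 6"
      using h(5)[OF s'] hs by (subst sixth) auto
    hence "k * (root 6 (h s) ^ 5 * sqrt (1 + h s)) \<le> h' s"
      using k hs h(4)[OF s'] by (subst (asm) power_mono_iff) auto
    hence 2: "k / 6 \<le> inverse (6 * root 6 (h s) ^ 5 * sqrt (1 + h s)) * h' s"
    proof -
      define m where "m = root 6 (h s) ^ 5 * sqrt (1 + h s)"
      have "m > 0" using pos[of "h s"] hs by (simp add: m_def)
      moreover have "k * m \<le> h' s" using \<open>k * _ \<le> h' s\<close> by (simp add: m_def)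
      ultimately have "k / 6 \<le> inverse (6 * m) * h' s" by (simp add: field_simps)
      thus ?thesis by (simp add: m_def mult.assoc)
    qed
    have "(D has_real_derivative inverse (6 * root 6 n ^ 5 * sqrt (1 + n)) * n' -
        inverse (6 * root 6 (h s) ^ 5 * sqrt (1 + h s)) * h' s) (at s)"
      unfolding D_def n_def using ns hs
      by (intro DERIV_diff DERIV_chain2[OF \<Psi>(3)] dn h(2)[OF s']) auto
    thus "\<exists>y. (D has_real_derivative y) (at s) \<and> y \<le> 0" using 1 2 by (intro exI conjI) auto
  qed
  moreover have "D c \<le> 0"
    unfolding D_def using c h_nonneg[of c] strict_mono_on_imp_mono_on[OF \<Psi>(2)]
    by (auto simp: mono_on_def)
  moreover have "D r > 0"
    unfolding D_def using above[of r] cr h_nonneg[of r] \<Psi>(2) by (auto simp: strict_mono_on_def)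
  ultimately show False by simp
qed

lemma quotient_has_field_derivative:
  assumes "poly q z \<noteq> 0"
  shows "((\<lambda>z. poly p z / poly q z) has_field_derivative
           poly (pderiv p * q - p * pderiv q) z / poly q z ^ 2) (at z)"
  using assms by (auto intro!: derivative_eq_intros simp: power2_eq_square)

text \<open>The case K = |C| |\<gamma>'|^6 / |W(\<gamma>)|. W may vanish at the ends of the path,
  which lets paths start at zeros or poles of f.\<close>

lemma ode_growth_comparison:
  fixes p q W :: "complex poly" and \<gamma> \<gamma>' :: "real \<Rightarrow> complex"
  defines "g \<equiv> \<lambda>z. poly p z / poly q z"
  assumes ode: "(pderiv p * q - p * pderiv q) ^ 6 * W = Polynomial.smult C (p ^ 5 * (p + q) ^ 3 * q ^ 4)"
    and ab: "a \<le> b"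
    and \<gamma>: "continuous_on {a..b} \<gamma>"
      "\<And>s. a < s \<Longrightarrow> s < b \<Longrightarrow> (\<gamma> has_vector_derivative \<gamma>' s) (at s)"
      "\<And>s. a \<le> s \<Longrightarrow> s \<le> b \<Longrightarrow> poly q (\<gamma> s) \<noteq> 0"
      "\<And>s. a < s \<Longrightarrow> s < b \<Longrightarrow> poly W (\<gamma> s) \<noteq> 0"
    and h: "continuous_on {a..b} h"
      "\<And>s. a < s \<Longrightarrow> s < b \<Longrightarrow> (h has_real_derivative h' s) (at s)"
      "\<And>s. a < s \<Longrightarrow> s < b \<Longrightarrow> h s > 0"
      "\<And>s. a < s \<Longrightarrow> s < b \<Longrightarrow> h' s \<ge> 0"
      "\<And>s. a < s \<Longrightarrow> s < b \<Longrightarrow>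
         norm C * norm (\<gamma>' s) ^ 6 * (h s ^ 5 * (1 + h s) ^ 3) \<le> h' s ^ 6 * norm (poly W (\<gamma> s))"
    and start: "norm (g (\<gamma> a)) \<le> h a"
  shows "norm (g (\<gamma> b)) \<le> h b"
proof -
  define g' where "g' = (\<lambda>z. poly (pderiv p * q - p * pderiv q) z / poly q z ^ 2)"
  have ode': "g' z ^ 6 * poly W z = C * g z ^ 5 * (1 + g z) ^ 3" if "poly q z \<noteq> 0" for z
  proof -
    have "poly (pderiv p * q - p * pderiv q) z ^ 6 * poly W z = C * (poly p z ^ 5 * (poly p z + poly q z) ^ 3 * poly q z ^ 4)"
      using arg_cong[OF ode, of "\<lambda>r. poly r z"] by simp
    moreover have "1 + g z = (poly p z + poly q z) / poly q z" using that by (simp add: g_def field_simps)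
    ultimately show ?thesis using that
      by (simp add: g'_def g_def power_divide field_simps flip: power_mult)
  qed
  show ?thesis
  proof (rule growth_comparison[where G = "\<lambda>s. g (\<gamma> s)" and G' = "\<lambda>s. \<gamma>' s * g' (\<gamma> s)" and h = h and h' = h'
        and K = "\<lambda>s. norm C * norm (\<gamma>' s) ^ 6 / norm (poly W (\<gamma> s))"])
    show "continuous_on {a..b} (\<lambda>s. g (\<gamma> s))"
      unfolding g_def using \<gamma> by (intro continuous_intros) auto
  next
    fix s assume s: "a < s" "s < b"
    show "((\<lambda>s. g (\<gamma> s)) has_vector_derivative \<gamma>' s * g' (\<gamma> s)) (at s)"
      using field_vector_diff_chain_at[OF \<gamma>(2)[OF s], of g "g' (\<gamma> s)"] s \<gamma>(3)[of s]
        quotient_has_field_derivative[of q "\<gamma> s" p]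
      unfolding g_def g'_def o_def by auto
    have W: "norm (poly W (\<gamma> s)) > 0" using \<gamma>(4)[OF s] by simp
    have "norm (g' (\<gamma> s)) ^ 6 * norm (poly W (\<gamma> s)) = norm C * norm (g (\<gamma> s)) ^ 5 * norm (1 + g (\<gamma> s)) ^ 3"
      using arg_cong[OF ode'[OF \<gamma>(3)[of s]], of norm] s by (simp add: norm_mult norm_power)
    also have "\<dots> \<le> norm C * norm (g (\<gamma> s)) ^ 5 * (1 + norm (g (\<gamma> s))) ^ 3"
      using norm_triangle_ineq[of 1 "g (\<gamma> s)"] by (intro mult_left_mono power_mono) auto
    finally have "norm (g' (\<gamma> s)) ^ 6 \<le> norm C * norm (g (\<gamma> s)) ^ 5 * (1 + norm (g (\<gamma> s))) ^ 3 / norm (poly W (\<gamma> s))"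
      using W by (simp add: field_simps)
    hence "norm (\<gamma>' s) ^ 6 * norm (g' (\<gamma> s)) ^ 6
        \<le> norm (\<gamma>' s) ^ 6 * (norm C * norm (g (\<gamma> s)) ^ 5 * (1 + norm (g (\<gamma> s))) ^ 3 / norm (poly W (\<gamma> s)))"
      by (intro mult_left_mono) auto
    thus "norm (\<gamma>' s * g' (\<gamma> s)) ^ 6 \<le> norm C * norm (\<gamma>' s) ^ 6 / norm (poly W (\<gamma> s)) *
        norm (g (\<gamma> s)) ^ 5 * (1 + norm (g (\<gamma> s))) ^ 3"
      by (simp add: norm_mult power_mult_distrib mult_ac)
    show "norm C * norm (\<gamma>' s) ^ 6 / norm (poly W (\<gamma> s)) * h s ^ 5 * (1 + h s) ^ 3 \<le> h' s ^ 6"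
      using h(5)[OF s] W by (simp add: field_simps)
  qed (use ab h start in auto)
qed

text \<open>The bound |p| \<le> B |q| survives the passage to the end of the path: a quotient
  bounded along the path cannot have a pole there, unless p vanishes too.\<close>

lemma poly_norm_le_closed:
  fixes p q :: "complex poly" and \<gamma> :: "real \<Rightarrow> complex"
  assumes "a < b" "continuous_on {a..b} \<gamma>"
    and "\<And>s. a \<le> s \<Longrightarrow> s < b \<Longrightarrow> norm (poly p (\<gamma> s) / poly q (\<gamma> s)) \<le> B"
    and "\<And>s. a \<le> s \<Longrightarrow> s < b \<Longrightarrow> poly q (\<gamma> s) \<noteq> 0"
    and "poly q (\<gamma> b) = 0"
  shows "poly p (\<gamma> b) = 0"
proof -
  have cl: "closure {a..<b} = {a..b}" using assms(1) by (simp add: closure_atLeastLessThan)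
  have "norm (poly p (\<gamma> b)) - B * norm (poly q (\<gamma> b)) \<le> 0"
  proof (rule continuous_le_on_closure[where S = "{a..<b}" and f = "\<lambda>s. norm (poly p (\<gamma> s)) - B * norm (poly q (\<gamma> s))"])
    show "continuous_on (closure {a..<b}) (\<lambda>s. norm (poly p (\<gamma> s)) - B * norm (poly q (\<gamma> s)))"
      unfolding cl using assms(2) by (intro continuous_intros)
    show "b \<in> closure {a..<b}" unfolding cl using assms(1) by simp
    show "norm (poly p (\<gamma> s)) - B * norm (poly q (\<gamma> s)) \<le> 0" if "s \<in> {a..<b}" for s
      using assms(3,4)[of s] that by (simp add: norm_divide field_simps)
  qed
  thus ?thesis using assms(5) by simp
qed

section \<open>Points with small logarithmic derivative\<close>

text \<open>In terms of X and Y one has g = 1 / X^3, g' = - 3 X^(-4) Y w logd and Y^2 = (1 + g) / g;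
  the sixth power removes all roots.\<close>

lemma (in mordell_curve) coord_ode:
  assumes c: "y ^ 2 = x ^ 3 + f"
  defines "g \<equiv> f / x ^ 3"
  shows "rat_deriv g ^ 6 = 729 * logd (Affine x y) ^ 6 * f * g ^ 5 * (1 + g) ^ 3"
proof -
  note nz = coord_nz[OF c]
  define L where "L = rat_deriv f / (6 * f)"
  define R where "R = logd (Affine x y)"
  have Df: "rat_deriv f = 6 * f * L" by (simp add: L_def)
  have Dx: "rat_deriv x = R * y + 2 * x * L" unfolding R_def L_def by (rule logd_deriv[OF c])
  have "rat_deriv g = (6 * f * L * x ^ 3 - f * (3 * x ^ 2 * (R * y + 2 * x * L))) / (x ^ 3) ^ 2"
    using nz by (simp add: g_def rat_deriv_divide rat_deriv_power Df Dx)
  also have "6 * f * L * x ^ 3 - f * (3 * x ^ 2 * (R * y + 2 * x * L)) = - 3 * f * R * y * x ^ 2"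
    by Groebner_Basis.algebra
  also have "(x ^ 3) ^ 2 = x ^ 4 * x ^ 2" by (simp flip: power_mult power_add)
  finally have Dg: "rat_deriv g = - 3 * f * R * y / x ^ 4"
    using nz(1) by (simp only: mult_divide_mult_cancel_right power_not_zero not_False_eq_True)
  have "rat_deriv g ^ 6 = 729 * f ^ 6 * R ^ 6 * (y ^ 2) ^ 3 / x ^ 24"
    unfolding Dg by (simp add: power_mult_distrib power_divide flip: power_mult)
  also have "\<dots> = 729 * R ^ 6 * f * (f ^ 5 / x ^ 15) * ((x ^ 3 + f) / x ^ 3) ^ 3"
    unfolding c using nz by (simp add: power_divide field_simps flip: power_mult power_add)
       (simp add: eval_nat_numeral)
  also have "f ^ 5 / x ^ 15 = g ^ 5" by (simp add: g_def power_divide flip: power_mult)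
  also have "(x ^ 3 + f) / x ^ 3 = 1 + g" using nz by (simp add: g_def field_simps)
  finally show ?thesis unfolding R_def .
qed

lemma ode_poly:
  assumes g: "g = to_fract p / to_fract q" "q \<noteq> 0"
    and ode: "rat_deriv g ^ 6 * to_fract W = ratfun_const C * g ^ 5 * (1 + g) ^ 3"
  shows "(pderiv p * q - p * pderiv q) ^ 6 * W = Polynomial.smult C (p ^ 5 * (p + q) ^ 3 * q ^ 4)"
proof -
  define d where "d = to_fract (pderiv p * q - p * pderiv q)"
  have Dg: "rat_deriv g = d / to_fract q ^ 2" unfolding g(1) d_def by (rule rat_deriv_to_fract_quot) fact
  have 1: "1 + g = (to_fract p + to_fract q) / to_fract q" using g by (simp add: field_simps)
  have "d ^ 6 * to_fract W * to_fract q ^ 8 = ratfun_const C * (to_fract p ^ 5 * (to_fract p + to_fract q) ^ 3 * to_fract q ^ 4) * to_fract q ^ 8"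
    using ode g(2) unfolding Dg 1 unfolding g(1)
    by (simp add: power_divide field_simps flip: power_mult power_add)
  hence "d ^ 6 * to_fract W = ratfun_const C * (to_fract p ^ 5 * (to_fract p + to_fract q) ^ 3 * to_fract q ^ 4)"
    using g(2) by simp
  hence "to_fract ((pderiv p * q - p * pderiv q) ^ 6 * W) = to_fract ([:C:] * (p ^ 5 * (p + q) ^ 3 * q ^ 4))"
    unfolding to_fract_mult to_fract_power to_fract_add ratfun_const_def[symmetric] d_def by simp
  thus ?thesis unfolding to_fract_eq_iff by simp
qed

text \<open>Treats a g without finite poles by comparing the degrees of the two sides of the
  equation.\<close>

lemma ode_degree:
  fixes p q W :: "complex poly"
  assumes ode: "(pderiv p * q - p * pderiv q) ^ 6 * W = Polynomial.smult C (p ^ 5 * (p + q) ^ 3 * q ^ 4)"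
    and "Polynomial.degree q = 0" "q \<noteq> 0" "Polynomial.degree p > 0" "C \<noteq> 0" "W \<noteq> 0"
  shows "6 * (Polynomial.degree p - 1) + Polynomial.degree W = 8 * Polynomial.degree p"
proof -
  obtain k where k: "q = [:k:]" "k \<noteq> 0" using assms(2,3) by (metis degree_eq_zeroE pCons_0_0)
  have dpq: "Polynomial.degree (p + q) = Polynomial.degree p" using assms(2,4) by (intro degree_add_eq_left) simp
  hence p: "p \<noteq> 0" "pderiv p \<noteq> 0" "p + q \<noteq> 0"
    using pderiv_eq_0_iff[of p] assms(4) by (metis degree_0 less_numeral_extra(3))+
  hence "Polynomial.degree (Polynomial.smult C (p ^ 5 * (p + q) ^ 3 * q ^ 4)) = 8 * Polynomial.degree p"
    using assms(2-) p dpq by (simp add: degree_mult_eq degree_power_eq)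
  moreover have "pderiv q = 0" using k by (simp add: pderiv_pCons)
  hence "Polynomial.degree ((pderiv p * q - p * pderiv q) ^ 6 * W) =
      6 * (Polynomial.degree p - 1) + Polynomial.degree W"
    using assms(2-) p by (simp add: degree_mult_eq degree_power_eq degree_pderiv)
  ultimately show ?thesis unfolding ode by simp
qed

text \<open>When \<open>logd\<close> is a constant multiple of a fixed function, \<open>W\<close> is
  chosen to clear everything but that constant. Lowest terms are passed on as the absence of common
  zeros.\<close>

lemma (in mordell_curve) obtain_coord_ode:
  assumes on: "y ^ 2 = x ^ 3 + f" and W: "logd (Affine x y) ^ 6 * f * to_fract W = ratfun_const C"
  obtains p q where "f / x ^ 3 = to_fract p / to_fract q" "p \<noteq> 0" "q \<noteq> 0"
    "\<forall>z. poly p z \<noteq> 0 \<or> poly q z \<noteq> 0"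
    "(pderiv p * q - p * pderiv q) ^ 6 * W = Polynomial.smult (729 * C) (p ^ 5 * (p + q) ^ 3 * q ^ 4)"
proof -
  define g where "g = f / x ^ 3"
  obtain p q where pq: "g = to_fract p / to_fract q" "q \<noteq> 0" "coprime p q" by (rule ratfun_cases)
  have "rat_deriv g ^ 6 * to_fract W = (logd (Affine x y) ^ 6 * f * to_fract W) * (729 * g ^ 5 * (1 + g) ^ 3)"
    using coord_ode[OF on] by (simp add: g_def mult_ac)
  hence "rat_deriv g ^ 6 * to_fract W = ratfun_const (729 * C) * g ^ 5 * (1 + g) ^ 3"
    unfolding W by (simp add: mult_ac)
  from ode_poly[OF pq(1,2) this]
  have "(pderiv p * q - p * pderiv q) ^ 6 * W = Polynomial.smult (729 * C) (p ^ 5 * (p + q) ^ 3 * q ^ 4)" .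
  moreover have "p \<noteq> 0" using pq coord_nz[OF on] by (auto simp: g_def)
  moreover have "\<forall>z. poly p z \<noteq> 0 \<or> poly q z \<noteq> 0" using pq(3) coprime_poly_0 by blast
  ultimately show ?thesis using that[of p q] pq unfolding g_def by blast
qed

lemma segment_ge:
  fixes s b c :: real
  assumes "0 \<le> s" "s \<le> b" "- 1 \<le> b * c"
  shows "- 1 \<le> s * c"
proof (cases "c \<ge> 0")
  case True
  hence "0 \<le> s * c" using assms(1) by simp
  thus ?thesis by linarith
next
  case False
  hence "b * c \<le> s * c" using assms by (intro mult_right_mono_neg) auto
  thus ?thesis using assms(3) by linarith
qed

text \<open>Applied to the denominator of g it gives a nearest pole, so that the segment leading
  there meets no other pole.\<close>

lemma obtain_root_of_min_dist:
  fixes q :: "complex poly" and d :: "complex \<Rightarrow> real"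
  assumes "q \<noteq> 0" "poly q z0 = 0" "Q z0"
  obtains z where "poly q z = 0" "Q z" "\<And>w. poly q w = 0 \<Longrightarrow> Q w \<Longrightarrow> d z \<le> d w"
proof -
  define S where "S = {z. poly q z = 0 \<and> Q z}"
  have S: "finite S" "S \<noteq> {}"
    using assms rev_finite_subset[OF poly_roots_finite[OF assms(1)]] by (auto simp: S_def)
  show ?thesis
    using arg_min_if_finite(1)[OF S, of d] arg_min_least[OF S, of _ d] that[of "arg_min_on d S"]
    by (auto simp: S_def)
qed


section \<open>Lower bound for \<open>logd\<close> on the first curve\<close>

lemma sum_sixth_powers_ge:
  fixes x :: real
  shows "x ^ 6 + (1 - x) ^ 6 \<ge> 1 / 32"
proof -
  have sq: "(u + v) ^ 2 \<le> 2 * (u ^ 2 + v ^ 2)" for u v :: real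
    using zero_le_power2[of "u - v"] by (simp add: power2_eq_square algebra_simps)
  have "x ^ 3 + (1 - x) ^ 3 = 3 * (x - 1 / 2) ^ 2 + 1 / 4"
    by (simp add: power3_eq_cube power2_eq_square field_simps)
  hence "x ^ 3 + (1 - x) ^ 3 \<ge> 1 / 4" by simp
  hence "(1 / 4) ^ 2 \<le> (x ^ 3 + (1 - x) ^ 3) ^ 2" by (intro power_mono) auto
  also have "\<dots> \<le> 2 * ((x ^ 3) ^ 2 + ((1 - x) ^ 3) ^ 2)" by (rule sq)
  finally show ?thesis by (simp flip: power_mult add: power2_eq_square)
qed

text \<open>With \<open>r = |t|\<close>, the metric on the first curve is dominated by \<open>r^(-1/6) |1 - r^2|^(-5/6) dr\<close>.
  The radius is parametrised so that \<open>(1 - r) / r = ((1 - s) / s)^6\<close>, which removes the singularity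
  at \<open>r = 1\<close>.\<close>

lemma E1_path_inner:
  fixes C e :: complex and p q :: "complex poly"
  defines "r \<equiv> \<lambda>s::real. s ^ 6 / (s ^ 6 + (1 - s) ^ 6)"
  assumes ode: "(pderiv p * q - p * pderiv q) ^ 6 * (q1 ^ 5 * [:0, 1:]) = Polynomial.smult C (p ^ 5 * (p + q) ^ 3 * q ^ 4)"
    and C: "norm C * (65 ^ 3 * 32 ^ 6) \<le> 1"
    and e: "norm e = 1" and p0: "poly p 0 = 0"
    and b: "0 \<le> b" "b \<le> 1" and q: "\<And>s. 0 \<le> s \<Longrightarrow> s \<le> b \<Longrightarrow> poly q (of_real (r s) * e) \<noteq> 0"
  shows "norm (poly p (of_real (r b) * e) / poly q (of_real (r b) * e)) \<le> b ^ 6"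
proof -
  define S where "S = (\<lambda>s::real. s ^ 6 + (1 - s) ^ 6)"
  have S: "S s \<ge> 1 / 32" for s unfolding S_def by (rule sum_sixth_powers_ge)
  have S_pos: "S s > 0" for s using S[of s] by linarith
  define r' where "r' = (\<lambda>s. 6 * s ^ 5 * (1 - s) ^ 5 / S s ^ 2)"
  have r_eq: "r s = s ^ 6 / S s" for s by (simp add: r_def S_def)
  have r_deriv: "(r has_real_derivative r' s) (at s)" for s
  proof -
    have "(S has_real_derivative 6 * s ^ 5 - 6 * (1 - s) ^ 5) (at s)"
      unfolding S_def by (auto intro!: derivative_eq_intros)
    hence "((\<lambda>s. s ^ 6 / S s) has_real_derivative (6 * s ^ 5 * S s - s ^ 6 * (6 * s ^ 5 - 6 * (1 - s) ^ 5)) / S s ^ 2) (at s)"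
      using S_pos[of s] by (auto intro!: derivative_eq_intros simp: power2_eq_square)
    also have "6 * s ^ 5 * S s - s ^ 6 * (6 * s ^ 5 - 6 * (1 - s) ^ 5) = 6 * s ^ 5 * (1 - s) ^ 5"
      unfolding S_def by Groebner_Basis.algebra
    finally show ?thesis unfolding r'_def r_eq[abs_def] .
  qed
  have r01: "0 < r s" "r s < 1" "1 - r s = (1 - s) ^ 6 / S s" if "0 < s" "s < 1" for s
    using that S_pos[of s] by (simp_all add: r_eq field_simps) (simp_all add: S_def)
  have norm_q1: "norm (poly q1 (of_real (r s) * e)) \<ge> 1 - r s" if "0 < s" "s < 1" for s
  proof -
    have "poly q1 (of_real (r s) * e) = 1 - (- ((of_real (r s) * e) ^ 2))"
      by (simp add: q1_def power2_eq_square)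
    also have "norm \<dots> \<ge> norm (1::complex) - norm (- ((of_real (r s) * e) ^ 2))" by (rule norm_triangle_ineq2)
    also have "norm (- ((of_real (r s) * e) ^ 2)) = r s ^ 2" using e by (simp add: norm_mult norm_power)
    finally have "norm (poly q1 (of_real (r s) * e)) \<ge> 1 - r s ^ 2" by simp
    moreover have "r s ^ 2 \<le> r s" using r01[OF that] by (simp add: power2_eq_square mult_left_le)
    ultimately show ?thesis by simp
  qed
  define W where "W = q1 ^ 5 * [:0, 1:]"
  have W: "norm (poly W (of_real (r s) * e)) \<ge> (1 - r s) ^ 5 * r s" if "0 < s" "s < 1" for s
    using norm_q1[OF that] r01[OF that] e
    by (auto simp: W_def norm_mult norm_power intro!: mult_right_mono power_mono)
  have W_pos: "(1 - r s) ^ 5 * r s > 0" if "0 < s" "s < 1" for s using r01[OF that] by simp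
  show ?thesis
  proof (rule ode_growth_comparison[where \<gamma> = "\<lambda>s. of_real (r s) * e" and \<gamma>' = "\<lambda>s. of_real (r' s) * e" and a = 0
        and h = "\<lambda>s. s ^ 6" and h' = "\<lambda>s. 6 * s ^ 5", OF ode[folded W_def] b(1)])
    show "continuous_on {0..b} (\<lambda>s. of_real (r s) * e)"
      using r_deriv by (intro continuous_intros) (meson DERIV_isCont continuous_at_imp_continuous_on)
  next
    fix s assume s: "0 < s" "s < b"
    hence s1: "0 < s" "s < 1" using b by auto
    show "((\<lambda>s. of_real (r s) * e) has_vector_derivative of_real (r' s) * e) (at s)"
      using r_deriv[of s] by (auto intro!: derivative_eq_intros simp: has_real_derivative_iff_has_vector_derivative)
    show "poly W (of_real (r s) * e) \<noteq> 0" using W[OF s1] W_pos[OF s1] by auto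
    \<comment> \<open>8 bounds (1 + h)^3 on this part; the 65^3 of the hypothesis is sized for
      \<open>E1_path_outer\<close>. The factor 32^6 offsets the minimum 1/32 of S.\<close>
    have "norm C * (8 * s ^ 24) \<le> S s ^ 6"
    proof -
      have "norm C * (8 * s ^ 24) \<le> norm C * (65 ^ 3 * 1)"
        using s1 by (intro mult_left_mono mult_mono power_le_one) auto
      also have "\<dots> \<le> (1 / 32) ^ 6" using C by (simp add: field_simps)
      also have "\<dots> \<le> S s ^ 6" using S[of s] by (intro power_mono) auto
      finally show ?thesis .
    qed
    hence key: "(norm C * (8 * s ^ 24)) * (6 ^ 6 * s ^ 36 * (1 - s) ^ 30 / S s ^ 12)
        \<le> S s ^ 6 * (6 ^ 6 * s ^ 36 * (1 - s) ^ 30 / S s ^ 12)"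
      using s1 S_pos[of s] by (intro mult_right_mono) auto
    have "norm C * norm (of_real (r' s) * e) ^ 6 * ((s ^ 6) ^ 5 * (1 + s ^ 6) ^ 3)
        \<le> norm C * r' s ^ 6 * ((s ^ 6) ^ 5 * 8)"
    proof -
      have "(1 + s ^ 6) ^ 3 \<le> 2 ^ 3" using s1 by (intro power_mono) (auto simp: power_le_one)
      thus ?thesis using e by (auto simp: norm_mult intro!: mult_left_mono)
    qed
    also have "\<dots> = (norm C * (8 * s ^ 24)) * (6 ^ 6 * s ^ 36 * (1 - s) ^ 30 / S s ^ 12)"
      unfolding r'_def by (simp add: power_mult_distrib power_divide mult_ac flip: power_mult power_add)
    also note key
    also have "S s ^ 6 * (6 ^ 6 * s ^ 36 * (1 - s) ^ 30 / S s ^ 12) = (6 * s ^ 5) ^ 6 * ((1 - r s) ^ 5 * r s)"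
      unfolding r01(3)[OF s1] unfolding r_eq using S_pos[of s]
      by (simp add: power_mult_distrib power_divide field_simps flip: power_mult power_add)
         (simp add: eval_nat_numeral)
    also have "\<dots> \<le> (6 * s ^ 5) ^ 6 * norm (poly W (of_real (r s) * e))"
      using W[OF s1] s1 by (intro mult_left_mono) auto
    finally show "norm C * norm (of_real (r' s) * e) ^ 6 * ((s ^ 6) ^ 5 * (1 + s ^ 6) ^ 3)
        \<le> (6 * s ^ 5) ^ 6 * norm (poly W (of_real (r s) * e))" .
  qed (use q p0 in \<open>auto intro!: continuous_intros derivative_eq_intros simp: r_def\<close>)
qed

text \<open>The radius is the reciprocal of the inner radius at 1 - s, so s = 1 stands for infinity.
  The comparison function (1 + s)^6 continues s^6 from the value 1 at the unit circle and stays
  below 2^6 up to infinity; 65 is 1 + 2^6.\<close>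

lemma E1_path_outer:
  fixes C e :: complex and p q :: "complex poly"
  defines "r \<equiv> \<lambda>s::real. (s ^ 6 + (1 - s) ^ 6) / (1 - s) ^ 6"
  assumes ode: "(pderiv p * q - p * pderiv q) ^ 6 * (q1 ^ 5 * [:0, 1:]) = Polynomial.smult C (p ^ 5 * (p + q) ^ 3 * q ^ 4)"
    and C: "norm C * (65 ^ 3 * 32 ^ 6) \<le> 1"
    and e: "norm e = 1" and start: "norm (poly p e / poly q e) \<le> 1"
    and b: "0 \<le> b" "b < 1" and q: "\<And>s. 0 \<le> s \<Longrightarrow> s \<le> b \<Longrightarrow> poly q (of_real (r s) * e) \<noteq> 0"
  shows "norm (poly p (of_real (r b) * e) / poly q (of_real (r b) * e)) \<le> (1 + b) ^ 6"
proof -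
  define S where "S = (\<lambda>s::real. s ^ 6 + (1 - s) ^ 6)"
  have S: "S s \<ge> 1 / 32" for s unfolding S_def by (rule sum_sixth_powers_ge)
  have S_pos: "S s > 0" for s using S[of s] by linarith
  define r' where "r' = (\<lambda>s::real. 6 * s ^ 5 / (1 - s) ^ 7)"
  have r_eq: "r s = S s / (1 - s) ^ 6" for s by (simp add: r_def S_def)
  have r_deriv: "(r has_real_derivative r' s) (at s)" if "s < 1" for s
  proof -
    have "(S has_real_derivative 6 * s ^ 5 - 6 * (1 - s) ^ 5) (at s)"
      unfolding S_def by (auto intro!: derivative_eq_intros)
    hence "((\<lambda>s. S s / (1 - s) ^ 6) has_real_derivative
        ((6 * s ^ 5 - 6 * (1 - s) ^ 5) * (1 - s) ^ 6 + S s * (6 * (1 - s) ^ 5)) / ((1 - s) ^ 6) ^ 2) (at s)"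
      using that by (auto intro!: derivative_eq_intros simp: power2_eq_square)
    also have "(6 * s ^ 5 - 6 * (1 - s) ^ 5) * (1 - s) ^ 6 + S s * (6 * (1 - s) ^ 5) = 6 * s ^ 5 * (1 - s) ^ 5"
      unfolding S_def by Groebner_Basis.algebra
    also have "6 * s ^ 5 * (1 - s) ^ 5 / ((1 - s) ^ 6) ^ 2 = r' s"
      using that by (simp add: r'_def field_simps flip: power_mult power_add)
    finally show ?thesis unfolding r_eq[abs_def] .
  qed
  have r1: "1 < r s" "r s - 1 = s ^ 6 / (1 - s) ^ 6" if "0 < s" "s < 1" for s
    using that by (simp_all add: r_eq field_simps) (simp_all add: S_def)
  have norm_q1: "norm (poly q1 (of_real (r s) * e)) \<ge> (r s - 1) * r s" if "0 < s" "s < 1" for s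
  proof -
    have "poly q1 (of_real (r s) * e) = (of_real (r s) * e) ^ 2 - (- 1)"
      by (simp add: q1_def power2_eq_square)
    also have "norm \<dots> \<ge> norm ((of_real (r s) * e) ^ 2) - norm (- 1 :: complex)" by (rule norm_triangle_ineq2)
    also have "norm ((of_real (r s) * e) ^ 2) = r s ^ 2" using e by (simp add: norm_mult norm_power)
    finally have "norm (poly q1 (of_real (r s) * e)) \<ge> r s ^ 2 - 1" by simp
    moreover have "(r s - 1) * r s \<le> r s ^ 2 - 1" using r1[OF that] by (simp add: power2_eq_square algebra_simps)
    ultimately show ?thesis by simp
  qed
  define W where "W = q1 ^ 5 * [:0, 1:]"
  have W: "norm (poly W (of_real (r s) * e)) \<ge> ((r s - 1) * r s) ^ 5 * r s" if "0 < s" "s < 1" for s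
    using norm_q1[OF that] r1[OF that] e
    by (auto simp: W_def norm_mult norm_power intro!: mult_right_mono power_mono)
  have W_pos: "((r s - 1) * r s) ^ 5 * r s > 0" if "0 < s" "s < 1" for s using r1(1)[OF that] by simp
  show ?thesis
  proof (rule ode_growth_comparison[where \<gamma> = "\<lambda>s. of_real (r s) * e" and \<gamma>' = "\<lambda>s. of_real (r' s) * e" and a = 0
        and h = "\<lambda>s. (1 + s) ^ 6" and h' = "\<lambda>s. 6 * (1 + s) ^ 5", OF ode[folded W_def] b(1)])
    have "isCont r s" if "s \<in> {0..b}" for s using r_deriv[of s] that b by (auto intro: DERIV_isCont)
    thus "continuous_on {0..b} (\<lambda>s. of_real (r s) * e)"
      by (intro continuous_intros continuous_at_imp_continuous_on) auto
  next
    fix s assume s: "0 < s" "s < b"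
    hence s1: "0 < s" "s < 1" using b by auto
    show "((\<lambda>s. of_real (r s) * e) has_vector_derivative of_real (r' s) * e) (at s)"
      using r_deriv[of s] s1 by (auto intro!: derivative_eq_intros simp: has_real_derivative_iff_has_vector_derivative)
    show "poly W (of_real (r s) * e) \<noteq> 0" using W[OF s1] W_pos[OF s1] by auto
    have "norm C * (65 ^ 3 * (1 - s) ^ 24) \<le> S s ^ 6"
    proof -
      have "norm C * (65 ^ 3 * (1 - s) ^ 24) \<le> norm C * (65 ^ 3 * 1)"
        using s1 by (intro mult_left_mono power_le_one) auto
      also have "\<dots> \<le> (1 / 32) ^ 6" using C by (simp add: field_simps)
      also have "\<dots> \<le> S s ^ 6" using S[of s] by (intro power_mono) auto
      finally show ?thesis .
    qed
    hence key: "(norm C * (65 ^ 3 * (1 - s) ^ 24)) * (6 ^ 6 * s ^ 30 * (1 + s) ^ 30 / (1 - s) ^ 66)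
        \<le> S s ^ 6 * (6 ^ 6 * s ^ 30 * (1 + s) ^ 30 / (1 - s) ^ 66)"
      using s1 by (intro mult_right_mono) auto
    have "norm C * norm (of_real (r' s) * e) ^ 6 * (((1 + s) ^ 6) ^ 5 * (1 + (1 + s) ^ 6) ^ 3)
        \<le> norm C * r' s ^ 6 * (((1 + s) ^ 6) ^ 5 * 65 ^ 3)"
    proof -
      have "(1 + s) ^ 6 \<le> 2 ^ 6" using s1 by (intro power_mono) auto
      hence "(1 + (1 + s) ^ 6) ^ 3 \<le> 65 ^ 3" using s1 by (intro power_mono) auto
      thus ?thesis using e s1 by (auto simp: norm_mult intro!: mult_left_mono simp del: power_numeral)
    qed
    also have "\<dots> = (norm C * (65 ^ 3 * (1 - s) ^ 24)) * (6 ^ 6 * s ^ 30 * (1 + s) ^ 30 / (1 - s) ^ 66)"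
      unfolding r'_def using s1 by (simp add: power_mult_distrib power_divide field_simps flip: power_mult power_add)
    also note key
    also have "S s ^ 6 * (6 ^ 6 * s ^ 30 * (1 + s) ^ 30 / (1 - s) ^ 66) = (6 * (1 + s) ^ 5) ^ 6 * (((r s - 1) * r s) ^ 5 * r s)"
      unfolding r1(2)[OF s1] unfolding r_eq using s1
      by (simp add: power_mult_distrib power_divide field_simps flip: power_mult power_add)
         (simp add: eval_nat_numeral)
    also have "\<dots> \<le> (6 * (1 + s) ^ 5) ^ 6 * norm (poly W (of_real (r s) * e))"
      using W[OF s1] s1 by (intro mult_left_mono) auto
    finally show "norm C * norm (of_real (r' s) * e) ^ 6 * (((1 + s) ^ 6) ^ 5 * (1 + (1 + s) ^ 6) ^ 3)
        \<le> (6 * (1 + s) ^ 5) ^ 6 * norm (poly W (of_real (r s) * e))" .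
  qed (use q start in \<open>auto intro!: continuous_intros derivative_eq_intros simp: r_def\<close>)
qed

lemma E1_small:
  assumes P: "P \<in> E1.points" "E1.logd P = ratfun_const c / to_fract q1"
    and c: "norm (729 * c ^ 6) * (65 ^ 3 * 32 ^ 6) \<le> 1"
  shows "P = Infinity"
proof (rule ccontr)
  assume "P \<noteq> Infinity"
  then obtain x y where xy: "P = Affine x y" by (cases P) auto
  have on: "y ^ 2 = x ^ 3 + F1" using P xy by simp
  note nz = E1.coord_nz[OF on]
  define C where "C = 729 * c ^ 6"
  have "c \<noteq> 0" using E1.logd_eq_0[OF P(1)] \<open>P \<noteq> Infinity\<close> P(2) by auto
  hence C: "C \<noteq> 0" by (simp add: C_def)
  define W where "W = q1 ^ 5 * [:0, 1:]"
  have W: "to_fract W = to_fract q1 ^ 5 * tvar" by (simp only: W_def to_fract_mult to_fract_power tvar_def)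
  have "E1.logd (Affine x y) ^ 6 * F1 * to_fract W = ratfun_const (c ^ 6)"
  proof -
    have "(ratfun_const c / to_fract q1) ^ 6 * F1 * to_fract W = ratfun_const c ^ 6"
      using tvar_nonzero by (simp add: W F_eq power_divide field_simps flip: power_Suc)
    thus ?thesis unfolding xy[symmetric] P(2) by simp
  qed
  from E1.obtain_coord_ode[OF on this, folded C_def]
  obtain p q where pq: "F1 / x ^ 3 = to_fract p / to_fract q" and p_nz: "p \<noteq> 0" and q_nz: "q \<noteq> 0"
    and cop: "\<forall>z. poly p z \<noteq> 0 \<or> poly q z \<noteq> 0"
    and ode: "(pderiv p * q - p * pderiv q) ^ 6 * W = Polynomial.smult C (p ^ 5 * (p + q) ^ 3 * q ^ 4)" .
  have coprime: "poly p z \<noteq> 0 \<or> poly q z \<noteq> 0" for z using cop by simp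
  \<comment> \<open>F1 has odd order -1 at 0, while y^2 has even order; hence x has a pole there and
    g vanishes.\<close>
  have g0: "rord 0 (F1 / x ^ 3) \<ge> 1"
  proof -
    have "rord 0 x < 0"
    proof (rule ccontr)
      assume "\<not> rord 0 x < 0"
      hence "rord 0 (F1 + x ^ 3) = rord 0 F1"
        using nz by (intro rord_add_eq[where k = 0]) (auto simp: rord_ge_def rord_F1_0 rord_power)
      moreover have "rord 0 (F1 + x ^ 3) = 2 * rord 0 y" 
        using nz unfolding add.commute[of F1] on[symmetric] by (simp add: rord_power)
      ultimately show False using rord_F1_0 by presburger
    qed
    thus ?thesis using nz by (simp add: rord_divide rord_power rord_F1_0)
  qed
  hence "Polynomial.order 0 p > 0" using pq p_nz q_nz by (simp add: rord_quot)
  hence p0: "poly p 0 = 0" by (simp add: order_root)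
  show False
  proof (cases "Polynomial.degree q = 0")
    case True
    have "Polynomial.degree p > 0" using p0 p_nz by (metis degree_0_id gr0I poly_pCons poly_0 mult_zero_left add.right_neutral pCons_0_0)
    moreover have "Polynomial.degree W = 11"
      by (simp add: W_def degree_mult_eq degree_power_eq) (simp add: q1_def)
    moreover have "W \<noteq> 0" by (simp add: W_def)
    \<comment> \<open>The equation amounts to 2 * degree p = 5.\<close>
    ultimately have "6 * (Polynomial.degree p - 1) + 11 = 8 * Polynomial.degree p"
      using ode_degree[OF ode True q_nz _ C] by simp
    thus False using \<open>Polynomial.degree p > 0\<close> by presburger
  next
    case False
    hence "\<not> constant (poly q)" by (simp add: constant_degree)
    then obtain z0 where "poly q z0 = 0" using fundamental_theorem_of_algebra by blast
    then obtain z where z: "poly q z = 0" "\<And>w. poly q w = 0 \<Longrightarrow> norm z \<le> norm w"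
      using obtain_root_of_min_dist[OF q_nz, of z0 "\<lambda>_. True" norm] by metis
    have "z \<noteq> 0" using z(1) p0 coprime by auto
    define \<rho> where "\<rho> = norm z"
    define e where "e = z / of_real \<rho>"
    have \<rho>: "\<rho> > 0" using \<open>z \<noteq> 0\<close> by (simp add: \<rho>_def)
    have e: "norm e = 1" "z = of_real \<rho> * e" using \<rho> by (auto simp: e_def norm_divide \<rho>_def)
    have q: "poly q (of_real s * e) \<noteq> 0" if "0 \<le> s" "s < \<rho>" for s
    proof
      assume "poly q (of_real s * e) = 0"
      hence "norm z \<le> norm (of_real s * e)" by (rule z(2))
      thus False using that e(1) by (simp add: norm_mult \<rho>_def)
    qed
    define r where "r = (\<lambda>s::real. s ^ 6 / (s ^ 6 + (1 - s) ^ 6))"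
    have S: "s ^ 6 + (1 - s) ^ 6 > 0" for s :: real using sum_sixth_powers_ge[of s] by linarith
    have r_cont: "continuous_on A r" for A
      unfolding r_def using S by (intro continuous_intros) (auto simp: less_le)
    have r_mono: "r s < r s'" if "0 \<le> s" "s < s'" "s' \<le> 1" for s s'
    proof -
      have "s ^ 6 * (1 - s') ^ 6 < s' ^ 6 * (1 - s) ^ 6"
      proof -
        have "s * (1 - s') < s' * (1 - s)" using that by (simp add: algebra_simps)
        hence "(s * (1 - s')) ^ 6 < (s' * (1 - s)) ^ 6" using that by (intro power_strict_mono) auto
        thus ?thesis by (simp add: power_mult_distrib)
      qed
      thus ?thesis using S[of s] S[of s'] by (simp add: r_def field_simps)
    qed
    have r_nonneg: "r s \<ge> 0" for s using S[of s] by (simp add: r_def)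
    have inner: "norm (poly p (of_real (r b) * e) / poly q (of_real (r b) * e)) \<le> b ^ 6"
      if b: "0 \<le> b" "b \<le> 1" "r b < \<rho>" for b
      unfolding r_def
    proof (rule E1_path_inner[OF ode[unfolded W_def] _ e(1) p0 b(1,2)])
      fix s assume s: "0 \<le> s" "s \<le> b"
      have "r s < \<rho>" using r_mono[of s b] s b by (cases "s = b") auto
      thus "poly q (of_real (s ^ 6 / (s ^ 6 + (1 - s) ^ 6)) * e) \<noteq> 0"
        using q[of "r s"] r_nonneg[of s] by (simp add: r_def)
    qed (use c in \<open>simp add: C_def\<close>)
    show False
    \<comment> \<open>The ray is cut at the unit circle, which carries the zeros of q1; these can
      then only be ends of paths.\<close>
    proof (cases "\<rho> \<le> 1")
      case True
      have "\<exists>b\<ge>0. b \<le> 1 \<and> r b = \<rho>"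
        using \<rho> True by (intro IVT' r_cont) (auto simp: r_def)
      then obtain b where b: "0 \<le> b" "b \<le> 1" "r b = \<rho>" by blast
      have zb: "of_real (r b) * e = z" unfolding b(3) by (rule e(2)[symmetric])
      have "b > 0" using b \<rho> by (cases "b = 0") (auto simp: r_def)
      have "poly p (of_real (r b) * e) = 0"
      proof (rule poly_norm_le_closed[where \<gamma> = "\<lambda>s. of_real (r s) * e" and a = 0 and B = 1 and q = q, OF \<open>b > 0\<close>])
        show "continuous_on {0..b} (\<lambda>s. of_real (r s) * e)" by (intro continuous_intros r_cont)
        fix s assume s: "0 \<le> s" "s < b"
        hence "r s < \<rho>" using r_mono[of s b] b by auto
        moreover have "s ^ 6 \<le> 1" using s b by (intro power_le_one) auto
        ultimately show "norm (poly p (of_real (r s) * e) / poly q (of_real (r s) * e)) \<le> 1"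
          "poly q (of_real (r s) * e) \<noteq> 0"
          using inner[of s] s b q[of "r s"] r_nonneg[of s] by auto
      qed (use z(1) zb in simp)
      thus False using coprime[of z] z(1) zb by simp
    next
      case False
      define R where "R = (\<lambda>s::real. (s ^ 6 + (1 - s) ^ 6) / (1 - s) ^ 6)"
      have R_eq: "R s = 1 + (s / (1 - s)) ^ 6" if "s < 1" for s
        using that by (simp add: R_def field_simps)
      define u where "u = root 6 (\<rho> - 1)"
      define b where "b = u / (1 + u)"
      have u: "u > 0" "u ^ 6 = \<rho> - 1" using False by (simp_all add: u_def)
      have b: "0 < b" "b < 1" "b / (1 - b) = u" using u(1) by (simp_all add: b_def field_simps)
      have Rb: "R b = \<rho>" using b u R_eq[of b] by simp
      have zb: "of_real (R b) * e = z" unfolding Rb by (rule e(2)[symmetric])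
      have R_cont: "continuous_on {0..b} R"
        unfolding R_def using b by (intro continuous_intros) auto
      have R_less: "R s < \<rho>" "R s \<ge> 0" if "0 \<le> s" "s < b" for s
      proof -
        have "s / (1 - s) < b / (1 - b)" using that b by (simp add: field_simps)
        hence "(s / (1 - s)) ^ 6 < u ^ 6" unfolding b(3) using that b by (intro power_strict_mono) auto
        thus "R s < \<rho>" "R s \<ge> 0" using R_eq[of s] that b u by auto
      qed
      have start: "norm (poly p e / poly q e) \<le> 1" using inner[of 1] False by (simp add: r_def)
      have "poly p (of_real (R b) * e) = 0"
      proof (rule poly_norm_le_closed[where \<gamma> = "\<lambda>s. of_real (R s) * e" and a = 0 and B = "2 ^ 6" and q = q, OF b(1)])
        show "continuous_on {0..b} (\<lambda>s. of_real (R s) * e)" by (intro continuous_intros R_cont)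
        fix s assume s: "0 \<le> s" "s < b"
        show "poly q (of_real (R s) * e) \<noteq> 0" using q R_less[OF s] by auto
        have "norm (poly p (of_real (R s) * e) / poly q (of_real (R s) * e)) \<le> (1 + s) ^ 6"
          unfolding R_def
        proof (rule E1_path_outer[OF ode[unfolded W_def] _ e(1) start])
          fix s' assume "0 \<le> s'" "s' \<le> s"
          thus "poly q (of_real ((s' ^ 6 + (1 - s') ^ 6) / (1 - s') ^ 6) * e) \<noteq> 0"
            using q[of "R s'"] R_less[of s'] s by (simp add: R_def)
        qed (use c s b in \<open>simp_all add: C_def\<close>)
        also have "\<dots> \<le> 2 ^ 6" using s b by (intro power_mono) auto
        finally show "norm (poly p (of_real (R s) * e) / poly q (of_real (R s) * e)) \<le> 2 ^ 6" .
      qed (use z(1) zb in simp)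
      thus False using coprime[of z] z(1) zb by simp
    qed
  qed
qed

section \<open>Lower bound for \<open>logd\<close> on the third curve\<close>

text \<open>In the comparison below, \<open>h = b (b + 2)\<close> is the value of \<open>1 / X^3\<close> on the point \<open>(2^(1/3), t)\<close> of the
  third curve at \<open>t = sqrt 2 * (1 + b)\<close>, where \<open>b = a / (2 - a)\<close> for \<open>a \<le> 1\<close> and \<open>b = 2 a - 1\<close> for \<open>a \<ge> 1\<close>.\<close>

lemma E3_path:
  fixes C e :: complex and \<epsilon> :: real and p q :: "complex poly"
  defines "\<gamma> \<equiv> \<lambda>a::real. of_real (\<epsilon> * sqrt 2) * (1 + of_real a * e)"
  assumes ode: "(pderiv p * q - p * pderiv q) ^ 6 * q3 ^ 5 = Polynomial.smult C (p ^ 5 * (p + q) ^ 3 * q ^ 4)"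
    and C: "27 * norm C \<le> 256" and e: "norm e = 1" and \<epsilon>: "\<bar>\<epsilon>\<bar> = 1"
    and p0: "poly p (of_real (\<epsilon> * sqrt 2)) = 0"
    and b: "0 \<le> b" "- 1 \<le> b * Re e"
    and q: "\<And>s. 0 \<le> s \<Longrightarrow> s \<le> b \<Longrightarrow> poly q (\<gamma> s) \<noteq> 0"
  shows "norm (poly p (\<gamma> b) / poly q (\<gamma> b)) \<le> 3 + 4 * b ^ 2"
proof -
  define \<gamma>' where "\<gamma>' = of_real (\<epsilon> * sqrt 2) * e"
  have \<gamma>_deriv: "(\<gamma> has_vector_derivative \<gamma>') (at s)" for s
    unfolding \<gamma>_def \<gamma>'_def by (auto intro!: derivative_eq_intros)
  have \<gamma>_cont: "continuous_on A \<gamma>" for A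
    unfolding \<gamma>_def by (intro continuous_intros)
  have "norm \<gamma>' ^ 2 = 2" using e \<epsilon> by (simp add: \<gamma>'_def norm_mult power_mult_distrib abs_mult)
  hence "(norm \<gamma>' ^ 2) ^ 3 = 8" by simp
  hence norm_\<gamma>': "norm \<gamma>' ^ 6 = 8" by (simp flip: power_mult)
  have \<epsilon>2: "(complex_of_real \<epsilon>) ^ 2 = 1"
    using \<epsilon> by (metis of_real_1 of_real_power power2_abs power_one)
  have q3: "norm (poly q3 (\<gamma> s)) = 2 * s * norm (2 + of_real s * e)" if "s \<ge> 0" for s
  proof -
    have "complex_of_real (sqrt 2) ^ 2 = 2" by (simp flip: of_real_power)
    hence "poly q3 (\<gamma> s) = 2 * (1 + of_real s * e) ^ 2 - 2"
      using \<epsilon>2 by (simp add: q3_def \<gamma>_def power_mult_distrib flip: power2_eq_square)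
    also have "\<dots> = 2 * of_real s * e * (2 + of_real s * e)"
      by (simp add: power2_eq_square algebra_simps)
    finally show ?thesis using that e by (simp add: norm_mult)
  qed
  have m1: "norm (2 + of_real s * e) \<ge> 2 - s" if "s \<ge> 0" for s
    using norm_triangle_ineq2[of 2 "- (of_real s * e)"] that e by (simp add: norm_mult)
  \<comment> \<open>The hypothesis on Re e keeps the path in the half-plane of points at least as
    near to its start \<epsilon> sqrt 2 as to the other zero of q3; the two distances are
    proportional to s and |2 + s e|.\<close>
  have m2: "norm (2 + of_real s * e) \<ge> s" if "0 \<le> s" "s \<le> b" for s
  proof -
    have "- 1 \<le> s * Re e" by (rule segment_ge[OF that b(2)])
    moreover have "norm e ^ 2 = Re e ^ 2 + Im e ^ 2" by (rule cmod_power2)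
    hence "Re e ^ 2 + Im e ^ 2 = 1" using e by simp
    moreover have "norm (2 + of_real s * e) ^ 2 = 4 + 4 * (s * Re e) + s ^ 2 * (Re e ^ 2 + Im e ^ 2)"
      by (simp add: cmod_power2) (simp add: power2_eq_square algebra_simps)
    ultimately have "s ^ 2 \<le> norm (2 + of_real s * e) ^ 2" by simp
    thus ?thesis by (rule power2_le_imp_le) simp
  qed
  have W: "norm (poly (q3 ^ 5) (\<gamma> s)) = 32 * s ^ 5 * norm (2 + of_real s * e) ^ 5" if "s \<ge> 0" for s
    using q3[OF that] by (simp add: norm_power power_mult_distrib)
  have inner: "norm (poly p (\<gamma> b') / poly q (\<gamma> b')) \<le> b' * (4 - b') / (2 - b') ^ 2"
    if b': "0 \<le> b'" "b' \<le> 1" "b' \<le> b" for b'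
  proof (rule ode_growth_comparison[where \<gamma> = \<gamma> and \<gamma>' = "\<lambda>_. \<gamma>'" and a = 0
        and h = "\<lambda>s. s * (4 - s) / (2 - s) ^ 2" and h' = "\<lambda>s. 8 / (2 - s) ^ 3", OF ode b'(1) \<gamma>_cont])
    fix s assume s: "0 < s" "s < b'"
    hence s1: "s < 1" "s < b" using b' by auto
    show "(\<gamma> has_vector_derivative \<gamma>') (at s)" by (rule \<gamma>_deriv)
    have m: "norm (2 + of_real s * e) \<ge> 2 - s" using m1 s by simp
    have W': "32 * s ^ 5 * (2 - s) ^ 5 \<le> norm (poly (q3 ^ 5) (\<gamma> s))"
      using W[of s] s s1 m by (auto intro!: mult_left_mono power_mono)
    moreover have "0 < 32 * s ^ 5 * (2 - s) ^ 5" using s s1 by simp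
    ultimately show "poly (q3 ^ 5) (\<gamma> s) \<noteq> 0" by auto
    show "((\<lambda>s. s * (4 - s) / (2 - s) ^ 2) has_real_derivative 8 / (2 - s) ^ 3) (at s)"
    proof -
      have "((\<lambda>s. s * (4 - s) / (2 - s) ^ 2) has_real_derivative
          ((4 - 2 * s) * (2 - s) ^ 2 + s * (4 - s) * (2 * (2 - s))) / ((2 - s) ^ 2) ^ 2) (at s)"
      proof -
        have "(2 - s) * (2 - s) \<noteq> 0" using s1 by simp
        hence "s * s + 4 \<noteq> s * 4" by (simp add: algebra_simps)
        thus ?thesis by (auto intro!: derivative_eq_intros simp: power2_eq_square algebra_simps)
      qed
      also have "(4 - 2 * s) * (2 - s) ^ 2 + s * (4 - s) * (2 * (2 - s)) = 8 * (2 - s)"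
        by Groebner_Basis.algebra
      also have "8 * (2 - s) / ((2 - s) ^ 2) ^ 2 = 8 / (2 - s) ^ 3"
      proof -
        have "((2 - s) ^ 2) ^ 2 = (2 - s) ^ 3 * (2 - s)" by (simp add: eval_nat_numeral)
        moreover have "8 * (2 - s) / ((2 - s) ^ 3 * (2 - s)) = 8 / (2 - s) ^ 3"
          using s1 by (intro mult_divide_mult_cancel_right) simp
        ultimately show ?thesis by (simp only:)
      qed
      finally show ?thesis .
    qed
    show "0 < s * (4 - s) / (2 - s) ^ 2" "0 \<le> 8 / (2 - s) ^ 3" using s s1 by simp_all
    have key: "(4 - s) ^ 5 \<le> 1728 * (2 - s) ^ 3"
    proof -
      have "(4 - s) ^ 5 = (4 - s) ^ 2 * (4 - s) ^ 3" by (simp flip: power_add)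
      also have "\<dots> \<le> 4 ^ 2 * (3 * (2 - s)) ^ 3" using s s1 by (intro mult_mono power_mono) auto
      also have "\<dots> = 432 * (2 - s) ^ 3" unfolding power_mult_distrib by simp
      also have "\<dots> \<le> 1728 * (2 - s) ^ 3" using s1 by (intro mult_right_mono) auto
      finally show ?thesis .
    qed
    \<comment> \<open>In the notation above, 1 + h = (1 + b)^2 with 1 + b = 2 / (2 - s).\<close>
    have "1 + s * (4 - s) / (2 - s) ^ 2 = 4 / (2 - s) ^ 2"
    proof -
      have "1 + s * (4 - s) / (2 - s) ^ 2 = ((2 - s) ^ 2 + s * (4 - s)) / (2 - s) ^ 2"
        using s1 by (simp add: add_divide_distrib)
      also have "(2 - s) ^ 2 + s * (4 - s) = 4" by (simp add: power2_eq_square algebra_simps)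
      finally show ?thesis .
    qed
    hence "norm C * norm \<gamma>' ^ 6 * ((s * (4 - s) / (2 - s) ^ 2) ^ 5 * (1 + s * (4 - s) / (2 - s) ^ 2) ^ 3)
        = norm C * (8 * 64 * (s ^ 5 * (4 - s) ^ 5 / (2 - s) ^ 16))"
      using s1 by (simp add: norm_\<gamma>' power_mult_distrib power_divide flip: power_mult power_add)
    also have "\<dots> \<le> (256 / 27) * (8 * 64 * (s ^ 5 * (4 - s) ^ 5 / (2 - s) ^ 16))"
      using C s s1 by (intro mult_right_mono) auto
    also have "\<dots> \<le> (256 / 27) * (8 * 64 * (s ^ 5 * (1728 * (2 - s) ^ 3) / (2 - s) ^ 16))"
      using key s s1 by (intro mult_left_mono divide_right_mono) auto
    also have "\<dots> = (8 / (2 - s) ^ 3) ^ 6 * (32 * s ^ 5 * (2 - s) ^ 5)"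
      using s1 by (simp add: power_divide field_simps flip: power_mult power_add)
    also have "\<dots> \<le> (8 / (2 - s) ^ 3) ^ 6 * norm (poly (q3 ^ 5) (\<gamma> s))"
      using W' by (intro mult_left_mono) auto
    finally show "norm C * norm \<gamma>' ^ 6 * ((s * (4 - s) / (2 - s) ^ 2) ^ 5 * (1 + s * (4 - s) / (2 - s) ^ 2) ^ 3)
       \<le> (8 / (2 - s) ^ 3) ^ 6 * norm (poly (q3 ^ 5) (\<gamma> s))" .
  next
    show "continuous_on {0..b'} (\<lambda>s. s * (4 - s) / (2 - s) ^ 2)"
      using b' by (intro continuous_intros) auto
  qed (use q b' p0 in \<open>auto simp: \<gamma>_def\<close>)
  show ?thesis
  proof (cases "b \<le> 1")
    case True
    have "b * (4 - b) / (2 - b) ^ 2 \<le> 3"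
    proof -
      have "0 \<le> 4 * (1 - b) * (3 - b)" using True by simp
      hence "b * (4 - b) \<le> 3 * (2 - b) ^ 2" by (simp add: power2_eq_square algebra_simps)
      thus ?thesis using True by (simp add: field_simps)
    qed
    also have "3 \<le> 3 + 4 * b ^ 2" by simp
    finally show ?thesis using inner[of b] b True by simp
  next
    case False
    have "norm (poly p (\<gamma> b) / poly q (\<gamma> b)) \<le> 4 * b ^ 2 - 1"
    proof (rule ode_growth_comparison[where \<gamma> = \<gamma> and \<gamma>' = "\<lambda>_. \<gamma>'" and a = 1
          and h = "\<lambda>s. 4 * s ^ 2 - 1" and h' = "\<lambda>s. 8 * s", OF ode _ \<gamma>_cont])
      fix s assume s: "1 < s" "s < b"
      show "(\<gamma> has_vector_derivative \<gamma>') (at s)" by (rule \<gamma>_deriv)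
      have W': "32 * s ^ 5 * s ^ 5 \<le> norm (poly (q3 ^ 5) (\<gamma> s))"
      proof -
        have "32 * s ^ 5 * s ^ 5 \<le> 32 * s ^ 5 * norm (2 + of_real s * e) ^ 5"
          using s m2[of s] by (intro mult_left_mono power_mono) auto
        also have "\<dots> = norm (poly (q3 ^ 5) (\<gamma> s))" using W[of s] s by simp
        finally show ?thesis .
      qed
      moreover have "0 < 32 * s ^ 5 * s ^ 5" using s by simp
      ultimately show "poly (q3 ^ 5) (\<gamma> s) \<noteq> 0" by auto
      have "1 < s ^ 2" using s by (simp add: power2_eq_square less_1_mult)
      hence "0 < 4 * s ^ 2 - 1" by linarith
      thus h_pos: "0 < 4 * s ^ 2 - 1" "0 \<le> 8 * s" using s by simp_all
      have "norm C * norm \<gamma>' ^ 6 * ((4 * s ^ 2 - 1) ^ 5 * (1 + (4 * s ^ 2 - 1)) ^ 3)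
          \<le> (256 / 27) * 8 * ((4 * s ^ 2) ^ 5 * (4 * s ^ 2) ^ 3)"
        using C h_pos norm_\<gamma>' by (intro mult_mono power_mono) auto
      also have "\<dots> = (256 / 27) * 8 * 65536 * s ^ 16"
        by (simp add: power_mult_distrib flip: power_mult power_add)
      \<comment> \<open>2^27 / 27 against 2^23 = 8^6 * 32: on this part the threshold 256/27 leaves
        a factor 27/16 to spare.\<close>
      also have "\<dots> \<le> 8388608 * s ^ 16" by simp
      also have "\<dots> = (8 * s) ^ 6 * (32 * s ^ 5 * s ^ 5)"
        by (simp add: power_mult_distrib flip: power_add)
      also have "\<dots> \<le> (8 * s) ^ 6 * norm (poly (q3 ^ 5) (\<gamma> s))"
        using W' by (intro mult_left_mono) auto
      finally show "norm C * norm \<gamma>' ^ 6 * ((4 * s ^ 2 - 1) ^ 5 * (1 + (4 * s ^ 2 - 1)) ^ 3)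
          \<le> (8 * s) ^ 6 * norm (poly (q3 ^ 5) (\<gamma> s))" .
      show "((\<lambda>s. 4 * s ^ 2 - 1) has_real_derivative 8 * s) (at s)"
        by (auto intro!: derivative_eq_intros)
    next
      show "norm (poly p (\<gamma> 1) / poly q (\<gamma> 1)) \<le> 4 * 1 ^ 2 - 1"
        using inner[of 1] False by simp
    qed (use q False in \<open>auto intro!: continuous_intros\<close>)
    thus ?thesis by simp
  qed
qed

lemma E3_small:
  assumes P: "P \<in> E3.points" "E3.logd P = ratfun_const c / to_fract q3"
    and c: "27 * norm (729 * c ^ 6) \<le> 256"
  shows "P = Infinity"
proof (rule ccontr)
  assume "P \<noteq> Infinity"
  then obtain x y where xy: "P = Affine x y" by (cases P) auto
  have on: "y ^ 2 = x ^ 3 + F3" using P xy by simp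
  note nz = E3.coord_nz[OF on]
  define C where "C = 729 * c ^ 6"
  have "c \<noteq> 0" using E3.logd_eq_0[OF P(1)] \<open>P \<noteq> Infinity\<close> P(2) by auto
  hence C: "C \<noteq> 0" by (simp add: C_def)
  have "E3.logd (Affine x y) ^ 6 * F3 * to_fract (q3 ^ 5) = ratfun_const (c ^ 6)"
  proof -
    have "(ratfun_const c / to_fract q3) ^ 6 * F3 * to_fract (q3 ^ 5) = ratfun_const c ^ 6"
      by (simp add: F_eq power_divide field_simps flip: power_Suc)
    thus ?thesis unfolding xy[symmetric] P(2) by simp
  qed
  from E3.obtain_coord_ode[OF on this, folded C_def]
  obtain p q where pq: "F3 / x ^ 3 = to_fract p / to_fract q" and p_nz: "p \<noteq> 0" and q_nz: "q \<noteq> 0"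
    and cop: "\<forall>z. poly p z \<noteq> 0 \<or> poly q z \<noteq> 0"
    and ode: "(pderiv p * q - p * pderiv q) ^ 6 * q3 ^ 5 = Polynomial.smult C (p ^ 5 * (p + q) ^ 3 * q ^ 4)" .
  have coprime: "poly p z \<noteq> 0 \<or> poly q z \<noteq> 0" for z using cop by simp
  \<comment> \<open>If x vanished at z, then y^2 would have the order 1 of F3. So x does not vanish
    and g has a zero at both square roots of 2.\<close>
  have p0: "poly p z = 0" if z: "poly q3 z = 0" for z
  proof -
    have "rord z x \<le> 0"
    proof (rule ccontr)
      assume "\<not> rord z x \<le> 0"
      hence "rord z (F3 + x ^ 3) = rord z F3"
        using nz z by (intro rord_add_eq[where k = 3]) (auto simp: rord_ge_def rord_F3 rord_power)
      moreover have "rord z (F3 + x ^ 3) = 2 * rord z y"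
        using nz unfolding add.commute[of F3] on[symmetric] by (simp add: rord_power)
      ultimately show False using rord_F3[OF z] by presburger
    qed
    hence "rord z (F3 / x ^ 3) \<ge> 1" using nz z by (simp add: rord_divide rord_power rord_F3)
    hence "Polynomial.order z p > 0" using pq p_nz q_nz by (simp add: rord_quot)
    thus ?thesis by (simp add: order_root)
  qed
  have sqrt2: "complex_of_real (sqrt 2) * complex_of_real (sqrt 2) = 2" by (simp flip: of_real_mult)
  have roots: "poly q3 (of_real (\<epsilon> * sqrt 2)) = 0" if "\<bar>\<epsilon>\<bar> = 1" for \<epsilon>
    using that sqrt2 by (auto simp: q3_def abs_if split: if_splits)
  show False
  proof (cases "Polynomial.degree q = 0")
    case True
    then obtain k where k: "q = [:k:]" "k \<noteq> 0" using q_nz by (metis degree_eq_zeroE pCons_0_0)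
    have "Polynomial.degree p > 0"
    proof (rule ccontr)
      assume "\<not> Polynomial.degree p > 0"
      then obtain l where "p = [:l:]" by (auto elim: degree_eq_zeroE)
      thus False using p0[OF roots[of 1]] p_nz by simp
    qed
    moreover have "Polynomial.degree (q3 ^ 5) = 10"
      by (simp add: degree_power_eq) (simp add: q3_def)
    ultimately have "6 * (Polynomial.degree p - 1) + 10 = 8 * Polynomial.degree p"
      using ode_degree[OF ode True q_nz _ C] by simp
    \<comment> \<open>A quadratic p with zeros at both square roots of 2 is a multiple of F3, which
      makes x constant. The shape of \<open>logd\<close> then leaves only x^3 = 2, where 729 c^6 =
      256 violates the assumed bound.\<close>
    hence deg: "Polynomial.degree p = 2" using \<open>Polynomial.degree p > 0\<close> by simp
    define w where "w = complex_of_real (sqrt 2)"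
    obtain a b l where p_eq: "p = [:a, b, l:]" using deg poly_degree_le_2[of p] by auto
    have "a + w * (b + w * l) = 0" "a - w * (b - w * l) = 0" "w * w = 2"
      using p0[OF roots[of 1]] p0[OF roots[of "-1"]] sqrt2 by (simp_all add: p_eq w_def)
    hence "b = 0" "a = - 2 * l" by Groebner_Basis.algebra+
    hence "to_fract p = ratfun_const l * F3"
      by (simp add: p_eq to_fract_pCons F3_def algebra_simps power2_eq_square)
    hence "F3 / x ^ 3 = ratfun_const l * F3 / ratfun_const k"
      using pq k by (simp add: to_fract_pCons)
    hence x3: "x ^ 3 * ratfun_const l = ratfun_const k"
      using nz k by (simp add: field_simps)
    have "l \<noteq> 0" using x3 k by auto
    have "3 * x ^ 2 * rat_deriv x * ratfun_const l = 0"
      using arg_cong[OF x3, of rat_deriv] by (simp add: rat_deriv_power)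
    hence "rat_deriv x = 0" using nz \<open>l \<noteq> 0\<close> by simp
    then obtain \<xi> where \<xi>: "x = ratfun_const \<xi>" by (auto simp: rat_deriv_eq_0_iff)
    have "- (x * (2 * tvar)) / (3 * F3) / y = ratfun_const c / F3"
      using P(2) by (simp add: xy \<xi> F_eq(3)[symmetric]) (simp add: F3_def rat_deriv_power \<xi>)
    hence "- (x * (2 * tvar)) = 3 * ratfun_const c * y" using nz by (simp add: field_simps)
    hence "4 * x ^ 2 * tvar ^ 2 = 9 * ratfun_const c ^ 2 * (x ^ 3 + F3)"
      unfolding on[symmetric] by Groebner_Basis.algebra
    hence "to_fract [:9 * c ^ 2 * (\<xi> ^ 3 - 2), 0, 9 * c ^ 2 - 4 * \<xi> ^ 2:] = 0"
      by (simp add: to_fract_pCons \<xi> F3_def algebra_simps power2_eq_square)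
    hence "\<xi> ^ 3 = 2" "9 * c ^ 2 = 4 * \<xi> ^ 2" using \<open>c \<noteq> 0\<close> by simp_all
    moreover have "729 * c ^ 6 = (9 * c ^ 2) ^ 3" by (simp add: power_mult_distrib flip: power_mult)
    moreover have "(4 * \<xi> ^ 2) ^ 3 = 64 * (\<xi> ^ 3) ^ 2" by (simp add: power_mult_distrib flip: power_mult)
    ultimately have "729 * c ^ 6 = 256" by simp
    thus False using c by simp
  next
    case False
    hence "\<not> constant (poly q)" by (simp add: constant_degree)
    then obtain z0 where z0: "poly q z0 = 0" using fundamental_theorem_of_algebra by blast
    \<comment> \<open>The start is the zero of q3 on the side of a given pole, and the nearest pole
      is sought in that closed half-plane only, as \<open>E3_path\<close> requires.\<close>
    define \<epsilon> :: real where "\<epsilon> = (if Re z0 \<ge> 0 then 1 else -1)"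
    have \<epsilon>: "\<bar>\<epsilon>\<bar> = 1" "\<epsilon> * Re z0 \<ge> 0" by (auto simp: \<epsilon>_def)
    define v where "v = complex_of_real (\<epsilon> * sqrt 2)"
    have v: "norm v = sqrt 2" "v \<noteq> 0" using \<epsilon> by (auto simp: v_def norm_mult abs_mult)
    obtain z where z: "poly q z = 0" "\<epsilon> * Re z \<ge> 0"
      "\<And>w. poly q w = 0 \<Longrightarrow> \<epsilon> * Re w \<ge> 0 \<Longrightarrow> norm (z - v) \<le> norm (w - v)"
      using obtain_root_of_min_dist[OF q_nz z0, of "\<lambda>w. \<epsilon> * Re w \<ge> 0" "\<lambda>w. norm (w - v)"] \<epsilon>(2) by metis
    have pv: "poly p v = 0" unfolding v_def by (rule p0[OF roots[OF \<epsilon>(1)]])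
    have "z \<noteq> v" using z(1) pv coprime by auto
    define b where "b = norm (z - v) / sqrt 2"
    define e where "e = (z - v) / (v * of_real b)"
    have b: "b > 0" using \<open>z \<noteq> v\<close> by (simp add: b_def)
    have e: "norm e = 1" using b v by (simp add: e_def norm_divide norm_mult) (simp add: b_def)
    define \<gamma> where "\<gamma> = (\<lambda>a::real. of_real (\<epsilon> * sqrt 2) * (1 + of_real a * e))"
    have \<gamma>_eq: "\<gamma> a = v + of_real (a / b) * (z - v)" for a
    proof -
      have "v * e = (z - v) / of_real b" using v by (simp add: e_def)
      moreover have "v * (1 + of_real a * e) = v + of_real a * (v * e)" by (simp add: algebra_simps)
      ultimately show ?thesis unfolding \<gamma>_def v_def[symmetric] by simp
    qed
    have \<gamma>b: "\<gamma> b = z" using b by (simp add: \<gamma>_eq)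
    have Re_\<gamma>: "\<epsilon> * Re (\<gamma> a) = sqrt 2 * (1 + a * Re e)" for a
      using \<epsilon>(1) by (auto simp: \<gamma>_def abs_if split: if_splits)
    have Re_e: "- 1 \<le> b * Re e" using z(2) Re_\<gamma>[of b] unfolding \<gamma>b by (simp add: zero_le_mult_iff)
    have q: "poly q (\<gamma> s) \<noteq> 0" if s: "0 \<le> s" "s < b" for s
    proof
      assume "poly q (\<gamma> s) = 0"
      moreover have "- 1 \<le> s * Re e" by (rule segment_ge[OF _ _ Re_e]) (use s in auto)
      hence "\<epsilon> * Re (\<gamma> s) \<ge> 0" unfolding Re_\<gamma> by simp
      ultimately have "norm (z - v) \<le> norm (\<gamma> s - v)" by (rule z(3))
      also have "\<dots> = s / b * norm (z - v)" using s b by (simp add: \<gamma>_eq norm_mult norm_divide)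
      also have "\<dots> < 1 * norm (z - v)"
        using s b \<open>z \<noteq> v\<close> by (intro mult_strict_right_mono) auto
      finally show False by simp
    qed
    have "poly p (\<gamma> b) = 0"
    proof (rule poly_norm_le_closed[where a = 0 and B = "3 + 4 * b ^ 2" and q = q, OF b])
      show "continuous_on {0..b} \<gamma>" unfolding \<gamma>_def by (intro continuous_intros)
      fix s assume s: "0 \<le> s" "s < b"
      show "poly q (\<gamma> s) \<noteq> 0" by (rule q[OF s])
      have "- 1 \<le> s * Re e" by (rule segment_ge[OF _ _ Re_e]) (use s in auto)
      hence "norm (poly p (\<gamma> s) / poly q (\<gamma> s)) \<le> 3 + 4 * s ^ 2"
        unfolding \<gamma>_def using c s q pv[unfolded v_def]
        by (intro E3_path[OF ode _ e \<epsilon>(1)]) (auto simp: C_def \<gamma>_def)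
      also have "\<dots> \<le> 3 + 4 * b ^ 2" using s by (simp add: power_mono)
      finally show "norm (poly p (\<gamma> s) / poly q (\<gamma> s)) \<le> 3 + 4 * b ^ 2" .
    qed (use z \<gamma>b in auto)
    thus False using coprime[of z] z \<gamma>b by auto
  qed
qed

section \<open>The first curve has no nonzero point\<close>

lemma zeta3_cubic: "zeta3 ^ 2 + zeta3 + 1 = 0"
proof -
  have "complex_of_real (sqrt 3) ^ 2 = 3" by (simp flip: of_real_power)
  thus ?thesis unfolding zeta3_def by (simp add: power2_eq_square field_simps)
qed

lemma zeta3_cube: "zeta3 ^ 3 = 1"
  using zeta3_cubic by Groebner_Basis.algebra

lemma zeta3_nz [simp]: "zeta3 \<noteq> 0"
  using zeta3_cube by auto

lemma F1_minus: "rat_subst (- tvar) F1 = - F1"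
  by (simp add: F1_def nonconst_simps)

text \<open>For the pullback by t -> t^2, \<open>logd\<close> is 2 t times an even function.
  Comparison with its values at - t leaves only the middle term b t of
  \<open>E2_logd_form\<close>.\<close>

lemma E1_form:
  assumes "P \<in> E1.points"
  obtains c where "E1.logd P = ratfun_const c / to_fract q1"
proof -
  let ?s = "tvar ^ 2" let ?Q = "twist ?s 1 1 P"
  have "F2 = ratfun_const (1 ^ 2) * rat_subst ?s F1"
    by (simp add: F1_def F2_def nonconst_simps)
  note Q = twist_logd[OF E1.mordell_curve_axioms E2.mordell_curve_axioms nonconst_simps(3) _ _ this assms]
  have Q1: "?Q \<in> E2.points" and Q2: "E2.logd ?Q = 2 * tvar * rat_subst ?s (E1.logd P)"
    using Q by (simp_all add: rat_deriv_power)
  obtain a b c where abc: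
    "E2.logd ?Q = (ratfun_const a + ratfun_const b * tvar + ratfun_const c * tvar ^ 2) / to_fract q2"
    using E2_logd_form[OF Q1] .
  define R where "R = rat_subst ?s (E1.logd P)"
  have R: "2 * tvar * R * to_fract q2 = ratfun_const a + ratfun_const b * tvar + ratfun_const c * tvar ^ 2"
    using abc unfolding Q2 R_def[symmetric] by (simp add: field_simps)
  have "rat_subst (- tvar) (rat_subst ?s x) = rat_subst ?s x" for x
  proof -
    obtain p q where x: "x = to_fract p / to_fract q" "q \<noteq> 0" by (rule ratfun_cases)
    have "rat_subst (- tvar) (poly_subst ?s p) = poly_subst ?s p" for p
      by (induction p) (simp_all add: nonconst_simps)
    thus ?thesis using x by (simp add: nonconst_simps)
  qed
  hence "rat_subst (- tvar) R = R" by (simp add: R_def)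
  hence "2 * - tvar * R * to_fract q2 = ratfun_const a + ratfun_const b * - tvar + ratfun_const c * (- tvar) ^ 2"
    using arg_cong[OF R, of "rat_subst (- tvar)"] by (simp add: nonconst_simps to_fract_q)
  hence "2 * (tvar * (2 * R * to_fract q2)) = 2 * (tvar * ratfun_const b)"
    using R by Groebner_Basis.algebra
  hence "2 * (2 * (R * to_fract q2)) = 2 * ratfun_const b"
    using tvar_nonzero by (simp add: mult.assoc)
  hence "2 * (R * to_fract q2) = ratfun_const b"
    by (metis mult_cancel_left ratfun_numeral_eq_0_iff)
  hence "R * (tvar ^ 4 + 1) = ratfun_const (b / 2)"
    by (simp add: to_fract_q nonzero_eq_divide_eq mult.commute)
  hence "rat_subst ?s (E1.logd P * to_fract q1) = rat_subst ?s (ratfun_const (b / 2))"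
    by (simp add: nonconst_simps to_fract_q R_def del: ratfun_const_divide flip: power_mult)
  hence "E1.logd P * to_fract q1 = ratfun_const (b / 2)"
    by (rule rat_subst_eq_iff[OF nonconst_simps(3), THEN iffD1])
  thus ?thesis by (intro that[of "b / 2"]) (simp add: field_simps del: ratfun_const_divide)
qed

text \<open>The change t -> - t turns F1 into - F1, which the scaling by a = - zeta3, b = i undoes.
  The factor - i zeta3 = exp(i pi / 6) is a primitive twelfth root of unity.\<close>

lemma E1_rotate:
  assumes "P \<in> E1.points" "E1.logd P = ratfun_const c / to_fract q1"
  obtains Q where "Q \<in> E1.points" "E1.logd Q = ratfun_const (- \<i> * zeta3 * c) / to_fract q1"
proof -
  have F1: "F1 = ratfun_const (\<i> ^ 2) * rat_subst (- tvar) F1"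
    by (simp add: F1_minus)
  have sq: "\<i> ^ 2 = (- zeta3) ^ 3" using zeta3_cube by simp
  have "twist (- tvar) (- zeta3) \<i> P \<in> E1.points"
    "E1.logd (twist (- tvar) (- zeta3) \<i> P) = ratfun_const (- zeta3 / \<i>) * rat_subst (- tvar) (E1.logd P) * rat_deriv (- tvar)"
    using twist_logd[OF E1.mordell_curve_axioms E1.mordell_curve_axioms nonconst_simps(2) sq _ F1 assms(1)]
    by simp_all
  moreover have "ratfun_const (- zeta3 / \<i>) * rat_subst (- tvar) (E1.logd P) * rat_deriv (- tvar) =
      ratfun_const (zeta3 / \<i> * c) / to_fract q1"
    unfolding assms(2) by (simp add: nonconst_simps to_fract_q)
  moreover have "zeta3 / \<i> = - \<i> * zeta3" by simp
  ultimately show ?thesis using that by metis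
qed

lemma E1_trivial: "E1.points = {Infinity}"
proof -
  define V where "V = {c. \<exists>P\<in>E1.points. E1.logd P = ratfun_const c / to_fract q1}"
  \<comment> \<open>1 minus the factor of \<open>E1_rotate\<close>; |u|^2 = 2 - sqrt 3.\<close>
  define u where "u = 1 + \<i> * zeta3"
  have uV: "u * c \<in> V" if "c \<in> V" for c
  proof -
    obtain P where P: "P \<in> E1.points" "E1.logd P = ratfun_const c / to_fract q1"
      using \<open>c \<in> V\<close> by (auto simp: V_def)
    obtain Q where Q: "Q \<in> E1.points" "E1.logd Q = ratfun_const (- \<i> * zeta3 * c) / to_fract q1"
      using E1_rotate[OF P] .
    have "ec_add E1.E P (E1.opp Q) \<in> E1.points" using P Q by (intro E1.ec_add_points E1.opp_points)
    moreover have "E1.logd (ec_add E1.E P (E1.opp Q)) = ratfun_const (u * c) / to_fract q1"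
      using P Q by (simp add: E1.logd_ec_add E1.opp_points E1.logd_opp u_def field_simps)
    ultimately show ?thesis unfolding V_def by blast
  qed
  have V0: "c = 0" if "c \<in> V" "norm (729 * c ^ 6) * (65 ^ 3 * 32 ^ 6) \<le> 1" for c
  proof -
    obtain P where P: "P \<in> E1.points" "E1.logd P = ratfun_const c / to_fract q1"
      using \<open>c \<in> V\<close> by (auto simp: V_def)
    hence "P = Infinity" using E1_small that by blast
    thus "c = 0" using P by simp
  qed
  have norm_u: "norm u < 1" "u \<noteq> 0"
  proof -
    have u_eq: "u = Complex (1 - sqrt 3 / 2) (- 1 / 2)"
      by (simp add: u_def zeta3_def complex_eq_iff)
    have s3: "sqrt 3 * sqrt 3 = 3" by simp
    have "sqrt 3 > 3 / 2" by (rule real_less_rsqrt) (simp add: power2_eq_square)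
    hence "norm u ^ 2 < 1" unfolding u_eq cmod_power2 using s3 by (simp add: power2_eq_square algebra_simps)
    thus "norm u < 1" by (simp add: power_less_one_iff)
    show "u \<noteq> 0" unfolding u_eq by (simp add: complex_eq_iff)
  qed
  have "c = 0" if "c \<in> V" for c
  proof -
    have pow: "u ^ n * c \<in> V" for n
      by (induction n) (use that uV in \<open>auto simp: mult.assoc\<close>)
    have lim: "(\<lambda>n. u ^ n) \<longlonglongrightarrow> 0" by (rule LIMSEQ_power_zero[OF norm_u(1)])
    have "(\<lambda>n. norm (729 * (u ^ n * c) ^ 6) * (65 ^ 3 * 32 ^ 6)) \<longlonglongrightarrow> norm (729 * (0 * c) ^ 6) * (65 ^ 3 * 32 ^ 6)"
      by (intro tendsto_mult tendsto_norm tendsto_power tendsto_const lim)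
    from order_tendstoD(2)[OF this, of 1]
    have "eventually (\<lambda>n. norm (729 * (u ^ n * c) ^ 6) * (65 ^ 3 * 32 ^ 6) < 1) sequentially"
      by simp
    then obtain n where "norm (729 * (u ^ n * c) ^ 6) * (65 ^ 3 * 32 ^ 6) < 1"
      by (auto simp: eventually_sequentially)
    hence "u ^ n * c = 0" using V0[OF pow[of n]] by simp
    thus "c = 0" using norm_u by simp
  qed
  moreover have "\<exists>c\<in>V. E1.logd P = ratfun_const c / to_fract q1" if "P \<in> E1.points" for P
    using E1_form[OF that] that unfolding V_def by blast
  ultimately have "E1.logd P = 0" if "P \<in> E1.points" for P using that by fastforce
  thus ?thesis using E1.logd_eq_0 by auto
qed

section \<open>The third curve\<close>

definition eisenstein :: "complex set" where
  "eisenstein = {of_int m + of_int n * zeta3 | m n. True}"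

lemma eisensteinI: "of_int m + of_int n * zeta3 \<in> eisenstein"
  by (auto simp: eisenstein_def)

lemma eisenstein_simps [intro]:
  "0 \<in> eisenstein" "1 \<in> eisenstein"
  "a \<in> eisenstein \<Longrightarrow> - a \<in> eisenstein"
  "a \<in> eisenstein \<Longrightarrow> b \<in> eisenstein \<Longrightarrow> a + b \<in> eisenstein"
proof -
  show "0 \<in> eisenstein" "1 \<in> eisenstein" using eisensteinI[of 0 0] eisensteinI[of 1 0] by simp_all
  show "- a \<in> eisenstein" if a: "a \<in> eisenstein"
  proof -
    obtain m n where "a = of_int m + of_int n * zeta3" using a by (auto simp: eisenstein_def)
    thus ?thesis using eisensteinI[of "- m" "- n"] by simp
  qed
  show "a + b \<in> eisenstein" if ab: "a \<in> eisenstein" "b \<in> eisenstein"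
  proof -
    obtain m n k l where "a = of_int m + of_int n * zeta3" "b = of_int k + of_int l * zeta3"
      using ab by (auto simp: eisenstein_def)
    thus ?thesis using eisensteinI[of "m + k" "n + l"] by (simp add: algebra_simps)
  qed
qed

text \<open>The distances of a point to the vertices of a unit equilateral triangle containing it, squared
  and weighted with its barycentric coordinates, add up to at most \<open>1 / 3\<close>.\<close>

lemma triangle_vertex_close:
  fixes p q :: real
  assumes "0 \<le> p" "0 \<le> q" "p + q \<le> 1"
  defines "N \<equiv> \<lambda>x y. x ^ 2 + x * y + y ^ 2"
  shows "N p q \<le> 1 / 3 \<or> N (p - 1) q \<le> 1 / 3 \<or> N p (q - 1) \<le> 1 / 3"
proof (rule ccontr)
  assume neg: "\<not> ?thesis"
  define \<mu> where "\<mu> = min (N p q) (min (N (p - 1) q) (N p (q - 1)))"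
  have \<mu>: "\<mu> > 1 / 3" using neg by (auto simp: \<mu>_def)
  have "\<mu> = (1 - p - q) * \<mu> + p * \<mu> + q * \<mu>" by (simp add: algebra_simps)
  also have "\<dots> \<le> (1 - p - q) * N p q + p * N (p - 1) q + q * N p (q - 1)"
    using assms(1-3) by (intro add_mono mult_left_mono) (auto simp: \<mu>_def)
  also have "\<dots> = 1 / 3 - ((p - 1 / 3 + (q - 1 / 3) / 2) ^ 2 + 3 / 4 * (q - 1 / 3) ^ 2)"
    by (simp add: N_def power2_eq_square algebra_simps) (simp add: field_simps)
  also have "\<dots> \<le> 1 / 3"
  proof -
    have "0 \<le> (p - 1 / 3 + (q - 1 / 3) / 2) ^ 2 + 3 / 4 * (q - 1 / 3) ^ 2"
      by (intro add_nonneg_nonneg) auto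
    thus ?thesis by linarith
  qed
  finally show False using \<mu> by simp
qed

text \<open>x and y are the coordinates of z in the lattice basis 1, 1 + zeta3, where |z|^2 is the
  form N; this is why m + n appears in the lattice point. The diagonal cuts the fundamental
  parallelogram into two equilateral triangles, exchanged by (p, q) -> (1 - p, 1 - q).\<close>

lemma eisenstein_covering:
  obtains \<theta> where "\<theta> \<in> eisenstein" "norm (z - \<theta>) ^ 2 \<le> 1 / 3"
proof -
  define N where "N = (\<lambda>x y :: real. x ^ 2 + x * y + y ^ 2)"
  define y x where "y = 2 * Im z / sqrt 3" and "x = Re z - y / 2"
  define p q where "p = x - of_int \<lfloor>x\<rfloor>" and "q = y - of_int \<lfloor>y\<rfloor>"
  have pq: "0 \<le> p" "p \<le> 1" "0 \<le> q" "q \<le> 1"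
    unfolding p_def q_def by linarith+
  have "\<exists>i j :: int. N (p - of_int i) (q - of_int j) \<le> 1 / 3"
  proof (cases "p + q \<le> 1")
    case True
    hence "N p q \<le> 1 / 3 \<or> N (p - 1) q \<le> 1 / 3 \<or> N p (q - 1) \<le> 1 / 3"
      using triangle_vertex_close[of p q] pq by (simp add: N_def)
    moreover have "N p q = N (p - of_int 0) (q - of_int 0)" "N (p - 1) q = N (p - of_int 1) (q - of_int 0)"
      "N p (q - 1) = N (p - of_int 0) (q - of_int 1)" by simp_all
    ultimately show ?thesis by metis
  next
    case False
    hence "N (1 - p) (1 - q) \<le> 1 / 3 \<or> N (1 - p - 1) (1 - q) \<le> 1 / 3 \<or> N (1 - p) (1 - q - 1) \<le> 1 / 3"
      using triangle_vertex_close[of "1 - p" "1 - q"] pq by (simp add: N_def)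
    moreover have "N (1 - p) (1 - q) = N (p - of_int 1) (q - of_int 1)"
      "N (1 - p - 1) (1 - q) = N (p - of_int 0) (q - of_int 1)"
      "N (1 - p) (1 - q - 1) = N (p - of_int 1) (q - of_int 0)"
      by (simp_all add: N_def power2_eq_square algebra_simps)
    ultimately show ?thesis by metis
  qed
  then obtain i j :: int where ij: "N (p - of_int i) (q - of_int j) \<le> 1 / 3" by blast
  define m n where "m = \<lfloor>x\<rfloor> + i" and "n = \<lfloor>y\<rfloor> + j"
  have s3: "sqrt 3 * sqrt 3 = 3" by simp
  have "norm (z - (of_int (m + n) + of_int n * zeta3)) ^ 2 = N (x - of_int m) (y - of_int n)"
  proof -
    have Re: "Re (z - (of_int (m + n) + of_int n * zeta3)) = (x - of_int m) + (y - of_int n) / 2"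
      by (simp add: x_def zeta3_def field_simps)
    have Im: "Im (z - (of_int (m + n) + of_int n * zeta3)) = (y - of_int n) * (sqrt 3 / 2)"
      using s3 by (simp add: y_def zeta3_def field_simps)
    have "sqrt 3 ^ 2 = (3 :: real)" by simp
    thus ?thesis unfolding cmod_power2 Re Im N_def power_mult_distrib power_divide
      by (simp add: power2_eq_square field_simps)
  qed
  also have "\<dots> \<le> 1 / 3" using ij by (simp add: m_def n_def p_def q_def algebra_simps)
  finally show ?thesis using that eisensteinI by blast
qed

text \<open>The constant value of \<open>logd\<close> times q3 at the point (2^(1/3), t) of the
  third curve.\<close>

definition \<kappa> :: complex where "\<kappa> = - 2 * cbrt2 / 3"

lemma cbrt2_cube: "cbrt2 ^ 3 = 2"
  by (simp add: cbrt2_def flip: of_real_power)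

lemma cbrt2_nz [simp]: "cbrt2 \<noteq> 0"
  using cbrt2_cube by auto

lemma \<kappa>_nz [simp]: "\<kappa> \<noteq> 0"
  by (simp add: \<kappa>_def)

lemma \<kappa>_power6: "729 * \<kappa> ^ 6 = 256"
proof -
  have "729 * \<kappa> ^ 6 = 64 * (cbrt2 ^ 3) ^ 2"
    by (simp add: \<kappa>_def power_divide power_mult_distrib flip: power_mult)
  thus ?thesis by (simp add: cbrt2_cube)
qed

lemma E3_base: "Affine (ratfun_const cbrt2) tvar \<in> E3.points"
    "E3.logd (Affine (ratfun_const cbrt2) tvar) = ratfun_const \<kappa> / to_fract q3"
proof -
  show "Affine (ratfun_const cbrt2) tvar \<in> E3.points"
    using arg_cong[OF cbrt2_cube, of ratfun_const] by (subst E3.mem_points) (simp add: F3_def)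
  show "E3.logd (Affine (ratfun_const cbrt2) tvar) = ratfun_const \<kappa> / to_fract q3"
  proof -
    have D: "rat_deriv F3 = 2 * tvar" by (simp add: F3_def rat_deriv_power)
    show ?thesis using tvar_nonzero by (simp add: \<kappa>_def F_eq(3)[symmetric] D divide_simps)
  qed
qed

lemma E3_logd_eisenstein:
  assumes P: "P \<in> E3.points" "E3.logd P = ratfun_const (\<kappa> * c) / to_fract q3"
  shows "c \<in> eisenstein"
proof -
  define V where "V = {c. \<exists>P\<in>E3.points. E3.logd P = ratfun_const (\<kappa> * c) / to_fract q3}"
  have add: "a + b \<in> V" if ab: "a \<in> V" "b \<in> V" for a b
  proof -
    obtain P Q where "P \<in> E3.points" "E3.logd P = ratfun_const (\<kappa> * a) / to_fract q3"
      "Q \<in> E3.points" "E3.logd Q = ratfun_const (\<kappa> * b) / to_fract q3"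
      using ab by (auto simp: V_def)
    hence "ec_add E3.E P Q \<in> E3.points" "E3.logd (ec_add E3.E P Q) = ratfun_const (\<kappa> * (a + b)) / to_fract q3"
      by (simp_all add: E3.ec_add_points E3.logd_ec_add field_simps)
    thus ?thesis unfolding V_def by blast
  qed
  have neg: "- a \<in> V" if a: "a \<in> V" for a
  proof -
    obtain P where "P \<in> E3.points" "E3.logd P = ratfun_const (\<kappa> * a) / to_fract q3"
      using a by (auto simp: V_def)
    hence "E3.opp P \<in> E3.points" "E3.logd (E3.opp P) = ratfun_const (\<kappa> * (- a)) / to_fract q3"
      by (simp_all add: E3.opp_points E3.logd_opp)
    thus ?thesis unfolding V_def by blast
  qed
  have rot: "zeta3 * a \<in> V" if a: "a \<in> V" for a
  proof -
    obtain P where P: "P \<in> E3.points" "E3.logd P = ratfun_const (\<kappa> * a) / to_fract q3"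
      using a by (auto simp: V_def)
    have "1 ^ 2 = zeta3 ^ 3" "F3 = ratfun_const (1 ^ 2) * rat_subst tvar F3"
      by (simp_all add: zeta3_cube)
    from twist_logd[OF E3.mordell_curve_axioms E3.mordell_curve_axioms nonconst_tvar this(1) _ this(2) P(1)]
    have "twist tvar zeta3 1 P \<in> E3.points"
      "E3.logd (twist tvar zeta3 1 P) = ratfun_const (\<kappa> * (zeta3 * a)) / to_fract q3"
      by (simp_all add: P(2))
    thus ?thesis unfolding V_def by blast
  qed
  have one: "1 \<in> V" unfolding V_def
    by (intro CollectI bexI[OF _ E3_base(1)]) (simp only: E3_base(2) mult_1_right)
  have zero: "0 \<in> V" using add[OF one neg[OF one]] by simp
  have int: "of_int m * a \<in> V" if a: "a \<in> V" for a m
  proof (induction m rule: int_induct[of _ 0])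
    case (step1 i)
    thus ?case using add[OF step1(2) a] by (simp add: algebra_simps)
  next
    case (step2 i)
    thus ?case using add[OF step2(2) neg[OF a]] by (simp add: algebra_simps)
  qed (use zero in simp)
  have "c \<in> V" using P by (auto simp: V_def)
  obtain \<theta> where \<theta>: "\<theta> \<in> eisenstein" "norm (c - \<theta>) ^ 2 \<le> 1 / 3" by (rule eisenstein_covering)
  then obtain m n where mn: "\<theta> = of_int m + of_int n * zeta3" by (auto simp: eisenstein_def)
  have "\<theta> \<in> V" unfolding mn using add[OF int[OF one, of m] int[OF rot[OF one], of n]] by simp
  hence "c - \<theta> \<in> V" using add[OF \<open>c \<in> V\<close> neg[OF \<open>\<theta> \<in> V\<close>]] by simp
  then obtain Q where Q: "Q \<in> E3.points" "E3.logd Q = ratfun_const (\<kappa> * (c - \<theta>)) / to_fract q3"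
    by (auto simp: V_def)
  have "(norm (c - \<theta>) ^ 2) ^ 3 \<le> (1 / 3) ^ 3" using \<theta>(2) by (intro power_mono) auto
  hence "27 * norm (c - \<theta>) ^ 6 \<le> 1" by (simp add: power_divide flip: power_mult)
  moreover have "729 * (\<kappa> * (c - \<theta>)) ^ 6 = 256 * (c - \<theta>) ^ 6"
    by (simp add: power_mult_distrib flip: \<kappa>_power6)
  ultimately have "27 * norm (729 * (\<kappa> * (c - \<theta>)) ^ 6) \<le> 256" by (simp add: norm_mult norm_power)
  hence "Q = Infinity" by (rule E3_small[OF Q])
  hence "c = \<theta>" using Q(2) by simp
  thus ?thesis using \<theta>(1) by simp
qed

section \<open>Generators of the second curve\<close>

text \<open>\<rho>1 dt is the pullback of \<kappa> / (s^2 - 2) ds under s = t + 1/t, and \<rho>3 is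
  \<rho>1 at i t. They are the values of \<open>logd\<close> at \<open>point_P1\<close> and
  \<open>point_P3\<close>.\<close>

definition \<rho>1 :: ratfun where "\<rho>1 = ratfun_const \<kappa> * (tvar ^ 2 - 1) / to_fract q2"
definition \<rho>3 :: ratfun where "\<rho>3 = - ratfun_const \<kappa> * (tvar ^ 2 + 1) / to_fract q2"

text \<open>(t + 1/t)^2 = F2 + 2 and (t - 1/t)^2 = F2 - 2, so each of the three cube roots of 2
  gives two points.\<close>

lemma E2_const_point:
  assumes "a ^ 3 = 2"
  shows "Affine (ratfun_const a) (tvar + 1 / tvar) \<in> E2.points"
    "E2.logd (Affine (ratfun_const a) (tvar + 1 / tvar)) = ratfun_const (a / cbrt2) * \<rho>1"
    "Affine (ratfun_const (- a)) (tvar - 1 / tvar) \<in> E2.points"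
    "E2.logd (Affine (ratfun_const (- a)) (tvar - 1 / tvar)) = ratfun_const (a / cbrt2) * \<rho>3"
proof -
  have a3: "ratfun_const a ^ 3 = 2" using arg_cong[OF assms, of ratfun_const] by simp
  show 1: "Affine (ratfun_const a) (tvar + 1 / tvar) \<in> E2.points"
    using tvar_nonzero a3 by (subst E2.mem_points) (simp add: F2_def field_simps power2_eq_square)
  show 2: "Affine (ratfun_const (- a)) (tvar - 1 / tvar) \<in> E2.points"
    using tvar_nonzero a3 by (subst E2.mem_points) (simp add: F2_def field_simps power2_eq_square)
  have D: "rat_deriv F2 / (3 * F2) = 2 * (tvar ^ 2 - 1) * (tvar ^ 2 + 1) / (3 * tvar * to_fract q2)"
  proof -
    have "rat_deriv F2 = 2 * (tvar ^ 2 - 1) * (tvar ^ 2 + 1) / tvar ^ 3"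
      using tvar_nonzero by (simp add: F2_def rat_deriv_power rat_deriv_divide field_simps eval_nat_numeral)
    thus ?thesis using tvar_nonzero by (simp add: F_eq power3_eq_cube power2_eq_square)
  qed
  have t1: "tvar + 1 / tvar = (tvar ^ 2 + 1) / tvar" and t2: "tvar - 1 / tvar = (tvar ^ 2 - 1) / tvar"
    using tvar_nonzero by (simp_all add: field_simps power2_eq_square)
  have nz: "tvar ^ 2 - 1 \<noteq> 0"
    using E2.coord_nz(2) 2 tvar_nonzero unfolding E2.mem_points t2 by fastforce
  show "E2.logd (Affine (ratfun_const a) (tvar + 1 / tvar)) = ratfun_const (a / cbrt2) * \<rho>1"
    unfolding E2.logd.simps times_divide_eq_right[symmetric] D t1
    using tvar_nonzero by (simp add: \<rho>1_def \<kappa>_def divide_simps)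
  show "E2.logd (Affine (ratfun_const (- a)) (tvar - 1 / tvar)) = ratfun_const (a / cbrt2) * \<rho>3"
    unfolding E2.logd.simps times_divide_eq_right[symmetric] D t2
    using tvar_nonzero nz by (simp add: \<rho>3_def \<kappa>_def divide_simps) (simp add: algebra_simps)
qed

lemma zeta3_cbrt2_cube: "(zeta3 * cbrt2) ^ 3 = 2" "(zeta3 ^ 2 * cbrt2) ^ 3 = 2"
proof -
  have "(zeta3 ^ 2) ^ 3 = (zeta3 ^ 3) ^ 2" by (simp flip: power_mult)
  thus "(zeta3 * cbrt2) ^ 3 = 2" "(zeta3 ^ 2 * cbrt2) ^ 3 = 2"
    by (simp_all add: power_mult_distrib cbrt2_cube zeta3_cube)
qed

lemma E2_points: "point_P1 \<in> E2.points" "point_P2 \<in> E2.points" "point_P3 \<in> E2.points" "point_P4 \<in> E2.points"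
  and E2_logd_points: "E2.logd point_P1 = \<rho>1" "E2.logd point_P2 = ratfun_const zeta3 * \<rho>1"
    "E2.logd point_P3 = \<rho>3" "E2.logd point_P4 = ratfun_const (zeta3 ^ 2) * \<rho>3"
  using E2_const_point[OF cbrt2_cube] E2_const_point[OF zeta3_cbrt2_cube(1)] E2_const_point[OF zeta3_cbrt2_cube(2)]
  unfolding point_P1_def point_P2_def point_P3_def point_P4_def mult_minus_left by simp_all

lemma \<rho>_independent:
  assumes "ratfun_const u * \<rho>1 + ratfun_const v * \<rho>3 = 0"
  shows "u = 0" "v = 0"
proof -
  have "ratfun_const u * \<rho>1 + ratfun_const v * \<rho>3 =
      ratfun_const \<kappa> * (ratfun_const u * (tvar ^ 2 - 1) - ratfun_const v * (tvar ^ 2 + 1)) / to_fract q2"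
    by (simp add: \<rho>1_def \<rho>3_def divide_inverse) (simp add: algebra_simps)
  hence "ratfun_const \<kappa> * (ratfun_const u * (tvar ^ 2 - 1) - ratfun_const v * (tvar ^ 2 + 1)) = 0"
    using assms by simp
  hence "ratfun_const u * (tvar ^ 2 - 1) - ratfun_const v * (tvar ^ 2 + 1) = 0" by simp
  hence "to_fract [:- u - v, 0, u - v:] = 0"
    by (simp add: to_fract_pCons algebra_simps power2_eq_square)
  hence "- u - v = 0" "u - v = 0"
    unfolding to_fract_eq_0_iff pCons_eq_0_iff by blast+
  hence "2 * u = 0" "2 * v = 0" by Groebner_Basis.algebra+
  thus "u = 0" "v = 0" by simp_all
qed

text \<open>Galois descent along the quadratic extension \<complex>(t) of \<complex>(\<phi>).
  Invariance has to be checked on \<open>logd\<close> only, by injectivity.\<close>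

lemma E2_fixed_descends:
  assumes P: "P \<in> E2.points" "E2.logd (twist \<psi> 1 1 P) = E2.logd P"
    and \<psi>: "nonconst \<psi>" "rat_subst \<psi> F2 = F2" "\<psi> \<noteq> tvar"
    and \<phi>: "nonconst \<phi>" "rat_subst \<psi> \<phi> = \<phi>" "rat_subst \<phi> f = F2"
    and quad: "tvar ^ 2 = rat_subst \<phi> T * tvar + rat_subst \<phi> M"
    and f: "mordell_curve f"
  obtains Q where "Q \<in> rational_points (Weierstrass 0 f) UNIV" "P = twist \<phi> 1 1 Q"
proof -
  interpret f: mordell_curve f by fact
  have "twist \<psi> 1 1 P \<in> E2.points"
    using \<psi> by (intro twist_logd[OF E2.mordell_curve_axioms E2.mordell_curve_axioms \<psi>(1) _ _ _ P(1)]) simp_all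
  hence fixed: "twist \<psi> 1 1 P = P" using P by (intro E2.logd_inj) auto
  show ?thesis
  proof (cases P)
    case Infinity
    thus ?thesis using that[of Infinity] by simp
  next
    case (Affine x y)
    hence "rat_subst \<psi> x = x" "rat_subst \<psi> y = y" using fixed by simp_all
    then obtain x' y' where xy: "x = rat_subst \<phi> x'" "y = rat_subst \<phi> y'"
      using fixed_imp_in_range_subst[OF \<phi>(1) \<psi>(1) \<phi>(2) \<psi>(3) quad] by metis
    have "y ^ 2 = x ^ 3 + F2" using P Affine by simp
    hence "rat_subst \<phi> (y' ^ 2) = rat_subst \<phi> (x' ^ 3 + f)"
      using \<phi> by (simp add: xy)
    hence "y' ^ 2 = x' ^ 3 + f" by (rule rat_subst_eq_iff[OF \<phi>(1), THEN iffD1])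
    thus ?thesis using that[of "Affine x' y'"] by (simp add: Affine xy)
  qed
qed

lemma E2_twist:
  assumes "P \<in> E2.points" "nonconst \<psi>" "b ^ 2 = a ^ 3" "b \<noteq> 0" "F2 = ratfun_const (b ^ 2) * rat_subst \<psi> F2"
  shows "twist \<psi> a b P \<in> E2.points"
    "E2.logd (twist \<psi> a b P) = ratfun_const (a / b) * rat_subst \<psi> (E2.logd P) * rat_deriv \<psi>"
  using twist_logd[OF E2.mordell_curve_axioms E2.mordell_curve_axioms assms(2-5,1)] .

text \<open>The sum of P and its image under t -> - t keeps the odd term b t, doubled, and descends
  to the first curve.\<close>

lemma E2_logd_odd_part:
  assumes "P \<in> E2.points"
    "E2.logd P = (ratfun_const a + ratfun_const b * tvar + ratfun_const c * tvar ^ 2) / to_fract q2"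
  shows "b = 0"
proof -
  let ?\<tau> = "twist (- tvar) 1 1"
  have F: "rat_subst (- tvar) F2 = F2" by (simp add: F2_def nonconst_simps)
  have \<tau>: "?\<tau> Q \<in> E2.points" "E2.logd (?\<tau> Q) = - rat_subst (- tvar) (E2.logd Q)" if "Q \<in> E2.points" for Q
    using E2_twist[OF that nonconst_simps(2), of 1 1] by (simp_all add: F)
  have "E2.logd (?\<tau> P) = - ((ratfun_const a - ratfun_const b * tvar + ratfun_const c * tvar ^ 2) / to_fract q2)"
    unfolding \<tau>(2)[OF assms(1)] assms(2) by (simp add: nonconst_simps to_fract_q)
  define Q where "Q = ec_add E2.E P (?\<tau> P)"
  have Q: "Q \<in> E2.points" "E2.logd Q = 2 * ratfun_const b * tvar / to_fract q2"
    using assms \<tau>[OF assms(1)] \<open>E2.logd (?\<tau> P) = _\<close>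
    by (simp_all add: Q_def E2.ec_add_points E2.logd_ec_add field_simps)
  have "- tvar \<noteq> tvar"
  proof
    assume "- tvar = tvar"
    hence "2 * tvar = 0" by (simp add: neg_eq_iff_add_eq_0)
    thus False using tvar_nonzero by simp
  qed
  moreover have "E2.logd (?\<tau> Q) = E2.logd Q"
    unfolding \<tau>(2)[OF Q(1)] Q(2) by (simp add: nonconst_simps to_fract_q)
  moreover have "rat_subst (- tvar) (tvar ^ 2) = tvar ^ 2" "rat_subst (tvar ^ 2) F1 = F2"
    "tvar ^ 2 = rat_subst (tvar ^ 2) 0 * tvar + rat_subst (tvar ^ 2) tvar"
    by (simp_all add: nonconst_simps F1_def F2_def)
  ultimately obtain R where "R \<in> E1.points" "Q = twist (tvar ^ 2) 1 1 R"
    using E2_fixed_descends[OF Q(1) _ nonconst_simps(2) F _ nonconst_simps(3) _ _ _ E1.mordell_curve_axioms]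
    by blast
  hence "Q = Infinity" using E1_trivial by simp
  hence "2 * ratfun_const b * tvar / to_fract q2 = 0" using Q(2) by simp
  thus ?thesis using tvar_nonzero by simp
qed

lemma E2_logd_\<rho>:
  assumes "P \<in> E2.points"
  obtains u v where "E2.logd P = ratfun_const u * \<rho>1 + ratfun_const v * \<rho>3"
proof -
  obtain a b c where abc: "E2.logd P = (ratfun_const a + ratfun_const b * tvar + ratfun_const c * tvar ^ 2) / to_fract q2"
    using E2_logd_form[OF assms] .
  have b: "b = 0" by (rule E2_logd_odd_part[OF assms abc])
  define u v where "u = (c - a) / (2 * \<kappa>)" and "v = - (a + c) / (2 * \<kappa>)"
  have uv: "a = - (u + v) * \<kappa>" "c = (u - v) * \<kappa>" by (simp_all add: u_def v_def field_simps)
  have "E2.logd P = ratfun_const u * \<rho>1 + ratfun_const v * \<rho>3"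
    unfolding abc b uv by (simp add: \<rho>1_def \<rho>3_def add_divide_distrib[symmetric] diff_divide_distrib[symmetric] algebra_simps)
  thus ?thesis by (rule that)
qed

text \<open>The involution t -> 1/t fixes \<rho>1 and negates \<rho>3, so P plus its image has
  \<open>logd\<close> equal to 2 u \<rho>1 and descends to the third curve.\<close>

lemma E2_twice_first_coeff:
  assumes P: "P \<in> E2.points" "E2.logd P = ratfun_const u * \<rho>1 + ratfun_const v * \<rho>3"
  shows "2 * u \<in> eisenstein"
proof -
  let ?\<iota> = "twist (1 / tvar) 1 1"
  let ?s = "tvar + 1 / tvar"
  have \<rho>: "rat_subst (1 / tvar) \<rho>1 / tvar ^ 2 = - \<rho>1" "rat_subst (1 / tvar) \<rho>3 / tvar ^ 2 = \<rho>3"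
  proof -
    have eq: "1 / tvar ^ 4 + 1 = (tvar ^ 4 + 1) / (tvar ^ 2 * tvar ^ 2)"
      "1 / tvar ^ 2 - 1 = (1 - tvar ^ 2) / tvar ^ 2" "1 / tvar ^ 2 + 1 = (1 + tvar ^ 2) / tvar ^ 2"
      using tvar_nonzero by (simp_all add: field_simps flip: power_add)
    have alg: "k * (m / w) / (d / (w * w)) / w = k * m / d" if "w \<noteq> 0" for k m w d :: ratfun
      using that by simp
    have "rat_subst (1 / tvar) \<rho>1 / tvar ^ 2 = ratfun_const \<kappa> * (1 / tvar ^ 2 - 1) / (1 / tvar ^ 4 + 1) / tvar ^ 2"
      "rat_subst (1 / tvar) \<rho>3 / tvar ^ 2 = - ratfun_const \<kappa> * (1 / tvar ^ 2 + 1) / (1 / tvar ^ 4 + 1) / tvar ^ 2"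
      by (simp_all add: \<rho>1_def \<rho>3_def nonconst_simps to_fract_q power_one_over)
    moreover have "tvar ^ 2 \<noteq> 0" using tvar_nonzero by simp
    ultimately have h: "rat_subst (1 / tvar) \<rho>1 / tvar ^ 2 = ratfun_const \<kappa> * (1 - tvar ^ 2) / (tvar ^ 4 + 1)"
      "rat_subst (1 / tvar) \<rho>3 / tvar ^ 2 = - ratfun_const \<kappa> * (1 + tvar ^ 2) / (tvar ^ 4 + 1)"
      unfolding eq by (simp_all only: alg not_False_eq_True)
    show "rat_subst (1 / tvar) \<rho>1 / tvar ^ 2 = - \<rho>1" "rat_subst (1 / tvar) \<rho>3 / tvar ^ 2 = \<rho>3"
      unfolding h unfolding \<rho>1_def \<rho>3_def to_fract_q
      by (simp_all add: algebra_simps minus_divide_left)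
  qed
  have "E2.logd (?\<iota> P) = ratfun_const u * \<rho>1 - ratfun_const v * \<rho>3"
  proof -
    have "E2.logd (?\<iota> P) = - ratfun_const u * (rat_subst (1 / tvar) \<rho>1 / tvar ^ 2) - ratfun_const v * (rat_subst (1 / tvar) \<rho>3 / tvar ^ 2)"
      unfolding E2_iota(2)[OF P(1)] P(2) using nonconst_simps(1) by (simp add: add_divide_distrib diff_divide_distrib)
    thus ?thesis unfolding \<rho> by simp
  qed
  define Q where "Q = ec_add E2.E P (?\<iota> P)"
  have Q: "Q \<in> E2.points" "E2.logd Q = 2 * ratfun_const u * \<rho>1"
    using P E2_iota(1)[OF P(1)] \<open>E2.logd (?\<iota> P) = _\<close>
    by (simp_all add: Q_def E2.ec_add_points E2.logd_ec_add)
  have \<iota>Q: "E2.logd (?\<iota> Q) = E2.logd Q"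
  proof -
    have "E2.logd (?\<iota> Q) = - (2 * ratfun_const u) * (rat_subst (1 / tvar) \<rho>1 / tvar ^ 2)"
      unfolding E2_iota(2)[OF Q(1)] Q(2) using nonconst_simps(1) by simp
    thus ?thesis unfolding \<rho> Q(2) by simp
  qed
  have t2: "tvar ^ 2 - 1 \<noteq> 0"
  proof
    assume "tvar ^ 2 - 1 = 0"
    moreover have "to_fract [:-1, 0, 1:] = tvar ^ 2 - 1" by (simp add: to_fract_pCons power2_eq_square)
    ultimately have "to_fract [:-1, 0, (1 :: complex):] = 0" by (simp only:)
    thus False by simp
  qed
  have "1 / tvar \<noteq> tvar"
  proof
    assume "1 / tvar = tvar"
    hence "tvar * tvar = 1" using tvar_nonzero by (metis nonzero_eq_divide_eq)
    thus False using t2 by (metis power2_eq_square right_minus_eq)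
  qed
  moreover have "rat_subst (1 / tvar) ?s = ?s"
    using nonconst_simps(1) by (simp add: add.commute)
  moreover have s2: "rat_subst ?s F3 = F2"
  proof -
    have "rat_subst ?s F3 = ?s ^ 2 - 2" by (simp add: nonconst_simps F3_def)
    also have "\<dots> = F2" using tvar_nonzero by (simp add: F2_def field_simps eval_nat_numeral)
    finally show ?thesis .
  qed
  moreover have "tvar ^ 2 = rat_subst ?s tvar * tvar + rat_subst ?s (- 1)"
  proof -
    have "rat_subst ?s tvar = ?s" "rat_subst ?s (- 1) = - 1" by (simp_all add: nonconst_simps)
    thus ?thesis using tvar_nonzero by (simp add: algebra_simps power2_eq_square)
  qed
  ultimately obtain R where R: "R \<in> E3.points" "Q = twist ?s 1 1 R"
    using E2_fixed_descends[OF Q(1) \<iota>Q nonconst_simps(1) F2_inverse _ nonconst_simps(4) _ _ _ E3.mordell_curve_axioms]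
    by blast
  have "F2 = ratfun_const (1 ^ 2) * rat_subst ?s F3" using s2 by simp
  from twist_logd(2)[OF E3.mordell_curve_axioms E2.mordell_curve_axioms nonconst_simps(4) _ _ this R(1)]
  have "E2.logd Q = rat_subst ?s (E3.logd R) * rat_deriv ?s" by (simp add: R(2))
  moreover have "rat_deriv ?s = (tvar ^ 2 - 1) / tvar ^ 2"
    using tvar_nonzero by (simp add: rat_deriv_divide field_simps power2_eq_square)
  ultimately have "rat_subst ?s (E3.logd R) * ((tvar ^ 2 - 1) / tvar ^ 2) = 2 * ratfun_const u * \<rho>1"
    using Q(2) by simp
  hence "rat_subst ?s (E3.logd R) * ((tvar ^ 2 - 1) / tvar ^ 2)
      = ratfun_const (\<kappa> * (2 * u)) * (tvar ^ 2 / to_fract q2) * ((tvar ^ 2 - 1) / tvar ^ 2)"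
    using tvar_nonzero by (simp add: \<rho>1_def mult_ac)
  moreover have "(tvar ^ 2 - 1) / tvar ^ 2 \<noteq> 0" using t2 tvar_nonzero by simp
  ultimately have "rat_subst ?s (E3.logd R) = ratfun_const (\<kappa> * (2 * u)) * (tvar ^ 2 / to_fract q2)"
    using mult_right_cancel[of "(tvar ^ 2 - 1) / tvar ^ 2" "rat_subst ?s (E3.logd R)"] by metis
  also have "tvar ^ 2 / to_fract q2 = 1 / F2" by (simp add: F_eq)
  also have "ratfun_const (\<kappa> * (2 * u)) * (1 / F2) = rat_subst ?s (ratfun_const (\<kappa> * (2 * u)) / F3)"
    using s2 nonconst_simps(4) by simp
  finally have "E3.logd R = ratfun_const (\<kappa> * (2 * u)) / F3"
    by (rule rat_subst_eq_iff[OF nonconst_simps(4), THEN iffD1])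
  thus ?thesis using E3_logd_eisenstein[OF R(1)] by (simp add: F_eq(3))
qed

text \<open>F2 changes sign under t -> i t, which the scaling by a = -1, b = i undoes. The resulting
  automorphism sends the coefficients (u, v) to (- v, - u).\<close>

lemma E2_twice_second_coeff:
  assumes P: "P \<in> E2.points" "E2.logd P = ratfun_const u * \<rho>1 + ratfun_const v * \<rho>3"
  shows "2 * v \<in> eisenstein"
proof -
  let ?\<phi> = "ratfun_const \<i> * tvar"
  have nc: "nonconst ?\<phi>" by (intro nonconst_simps) simp
  have i2: "ratfun_const \<i> * ratfun_const \<i> = -1" by (simp flip: ratfun_const_simps(6))
  have i4: "(ratfun_const \<i> * tvar) ^ 2 = - (tvar ^ 2)" "(ratfun_const \<i> * tvar) ^ 4 = tvar ^ 4"
    using i2 by Groebner_Basis.algebra+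
  have F: "F2 = ratfun_const (\<i> ^ 2) * rat_subst ?\<phi> F2"
    using nc by (simp add: F2_def i4)
  have \<rho>: "rat_subst ?\<phi> \<rho>1 = \<rho>3" "rat_subst ?\<phi> \<rho>3 = \<rho>1"
    using nc by (simp_all add: \<rho>1_def \<rho>3_def to_fract_q i4) (simp_all add: algebra_simps minus_divide_left)
  have sq: "\<i> ^ 2 = (- 1) ^ 3" by simp
  let ?Q = "twist ?\<phi> (- 1) \<i> P"
  have "?Q \<in> E2.points" by (rule E2_twist(1)[OF P(1) nc sq _ F]) simp
  moreover have "E2.logd ?Q = ratfun_const (- 1 / \<i>) * rat_subst ?\<phi> (E2.logd P) * rat_deriv ?\<phi>"
    by (rule E2_twist(2)[OF P(1) nc sq _ F]) simp
  hence "E2.logd ?Q = - (ratfun_const \<i> * ratfun_const \<i>) * - rat_subst ?\<phi> (E2.logd P)"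
    by (simp add: mult_ac)
  hence "E2.logd ?Q = ratfun_const (- v) * \<rho>1 + ratfun_const (- u) * \<rho>3"
    using nc by (simp add: i2 P(2) \<rho>)
  ultimately have "2 * - v \<in> eisenstein" by (rule E2_twice_first_coeff)
  thus ?thesis using eisenstein_simps(3)[of "2 * - v"] by simp
qed

subsection \<open>Points that are not divisible by two\<close>

text \<open>The duplication formula x(2Q) = (x^4 - 8 f x) / (4 (x^3 + f)) with denominators cleared:
  P stands for t^2 x, W for t^6 F2, and x(2Q) = A / t^2 + B. Leading degrees force P to be at most
  quadratic, and a few coefficients then decide.\<close>

lemma duplication_poly_solution:
  fixes P :: "complex poly" and A B :: complex
  defines "W \<equiv> [:0, 0, 0, 0, 1, 0, 0, 0, 1:]"
  assumes eq: "P ^ 4 - 8 * W * P = 4 * (P ^ 3 + W) * [:A, 0, B:]"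
  shows "A = 0" "B = 0"
proof -
  have W: "Polynomial.degree W = 8" by (simp add: W_def)
  have "Polynomial.degree P \<le> 2"
  proof (rule ccontr)
    assume "\<not> Polynomial.degree P \<le> 2"
    hence deg: "Polynomial.degree P \<ge> 3" by simp
    hence P: "P \<noteq> 0" by auto
    have L: "Polynomial.degree [:A, 0, B:] \<le> 2" by simp
    have n4: "(4 :: complex poly) = [:4:]" and n8: "(8 :: complex poly) = [:8:]" by (simp_all add: numeral_poly)
    have d1: "Polynomial.degree (8 * W * P) \<le> 8 + Polynomial.degree P"
      using degree_mult_le[of "8 * W" P] degree_mult_le[of 8 W] by (simp add: W n8)
    have "Polynomial.degree (P ^ 3 + W) \<le> max (3 * Polynomial.degree P) 8"
      using degree_power_le[of P 3] by (intro degree_add_le_max[THEN order_trans]) (auto simp: W mult.commute)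
    hence d2: "Polynomial.degree (4 * (P ^ 3 + W) * [:A, 0, B:]) \<le> max (3 * Polynomial.degree P) 8 + 2"
      using degree_mult_le[of "4 * (P ^ 3 + W)" "[:A, 0, B:]"] degree_mult_le[of 4 "P ^ 3 + W"] L
      by (simp add: n4)
    have "P ^ 4 = 4 * (P ^ 3 + W) * [:A, 0, B:] + 8 * W * P" using eq by (simp add: algebra_simps)
    hence "Polynomial.degree (P ^ 4) \<le> max (Polynomial.degree (4 * (P ^ 3 + W) * [:A, 0, B:])) (Polynomial.degree (8 * W * P))"
      by (simp only: degree_add_le_max)
    also have "\<dots> \<le> max (max (3 * Polynomial.degree P) 8 + 2) (8 + Polynomial.degree P)"
      by (rule max.mono[OF d2 d1])
    finally have "Polynomial.degree (P ^ 4) \<le> max (max (3 * Polynomial.degree P) 8 + 2) (8 + Polynomial.degree P)" .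
    moreover have "Polynomial.degree (P ^ 4) = 4 * Polynomial.degree P" using P by (simp add: degree_power_eq)
    ultimately show False using deg by simp
  qed
  then obtain a b c where P: "P = [:a, b, c:]" using poly_degree_le_2 by blast
  have "[:a, b, c:] ^ 4 - 8 * W * [:a, b, c:] - 4 * ([:a, b, c:] ^ 3 + W) * [:A, 0, B:] = 0"
    using eq by (simp add: P)
  hence eqs: "\<And>n. Polynomial.coeff ([:a, b, c:] ^ 4 - 8 * W * [:a, b, c:] - 4 * ([:a, b, c:] ^ 3 + W) * [:A, 0, B:]) n = 0"
    by simp
  have num: "(4 :: complex poly) = [:4:]" "(8 :: complex poly) = [:8:]" by (simp_all add: numeral_poly)
  note expand = W_def num power3_eq_cube power4_eq_xxxx coeff_pCons numeral_eq_Suc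
  have B: "B = - 2 * c" using eqs[of 10] by (simp add: expand)
  have b: "b = 0" using eqs[of 9] by (simp add: expand)
  have c0: "a ^ 4 = 4 * A * a ^ 3" and c2: "4 * a ^ 3 * c = 4 * (3 * a ^ 2 * c * A + a ^ 3 * B)"
    and c4: "6 * a ^ 2 * c ^ 2 - 8 * a = 4 * (3 * a * c ^ 2 * A + 3 * a ^ 2 * c * B + A)"
    and c8: "c ^ 4 - 8 * a = 4 * (c ^ 3 * B + A)"
    using eqs[of 0] eqs[of 2] eqs[of 4] eqs[of 8] unfolding b
    by (simp_all add: expand power2_eq_square algebra_simps)
  show "A = 0" "B = 0"
  proof -
    have "A = 0 \<and> c = 0"
    proof (cases "a = 0")
      case True
      hence "A = 0" using c4 by simp
      hence "9 * c ^ 4 = 0" using c8 True unfolding B by (simp add: eval_nat_numeral algebra_simps)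
      thus ?thesis using \<open>A = 0\<close> by simp
    next
      case False
      have "a ^ 3 * (a - 4 * A) = 0" using c0 by Groebner_Basis.algebra
      hence a: "a = 4 * A" using False by simp
      have "36 * a ^ 2 * (A * c) = 0" using c2 unfolding B a by Groebner_Basis.algebra
      hence "c = 0" using False a by simp
      hence "36 * A = 0" using c8 unfolding a by simp
      thus ?thesis using False a by simp
    qed
    thus "A = 0" "B = 0" using B by simp_all
  qed
qed

text \<open>The prescribed x-coordinate is the common shape for points with constant x (A = 0) and
  for sums of one such point from each of the two families in \<open>E2_const_point\<close>.\<close>

lemma E2_not_twice:
  assumes P: "P \<in> E2.points"
    and dbl: "ec_add E2.E P P = Affine (ratfun_const A / tvar ^ 2 + ratfun_const B) z"
  shows False
proof -
  obtain x y where xy: "P = Affine x y" using dbl by (cases P) auto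
  have on: "y ^ 2 = x ^ 3 + F2" using P xy by simp
  note nz = E2.coord_nz[OF on]
  define w where "w = ratfun_const A / tvar ^ 2 + ratfun_const B"
  have "y \<noteq> - y" using nz by (simp add: eq_neg_iff_add_eq_0 flip: mult_2)
  hence w: "w = (3 * x ^ 2 / (2 * y)) ^ 2 - x - x"
    using dbl by (simp add: xy Let_def w_def)
  have "4 * (x ^ 3 + F2) * w = x ^ 4 - 8 * F2 * x"
  proof -
    have "4 * y ^ 2 * w = 9 * x ^ 4 - 8 * x * y ^ 2"
      unfolding w using nz by (simp add: power_divide power_mult_distrib field_simps flip: power_mult)
    thus ?thesis unfolding on by Groebner_Basis.algebra
  qed
  define X0 where "X0 = tvar ^ 2 * x"
  define W :: "complex poly" where "W = [:0, 0, 0, 0, 1, 0, 0, 0, 1:]"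
  have W: "to_fract W = tvar ^ 4 + tvar ^ 8"
    by (simp add: W_def to_fract_pCons eval_nat_numeral algebra_simps)
  have AB: "to_fract [:A, 0, B:] = tvar ^ 2 * w"
    using tvar_nonzero by (simp add: w_def to_fract_pCons algebra_simps power2_eq_square)
  have F2: "tvar ^ 6 * F2 = to_fract W"
    using tvar_nonzero by (simp add: F_eq W to_fract_q field_simps flip: power_add)
  have "X0 ^ 4 - 8 * to_fract W * X0 = 4 * (X0 ^ 3 + to_fract W) * to_fract [:A, 0, B:]"
    using \<open>4 * (x ^ 3 + F2) * w = x ^ 4 - 8 * F2 * x\<close>
    unfolding X0_def F2[symmetric] AB by Groebner_Basis.algebra
  obtain p q where pq: "X0 = to_fract p / to_fract q" "q \<noteq> 0" "coprime p q" by (rule ratfun_cases)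
  have Xq: "to_fract p = X0 * to_fract q" using pq by simp
  have "to_fract p ^ 4 - 8 * to_fract W * to_fract p * to_fract q ^ 3
      = 4 * (to_fract p ^ 3 * to_fract q + to_fract W * to_fract q ^ 4) * to_fract [:A, 0, B:]"
    using \<open>X0 ^ 4 - _ = _\<close> unfolding Xq by Groebner_Basis.algebra
  hence "to_fract (p ^ 4) = to_fract (q * (8 * W * p * q ^ 2 + 4 * (p ^ 3 + W * q ^ 3) * [:A, 0, B:]))"
    unfolding to_fract_mult to_fract_add to_fract_power to_fract_numeral by Groebner_Basis.algebra
  hence "p ^ 4 = q * (8 * W * p * q ^ 2 + 4 * (p ^ 3 + W * q ^ 3) * [:A, 0, B:])"
    by (rule to_fract_eq_iff[THEN iffD1])
  \<comment> \<open>The equation is monic in X0, so X0 is integral over \<complex>[t] and therefore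
    a polynomial.\<close>
  hence "q dvd p ^ 4" by simp
  moreover have "coprime (p ^ 4) q" using pq(3) by simp
  ultimately have "is_unit q" by (meson coprime_absorb_right dvd_refl)
  then obtain k where k: "q = [:k:]" "k \<noteq> 0" 
    using is_unit_poly_iff[of q] pq(2) by auto
  define P' where "P' = Polynomial.smult (1 / k) p"
  have XP: "X0 = to_fract P'"
    using k to_fract_quot_eq_iff[of q 1 p P'] by (simp add: pq(1) P'_def)
  have "to_fract (P' ^ 4 - 8 * W * P') = to_fract (4 * (P' ^ 3 + W) * [:A, 0, B:])"
    using \<open>X0 ^ 4 - _ = _\<close> unfolding XP to_fract_mult to_fract_add to_fract_diff to_fract_power to_fract_numeral .
  hence "P' ^ 4 - 8 * W * P' = 4 * (P' ^ 3 + W) * [:A, 0, B:]"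
    by (rule to_fract_eq_iff[THEN iffD1])
  \<comment> \<open>A double with x = 0 would make F2 a square.\<close>
  hence "A = 0" "B = 0" using duplication_poly_solution unfolding W_def by blast+
  hence w0: "w = 0" by (simp add: w_def)
  have "ec_add E2.E P P \<in> E2.points" using P by (intro E2.ec_add_points)
  hence "z ^ 2 = w ^ 3 + F2" unfolding dbl w_def by simp
  thus False using E2.coord_nz(1) w0 by blast
qed

text \<open>Z[zeta3] / 2 is the field with four elements. Roots of unity represent its nonzero
  classes because their multiples of 2^(1/3) again cube to 2, so that \<open>E2_const_point\<close>
  applies.\<close>

lemma eisenstein_mod_2:
  assumes "\<theta> \<in> eisenstein"
  obtains \<alpha> \<epsilon> where "\<alpha> \<in> eisenstein" "\<epsilon> \<in> {0, 1, zeta3, zeta3 ^ 2}" "\<theta> = 2 * \<alpha> + \<epsilon>"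
proof -
  obtain m n where mn: "\<theta> = of_int m + of_int n * zeta3" using assms by (auto simp: eisenstein_def)
  define k l where "k = m div 2" and "l = n div 2"
  let ?T = "\<exists>\<alpha>\<in>eisenstein. \<exists>\<epsilon>\<in>{0, 1, zeta3, zeta3 ^ 2}. \<theta> = 2 * \<alpha> + \<epsilon>"
  have z2: "zeta3 ^ 2 = - 1 - zeta3" using zeta3_cubic by Groebner_Basis.algebra
  have "(m = 2 * k \<or> m = 2 * k + 1) \<and> (n = 2 * l \<or> n = 2 * l + 1)"
    unfolding k_def l_def by presburger
  moreover have ?T if "m = 2 * k" "n = 2 * l"
    using that by (intro bexI[of _ "of_int k + of_int l * zeta3"] bexI[of _ 0] eisensteinI) (auto simp: mn algebra_simps)
  moreover have ?T if "m = 2 * k + 1" "n = 2 * l"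
    using that by (intro bexI[of _ "of_int k + of_int l * zeta3"] bexI[of _ 1] eisensteinI) (auto simp: mn algebra_simps)
  moreover have ?T if "m = 2 * k" "n = 2 * l + 1"
    using that by (intro bexI[of _ "of_int k + of_int l * zeta3"] bexI[of _ zeta3] eisensteinI) (auto simp: mn algebra_simps)
  \<comment> \<open>zeta3^2 = - 1 - zeta3 has both coordinates -1, hence the shift to k + 1 and l +
    1.\<close>
  moreover have ?T if "m = 2 * k + 1" "n = 2 * l + 1"
    using that by (intro bexI[of _ "of_int (k + 1) + of_int (l + 1) * zeta3"] bexI[of _ "zeta3 ^ 2"] eisensteinI)
       (auto simp: mn z2 algebra_simps)
  ultimately show ?thesis using that by blast
qed

abbreviation combination :: "int \<Rightarrow> int \<Rightarrow> int \<Rightarrow> int \<Rightarrow> ratfun ec_point" where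
  "combination m n k l \<equiv> point_P1 [^]\<^bsub>E2.G\<^esub> m \<otimes>\<^bsub>E2.G\<^esub> point_P2 [^]\<^bsub>E2.G\<^esub> n \<otimes>\<^bsub>E2.G\<^esub>
      (point_P3 [^]\<^bsub>E2.G\<^esub> k \<otimes>\<^bsub>E2.G\<^esub> point_P4 [^]\<^bsub>E2.G\<^esub> l)"

lemma E2_eisenstein_points:
  assumes "u \<in> eisenstein" "v \<in> eisenstein"
  obtains m n k l :: int where
    "u = of_int m + of_int n * zeta3" "v = of_int k + of_int l * zeta3 ^ 2"
    "combination m n k l \<in> E2.points"
    "E2.logd (combination m n k l) = ratfun_const u * \<rho>1 + ratfun_const v * \<rho>3"
proof -
  have z2: "zeta3 ^ 2 = - 1 - zeta3" using zeta3_cubic by Groebner_Basis.algebra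
  obtain m n where u: "u = of_int m + of_int n * zeta3" using assms by (auto simp: eisenstein_def)
  obtain k' l' where "v = of_int k' + of_int l' * zeta3" using assms by (auto simp: eisenstein_def)
  \<comment> \<open>A change to the basis 1, zeta3^2 of Z[zeta3], since \<open>point_P4\<close>
    carries zeta3^2.\<close>
  hence v: "v = of_int (k' - l') + of_int (- l') * zeta3 ^ 2" by (simp add: z2 algebra_simps)
  show ?thesis
  proof (rule that[OF u v])
    show "E2.logd (combination m n (k' - l') (- l')) = ratfun_const u * \<rho>1 + ratfun_const v * \<rho>3"
      unfolding u v
      by (simp add: E2.logd_ec_add E2.ec_add_points E2.pow_int_points E2_points E2.logd_pow_int E2_logd_points
           algebra_simps)
  qed (simp add: E2.ec_add_points E2.pow_int_points E2_points)
qed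

text \<open>Subtracting from P a combination of the four points leaves Q whose double has
  coefficients \<epsilon>, \<delta> among the representatives modulo 2. Unless both vanish, that
  double is a point excluded by \<open>E2_not_twice\<close>.\<close>

lemma E2_logd_eisenstein:
  assumes P: "P \<in> E2.points"
  obtains u v where "u \<in> eisenstein" "v \<in> eisenstein" "E2.logd P = ratfun_const u * \<rho>1 + ratfun_const v * \<rho>3"
proof -
  obtain u v where uv: "E2.logd P = ratfun_const u * \<rho>1 + ratfun_const v * \<rho>3"
    by (rule E2_logd_\<rho>[OF P])
  obtain \<alpha> \<epsilon> where \<alpha>: "\<alpha> \<in> eisenstein" "\<epsilon> \<in> {0, 1, zeta3, zeta3 ^ 2}" "2 * u = 2 * \<alpha> + \<epsilon>"
    by (rule eisenstein_mod_2[OF E2_twice_first_coeff[OF P uv]])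
  obtain \<beta> \<delta> where \<beta>: "\<beta> \<in> eisenstein" "\<delta> \<in> {0, 1, zeta3, zeta3 ^ 2}" "2 * v = 2 * \<beta> + \<delta>"
    by (rule eisenstein_mod_2[OF E2_twice_second_coeff[OF P uv]])
  obtain R where R: "R \<in> E2.points" "E2.logd R = ratfun_const (- \<alpha>) * \<rho>1 + ratfun_const (- \<beta>) * \<rho>3"
    using E2_eisenstein_points[of "- \<alpha>" "- \<beta>"] \<alpha>(1) \<beta>(1) by blast
  define Q where "Q = ec_add E2.E P R"
  have Q: "Q \<in> E2.points" using P R by (simp add: Q_def E2.ec_add_points)
  have "E2.logd Q = E2.logd P + E2.logd R" using P R by (simp add: Q_def E2.logd_ec_add)
  hence logd_Q: "E2.logd Q = ratfun_const (u - \<alpha>) * \<rho>1 + ratfun_const (v - \<beta>) * \<rho>3"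
    unfolding \<open>E2.logd Q = _\<close> uv R(2) by (simp add: algebra_simps)
  have "E2.logd (ec_add E2.E Q Q) = ratfun_const (2 * u - 2 * \<alpha>) * \<rho>1 + ratfun_const (2 * v - 2 * \<beta>) * \<rho>3"
    unfolding E2.logd_ec_add[OF Q Q] logd_Q by (simp add: algebra_simps)
  hence QQ: "E2.logd (ec_add E2.E Q Q) = ratfun_const \<epsilon> * \<rho>1 + ratfun_const \<delta> * \<rho>3"
    using \<alpha>(3) \<beta>(3) by simp
  have unit_cube: "\<epsilon> ^ 3 = 1" if "\<epsilon> \<in> {0, 1, zeta3, zeta3 ^ 2}" "\<epsilon> \<noteq> 0" for \<epsilon>
  proof -
    have "(zeta3 ^ 2) ^ 3 = (zeta3 ^ 3) ^ 2" by (simp flip: power_mult)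
    thus ?thesis using that zeta3_cube by auto
  qed
  let ?A = "\<lambda>\<epsilon>. Affine (ratfun_const (\<epsilon> * cbrt2)) (tvar + 1 / tvar)"
  let ?B = "\<lambda>\<epsilon>. Affine (ratfun_const (- (\<epsilon> * cbrt2))) (tvar - 1 / tvar)"
  have A: "?A \<epsilon> \<in> E2.points" "E2.logd (?A \<epsilon>) = ratfun_const \<epsilon> * \<rho>1"
    and B: "?B \<epsilon> \<in> E2.points" "E2.logd (?B \<epsilon>) = ratfun_const \<epsilon> * \<rho>3"
    if "\<epsilon> \<in> {0, 1, zeta3, zeta3 ^ 2}" "\<epsilon> \<noteq> 0" for \<epsilon>
    using E2_const_point[of "\<epsilon> * cbrt2"] unit_cube[OF that] by (simp_all add: power_mult_distrib cbrt2_cube)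
  have QQ_points: "ec_add E2.E Q Q \<in> E2.points" using Q by (simp add: E2.ec_add_points)
  have "\<epsilon> = 0 \<and> \<delta> = 0"
  proof (rule ccontr)
    assume "\<not> (\<epsilon> = 0 \<and> \<delta> = 0)"
    then consider "\<epsilon> \<noteq> 0" "\<delta> = 0" | "\<epsilon> = 0" "\<delta> \<noteq> 0" | "\<epsilon> \<noteq> 0" "\<delta> \<noteq> 0" by blast
    thus False
    proof cases
      case 1
      hence "ec_add E2.E Q Q = ?A \<epsilon>" using A[OF \<alpha>(2)] QQ
        by (intro E2.logd_inj[OF QQ_points]) (simp_all del: E2.logd.simps)
      thus False using E2_not_twice[OF Q, of 0 "\<epsilon> * cbrt2"] by simp
    next
      case 2
      hence "ec_add E2.E Q Q = ?B \<delta>" using B[OF \<beta>(2)] QQ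
        by (intro E2.logd_inj[OF QQ_points]) (simp_all del: E2.logd.simps)
      thus False using E2_not_twice[OF Q, of 0 "- (\<delta> * cbrt2)"] by simp
    next
      case 3
      note A = A[OF \<alpha>(2) 3(1)] and B = B[OF \<beta>(2) 3(2)]
      have eq: "ec_add E2.E Q Q = ec_add E2.E (?A \<epsilon>) (?B \<delta>)"
        by (rule E2.logd_inj[OF QQ_points E2.ec_add_points[OF A(1) B(1)]])
           (simp only: QQ E2.logd_ec_add[OF A(1) B(1)] A(2) B(2))
      \<comment> \<open>This separates the two x-coordinates \<epsilon> 2^(1/3) and - \<delta>
        2^(1/3), so the sum is given by a chord, of slope - 2 / (d t).\<close>
      have "\<epsilon> + \<delta> \<noteq> 0"
      proof
        assume "\<epsilon> + \<delta> = 0"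
        hence "\<epsilon> = - \<delta>" by (simp add: eq_neg_iff_add_eq_0)
        hence "\<epsilon> ^ 3 = - (\<delta> ^ 3)" by simp
        thus False using unit_cube[OF \<alpha>(2) 3(1)] unit_cube[OF \<beta>(2) 3(2)] by simp
      qed
      define d where "d = - (\<delta> * cbrt2) - \<epsilon> * cbrt2"
      have "d = - ((\<epsilon> + \<delta>) * cbrt2)" by (simp add: d_def algebra_simps)
      hence d: "d \<noteq> 0" using \<open>\<epsilon> + \<delta> \<noteq> 0\<close> by simp
      hence ne: "ratfun_const (\<epsilon> * cbrt2) \<noteq> ratfun_const (- (\<delta> * cbrt2))"
        unfolding ratfun_const_simps(7) by (auto simp: d_def)
      let ?x = "(((tvar - 1 / tvar) - (tvar + 1 / tvar)) / (ratfun_const (- (\<delta> * cbrt2)) - ratfun_const (\<epsilon> * cbrt2))) ^ 2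
            - ratfun_const (\<epsilon> * cbrt2) - ratfun_const (- (\<delta> * cbrt2))"
      have "\<exists>z. ec_add E2.E (?A \<epsilon>) (?B \<delta>) =
          Affine ?x z"
        using ne by (simp only: ec_add.simps Let_def if_False simp_thms) blast
      then obtain z where z: "ec_add E2.E (?A \<epsilon>) (?B \<delta>) =
          Affine ?x z" by blast
      have "(tvar - 1 / tvar) - (tvar + 1 / tvar) = - 2 / tvar" by simp
      hence "?x
          = ratfun_const (4 / d ^ 2) / tvar ^ 2 + ratfun_const (- (\<epsilon> * cbrt2) + \<delta> * cbrt2)"
        unfolding ratfun_const_simps(4)[symmetric] d_def[symmetric]
        by (simp add: power_divide power_mult_distrib)
      with z eq have "ec_add E2.E Q Q = Affine (ratfun_const (4 / d ^ 2) / tvar ^ 2 + ratfun_const (- (\<epsilon> * cbrt2) + \<delta> * cbrt2)) z"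
        by metis
      thus False by (rule E2_not_twice[OF Q])
    qed
  qed
  hence "u = \<alpha>" "v = \<beta>" using \<alpha>(3) \<beta>(3) by simp_all
  thus ?thesis using that \<alpha>(1) \<beta>(1) uv by blast
qed

section \<open>Ranks\<close>

lemma common_denominator:
  fixes r :: "'a \<Rightarrow> rat"
  assumes "finite S"
  obtains d :: int and c :: "'a \<Rightarrow> int" where "d > 0" "\<And>s. s \<in> S \<Longrightarrow> of_int d * r s = of_int (c s)"
proof -
  have "\<exists>d>0. \<forall>s\<in>S. \<exists>k. of_int d * r s = of_int k"
    using assms
  proof (induction S rule: finite_induct)
    case empty
    show ?case by (rule exI[of _ 1]) simp
  next
    case (insert x S)
    then obtain d where d: "d > 0" "\<forall>s\<in>S. \<exists>k. of_int d * r s = of_int k" by blast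
    obtain a b where ab: "r x = of_int a / of_int b" "b > 0"
      by (metis quotient_of_denom_pos quotient_of_div surj_pair)
    have "of_int (d * b) * r x = of_int (d * a)" using ab by simp
    moreover have "\<exists>k. of_int (d * b) * r s = of_int k" if s: "s \<in> S" for s
    proof -
      obtain k where k: "of_int d * r s = of_int k" using bspec[OF d(2) s] ..
      have "of_int (d * b) * r s = of_int b * (of_int d * r s)" by simp
      hence "of_int (d * b) * r s = of_int (b * k)" unfolding k by simp
      thus ?thesis by blast
    qed
    ultimately have "\<forall>s\<in>insert x S. \<exists>k. of_int (d * b) * r s = of_int k" by blast
    moreover have "d * b > 0" using d(1) ab(2) by simp
    ultimately show ?case by blast
  qed
  then obtain d where "d > 0" "\<forall>s\<in>S. \<exists>k. of_int d * r s = of_int k" by blast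
  thus ?thesis using that by metis
qed

text \<open>Linear dependence over the rationals, cleared of denominators. For a family with a
  repeated vector the coefficients 1 and -1 serve.\<close>

lemma integer_relation:
  fixes v :: "'a \<Rightarrow> rat ^ 'n"
  assumes "finite S" "card S > CARD('n)"
  obtains c :: "'a \<Rightarrow> int" where "\<exists>s\<in>S. c s \<noteq> 0" "(\<Sum>s\<in>S. of_int (c s) *s v s) = 0"
proof -
  have "\<exists>r. (\<exists>s\<in>S. r s \<noteq> 0) \<and> (\<Sum>s\<in>S. r s *s v s) = 0"
  proof (cases "inj_on v S")
    case True
    hence "card (v ` S) > CARD('n)" using assms(2) by (simp add: card_image)
    hence "vec.dependent (v ` S)"
      using vec.independent_card_le_dim[of "v ` S" UNIV] by (auto simp: vec.dim_UNIV card_cart_basis)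
    then obtain u where u: "\<exists>w\<in>v ` S. u w \<noteq> 0" "(\<Sum>w\<in>v ` S. u w *s w) = 0"
      using vec.dependent_finite[of "v ` S"] assms(1) by auto
    hence "(\<Sum>s\<in>S. u (v s) *s v s) = 0" using sum.reindex[OF True, of "\<lambda>w. u w *s w"] by (simp add: o_def)
    thus ?thesis using u(1) by (intro exI[of _ "u \<circ> v"]) auto
  next
    case False
    then obtain a b where ab: "a \<in> S" "b \<in> S" "a \<noteq> b" "v a = v b" by (auto simp: inj_on_def)
    define r :: "'a \<Rightarrow> rat" where "r = (\<lambda>s. if s = a then 1 else if s = b then -1 else 0)"
    have "(\<Sum>s\<in>S. r s *s v s) = (\<Sum>s\<in>{a, b}. r s *s v s)"
      using assms(1) ab by (intro sum.mono_neutral_right) (auto simp: r_def)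
    also have "\<dots> = 0" using ab by (simp add: r_def)
    finally show ?thesis using ab by (intro exI[of _ r]) (auto simp: r_def)
  qed
  then obtain r where r: "\<exists>s\<in>S. r s \<noteq> 0" "(\<Sum>s\<in>S. r s *s v s) = 0" by blast
  obtain d c where dc: "d > 0" "\<And>s. s \<in> S \<Longrightarrow> of_int d * r s = of_int (c s)"
    using common_denominator[OF assms(1)] by metis
  have "(\<Sum>s\<in>S. of_int (c s) *s v s) = (\<Sum>s\<in>S. of_int d *s (r s *s v s))"
    by (intro sum.cong) (auto simp: dc(2)[symmetric])
  also have "\<dots> = of_int d *s (\<Sum>s\<in>S. r s *s v s)" by (simp add: vec.scale_sum_right)
  finally have "(\<Sum>s\<in>S. of_int (c s) *s v s) = 0" using r by simp
  moreover have "\<exists>s\<in>S. c s \<noteq> 0"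
  proof -
    obtain s where s: "s \<in> S" "r s \<noteq> 0" using r by blast
    hence "of_int (c s) \<noteq> (0 :: rat)" using dc(1) by (simp flip: dc(2))
    thus ?thesis using s by auto
  qed
  ultimately show ?thesis using that by blast
qed

lemma (in mordell_curve) logd_int_combination:
  assumes "finite S" "S \<subseteq> points"
  shows "logd (finprod G (\<lambda>P. P [^]\<^bsub>G\<^esub> (c P :: int)) S) = (\<Sum>P\<in>S. of_int (c P) * logd P)"
    "finprod G (\<lambda>P. P [^]\<^bsub>G\<^esub> (c P :: int)) S \<in> points"
proof -
  have *: "(\<lambda>P. P [^]\<^bsub>G\<^esub> c P) \<in> S \<rightarrow> points" using assms pow_int_points by auto
  have "logd (finprod G (\<lambda>P. P [^]\<^bsub>G\<^esub> c P) S) = (\<Sum>P\<in>S. logd (P [^]\<^bsub>G\<^esub> c P))"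
    by (rule logd_finprod[OF assms(1) *])
  also have "\<dots> = (\<Sum>P\<in>S. of_int (c P) * logd P)"
    using assms(2) by (intro sum.cong logd_pow_int) auto
  finally show "logd (finprod G (\<lambda>P. P [^]\<^bsub>G\<^esub> (c P :: int)) S) = (\<Sum>P\<in>S. of_int (c P) * logd P)" .
  show "finprod G (\<lambda>P. P [^]\<^bsub>G\<^esub> (c P :: int)) S \<in> points"
    using G.finprod_closed[of "\<lambda>P. P [^]\<^bsub>G\<^esub> c P" S] * by simp
qed

text \<open>Injectivity of \<open>logd\<close> moves independence into the additive group of
  \<complex>(t).\<close>

lemma (in mordell_curve) int_independent_iff:
  "int_independent G S \<longleftrightarrow> finite S \<and> S \<subseteq> points \<and>
     (\<forall>c :: _ \<Rightarrow> int. (\<Sum>P\<in>S. of_int (c P) * logd P) = 0 \<longrightarrow> (\<forall>P\<in>S. c P = 0))"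
proof -
  have "finprod G (\<lambda>P. P [^]\<^bsub>G\<^esub> c P) S = Infinity \<longleftrightarrow> (\<Sum>P\<in>S. of_int (c P) * logd P) = 0"
    if fin: "finite S" "S \<subseteq> points" for c :: "_ \<Rightarrow> int"
    unfolding logd_int_combination(1)[OF fin, of c, symmetric]
    using logd_eq_0[OF logd_int_combination(2)[OF fin, of c]] by fastforce
  thus ?thesis unfolding int_independent_def G_simps by blast
qed

text \<open>An integer relation among the coordinate vectors a P carries over to the values of
  \<open>logd\<close>.\<close>

lemma (in mordell_curve) card_int_independent_le:
  fixes \<rho> :: "'n::finite \<Rightarrow> ratfun"
  assumes span: "\<And>P. P \<in> points \<Longrightarrow> \<exists>a :: 'n \<Rightarrow> int. logd P = (\<Sum>i\<in>UNIV. of_int (a i) * \<rho> i)"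
    and S: "int_independent G S"
  shows "card S \<le> CARD('n)"
proof (rule ccontr)
  assume "\<not> card S \<le> CARD('n)"
  hence card: "card S > CARD('n)" by simp
  have fin: "finite S" "S \<subseteq> points" using S by (auto simp: int_independent_iff)
  obtain a where a: "\<And>P. P \<in> points \<Longrightarrow> logd P = (\<Sum>i\<in>UNIV. of_int (a P i) * \<rho> i)"
    using span by metis
  define v :: "ratfun ec_point \<Rightarrow> rat ^ 'n" where "v = (\<lambda>P. \<chi> i. of_int (a P i))"
  obtain c :: "ratfun ec_point \<Rightarrow> int" where c: "\<exists>P\<in>S. c P \<noteq> 0" "(\<Sum>P\<in>S. of_int (c P) *s v P) = 0"
    using integer_relation[OF fin(1) card] by blast
  have "(\<Sum>P\<in>S. c P * a P i) = 0" for i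
  proof -
    have "of_int (\<Sum>P\<in>S. c P * a P i) = (\<Sum>P\<in>S. of_int (c P) *s v P) $ i"
      by (simp add: v_def)
    hence "of_int (\<Sum>P\<in>S. c P * a P i) = (0 :: rat)" unfolding c(2) by simp
    thus ?thesis by (simp only: of_int_eq_0_iff)
  qed
  hence 0: "(\<Sum>P\<in>S. of_int (c P) * of_int (a P i)) = (0 :: ratfun)" for i
    by (metis (mono_tags, lifting) of_int_0 of_int_mult of_int_sum sum.cong)
  have "(\<Sum>P\<in>S. of_int (c P) * logd P) = (\<Sum>P\<in>S. \<Sum>i\<in>UNIV. of_int (c P) * of_int (a P i) * \<rho> i)"
    using fin a by (intro sum.cong) (auto simp: sum_distrib_left mult.assoc subset_iff)
  also have "\<dots> = (\<Sum>i\<in>UNIV. \<Sum>P\<in>S. of_int (c P) * of_int (a P i) * \<rho> i)" by (rule sum.swap)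
  also have "\<dots> = (\<Sum>i\<in>UNIV. (\<Sum>P\<in>S. of_int (c P) * of_int (a P i)) * \<rho> i)" by (simp add: sum_distrib_right)
  also have "\<dots> = 0" by (simp add: 0)
  finally show False using S c(1) unfolding int_independent_iff by blast
qed

lemma abelian_rank_eqI:
  assumes "int_independent G S" "card S = n" "\<And>S'. int_independent G S' \<Longrightarrow> card S' \<le> n"
  shows "abelian_rank G = enat n"
  unfolding abelian_rank_def
proof (rule antisym)
  show "(SUP S\<in>{S. int_independent G S}. enat (card S)) \<le> enat n"
    using assms(3) by (intro SUP_least) auto
  show "enat n \<le> (SUP S\<in>{S. int_independent G S}. enat (card S))"
    using assms(1,2) by (intro SUP_upper2[of S]) auto
qed

lemma rank_E1: "abelian_rank E1.G = 0"
proof -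
  have "S = {}" if "int_independent E1.G S" for S
  proof (rule ccontr)
    assume "S \<noteq> {}"
    moreover have "S \<subseteq> {Infinity}" using that E1_trivial by (auto simp: E1.int_independent_iff)
    ultimately have "S = {Infinity}" by auto
    moreover have "\<forall>c :: _ \<Rightarrow> int. (\<Sum>P\<in>S. of_int (c P) * E1.logd P) = 0 \<longrightarrow> (\<forall>P\<in>S. c P = 0)"
      using that by (simp add: E1.int_independent_iff)
    \<comment> \<open>The singleton of \<open>Infinity\<close> is dependent: coefficient 1 already
      gives 0.\<close>
    from this[rule_format, of "\<lambda>_. 1"] have "\<not> (\<Sum>P\<in>S. of_int (1 :: int) * E1.logd P) = 0"
      using \<open>S \<noteq> {}\<close> by auto
    ultimately show False by simp
  qed
  hence "abelian_rank E1.G = enat 0"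
    by (intro abelian_rank_eqI[of _ "{}"]) (auto simp: E1.int_independent_iff)
  thus ?thesis by (simp add: zero_enat_def)
qed

lemma points_distinct: "distinct [point_P1, point_P2, point_P3, point_P4]"
proof -
  have s3: "sqrt 3 \<noteq> 0" by simp
  have z: "zeta3 \<noteq> 1" "zeta3 \<noteq> -1" "zeta3 ^ 2 \<noteq> -1" "zeta3 ^ 2 \<noteq> 1" "zeta3 \<noteq> - (zeta3 ^ 2)"
  proof -
    have Im: "Im zeta3 \<noteq> 0" by (simp add: zeta3_def)
    thus "zeta3 \<noteq> 1" "zeta3 \<noteq> -1" by (simp_all add: complex_eq_iff)
    have z2: "zeta3 ^ 2 = - 1 - zeta3" using zeta3_cubic by Groebner_Basis.algebra
    show "zeta3 ^ 2 \<noteq> -1" unfolding z2 by simp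
    show "zeta3 ^ 2 \<noteq> 1" unfolding z2 using Im by (auto simp: complex_eq_iff)
    show "zeta3 \<noteq> - (zeta3 ^ 2)" unfolding z2 by simp
  qed
  show ?thesis
    using z tvar_nonzero by (auto simp: point_P1_def point_P2_def point_P3_def point_P4_def
        simp del: ratfun_const_simps(5,6) ratfun_const_power)
qed

lemma E2_generators:
  assumes "P \<in> E2.points"
  shows "P \<in> generate E2.G {point_P1, point_P2, point_P3, point_P4}"
proof -
  let ?H = "generate E2.G {point_P1, point_P2, point_P3, point_P4}"
  have H: "subgroup ?H E2.G" using E2_points by (intro E2.G.generate_is_subgroup) auto
  have pow: "Q [^]\<^bsub>E2.G\<^esub> (n :: int) \<in> ?H" if "Q \<in> {point_P1, point_P2, point_P3, point_P4}" for Q n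
    using that by (intro E2.G.subgroup_int_pow_closed[OF H] generate.incl)
  obtain u v where uv: "u \<in> eisenstein" "v \<in> eisenstein" "E2.logd P = ratfun_const u * \<rho>1 + ratfun_const v * \<rho>3"
    by (rule E2_logd_eisenstein[OF assms])
  obtain m n k l :: int where Q:
    "combination m n k l \<in> E2.points"
    "E2.logd (combination m n k l) = ratfun_const u * \<rho>1 + ratfun_const v * \<rho>3"
    by (rule E2_eisenstein_points[OF uv(1,2)])
  have "P = combination m n k l"
    using uv(3) Q(2) by (intro E2.logd_inj assms Q(1)) simp
  also have "\<dots> \<in> ?H" by (intro subgroup.m_closed[OF H] pow) auto
  finally show ?thesis .
qed

lemma generate_E2: "generate E2.G {point_P1, point_P2, point_P3, point_P4} = E2.points"
  using E2_generators E2.G.generate_incl[of "{point_P1, point_P2, point_P3, point_P4}"] E2_points by auto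

lemma int_independent_E2: "int_independent E2.G {point_P1, point_P2, point_P3, point_P4}"
  unfolding E2.int_independent_iff
proof (intro conjI allI impI)
  fix c :: "ratfun ec_point \<Rightarrow> int"
  assume *: "(\<Sum>P\<in>{point_P1, point_P2, point_P3, point_P4}. of_int (c P) * E2.logd P) = 0"
  define u v where "u = of_int (c point_P1) + of_int (c point_P2) * zeta3"
    and "v = of_int (c point_P3) + of_int (c point_P4) * zeta3 ^ 2"
  have "ratfun_const u * \<rho>1 + ratfun_const v * \<rho>3 = 0"
    using * points_distinct by (simp add: E2_logd_points u_def v_def algebra_simps)
  hence uv: "u = 0" "v = 0" by (rule \<rho>_independent)+
  have "Im u = of_int (c point_P2) * (sqrt 3 / 2)" by (simp add: u_def zeta3_def)
  hence "c point_P2 = 0" using uv(1) by simp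
  moreover from this have "c point_P1 = 0" using uv(1) by (simp add: u_def)
  moreover have "zeta3 ^ 2 = - 1 - zeta3" using zeta3_cubic by Groebner_Basis.algebra
  hence "Im v = - of_int (c point_P4) * (sqrt 3 / 2)" by (simp add: v_def zeta3_def)
  hence "c point_P4 = 0" using uv(2) by simp
  moreover from this have "c point_P3 = 0" using uv(2) by (simp add: v_def)
  ultimately show "\<forall>P\<in>{point_P1, point_P2, point_P3, point_P4}. c P = 0" by simp
qed (use E2_points in auto)

lemma rank_E2: "abelian_rank E2.G = 4"
proof -
  \<comment> \<open>The four-element type \<open>bool \<times> bool\<close> indexes the values of
    \<open>logd\<close> at the four generators.\<close>
  define r :: "bool \<times> bool \<Rightarrow> ratfun" where
    "r = (\<lambda>(a, b). if a then (if b then \<rho>1 else ratfun_const zeta3 * \<rho>1)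
            else (if b then \<rho>3 else ratfun_const (zeta3 ^ 2) * \<rho>3))"
  have UNIV: "(UNIV :: (bool \<times> bool) set) = {(True, True), (True, False), (False, True), (False, False)}"
    by auto
  have span: "\<exists>a :: bool \<times> bool \<Rightarrow> int. E2.logd P = (\<Sum>i\<in>UNIV. of_int (a i) * r i)" if P: "P \<in> E2.points" for P
  proof -
    obtain u v where uv: "u \<in> eisenstein" "v \<in> eisenstein" "E2.logd P = ratfun_const u * \<rho>1 + ratfun_const v * \<rho>3"
      by (rule E2_logd_eisenstein[OF P])
    obtain m n k l where "u = of_int m + of_int n * zeta3" "v = of_int k + of_int l * zeta3 ^ 2"
      by (rule E2_eisenstein_points[OF uv(1,2)])
    thus ?thesis using uv(3)
      by (intro exI[of _ "\<lambda>(a, b). if a then (if b then m else n) else (if b then k else l)"])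
         (simp add: UNIV r_def algebra_simps)
  qed
  have "abelian_rank E2.G = enat 4"
  proof (rule abelian_rank_eqI[OF int_independent_E2])
    show "card {point_P1, point_P2, point_P3, point_P4} = 4"
      using distinct_card[OF points_distinct] by simp
    show "card S \<le> 4" if "int_independent E2.G S" for S
      using E2.card_int_independent_le[OF span that] by simp
  qed
  thus ?thesis by (simp add: numeral_eq_enat)
qed

section \<open>The splitting field\<close>

lemma complex_field_simps [simp]:
  "carrier complex_field = UNIV" "\<one>\<^bsub>complex_field\<^esub> = 1" "\<zero>\<^bsub>complex_field\<^esub> = 0"
  "monoid.mult complex_field = (*)" "ring.add complex_field = (+)"
  by (auto simp: ring_of_type_algebra_def fun_eq_iff)

lemma field_complex_field: "Ring.field complex_field"
  by (rule field_from_type_algebra)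

lemma complex_field_minus [simp]: "a_inv complex_field x = - x"
proof -
  interpret C: Ring.field complex_field by (rule field_complex_field)
  show ?thesis by (rule C.minus_equality) auto
qed

lemma complex_field_inv: "x \<noteq> 0 \<Longrightarrow> m_inv complex_field x = inverse x"
proof -
  interpret C: Ring.field complex_field by (rule field_complex_field)
  show "x \<noteq> 0 \<Longrightarrow> m_inv complex_field x = inverse x" by (rule C.comm_inv_char) auto
qed

lemma subfield_complexD:
  assumes "subfield K complex_field"
  shows "0 \<in> K" "1 \<in> K" "a \<in> K \<Longrightarrow> b \<in> K \<Longrightarrow> a + b \<in> K" "a \<in> K \<Longrightarrow> - a \<in> K"
    "a \<in> K \<Longrightarrow> b \<in> K \<Longrightarrow> a * b \<in> K" "a \<in> K \<Longrightarrow> inverse a \<in> K"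
proof -
  interpret C: Ring.field complex_field by (rule field_complex_field)
  have R: "subring K complex_field" by (rule subfieldE(1)[OF assms])
  show "0 \<in> K" "1 \<in> K" "a \<in> K \<Longrightarrow> b \<in> K \<Longrightarrow> a + b \<in> K" "a \<in> K \<Longrightarrow> - a \<in> K"
    "a \<in> K \<Longrightarrow> b \<in> K \<Longrightarrow> a * b \<in> K"
    using subringE[OF R] by auto
  show "inverse a \<in> K" if "a \<in> K"
    using C.subfield_m_inv(1)[OF assms, of a] that \<open>0 \<in> K\<close> by (cases "a = 0") (auto simp: complex_field_inv)
qed

lemma subfield_Rats: "subfield \<rat> complex_field"
proof -
  interpret C: Ring.field complex_field by (rule field_complex_field)
  show ?thesis
  proof (rule C.subfieldI')
  show "subring \<rat> complex_field" by (rule C.subringI) auto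
  show "inv\<^bsub>complex_field\<^esub> k \<in> \<rat>" if "k \<in> \<rat> - {\<zero>\<^bsub>complex_field\<^esub>}" for k
    using that by (auto simp: complex_field_inv)
  qed
qed

section \<open>The field K(t) for a subfield K\<close>

context
  fixes K :: "complex set"
  assumes K: "subfield K complex_field"
begin

lemma coeffs_subset_iff: "set (coeffs p) \<subseteq> K \<longleftrightarrow> (\<forall>n. Polynomial.coeff p n \<in> K)"
proof -
  have "set (coeffs p) \<subseteq> K \<longleftrightarrow> range (Polynomial.coeff p) \<subseteq> K"
    unfolding range_coeff using subfield_complexD(1)[OF K] by simp
  thus ?thesis by (simp add: image_subset_iff)
qed

lemma coeff_mult_in:
  assumes "\<And>n. Polynomial.coeff p n \<in> K" "\<And>n. Polynomial.coeff q n \<in> K"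
  shows "Polynomial.coeff (p * q) n \<in> K"
proof -
  have "(\<Sum>i\<in>A. Polynomial.coeff p i * Polynomial.coeff q (n - i)) \<in> K" if "finite A" for A
    using that by (induction A) (auto intro: subfield_complexD[OF K] assms)
  thus ?thesis by (simp add: coeff_mult)
qed

lemma ratfuns_overI:
  assumes "\<And>n. Polynomial.coeff p n \<in> K" "\<And>n. Polynomial.coeff q n \<in> K"
  shows "to_fract p / to_fract q \<in> ratfuns_over K"
proof (cases "q = 0")
  case True
  have "0 = Fraction_Field.Fract (0 :: complex poly) 1" by (rule Zero_fract_def)
  thus ?thesis using True subfield_complexD(1,2)[OF K] unfolding ratfuns_over_def
    by (intro CollectI exI[of _ 0] exI[of _ 1]) auto
next
  case False
  thus ?thesis using assms unfolding ratfuns_over_def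
    by (intro CollectI exI[of _ p] exI[of _ q]) (auto simp: coeffs_subset_iff Fract_conv_to_fract)
qed

lemma ratfuns_overE:
  assumes "x \<in> ratfuns_over K"
  obtains p q where "x = to_fract p / to_fract q" "q \<noteq> 0" "\<And>n. Polynomial.coeff p n \<in> K" "\<And>n. Polynomial.coeff q n \<in> K"
  using assms unfolding ratfuns_over_def by (auto simp: coeffs_subset_iff Fract_conv_to_fract)

lemma ratfuns_over_to_fract: "(\<And>n. Polynomial.coeff p n \<in> K) \<Longrightarrow> to_fract p \<in> ratfuns_over K"
  using ratfuns_overI[of p 1] subfield_complexD(1,2)[OF K] by (simp add: Polynomial.coeff_1)

lemma ratfuns_over_const: "c \<in> K \<Longrightarrow> ratfun_const c \<in> ratfuns_over K"
  unfolding ratfun_const_def using subfield_complexD(1,2)[OF K]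
  by (intro ratfuns_over_to_fract) (auto simp: coeff_pCons split: nat.splits)

lemma ratfuns_over_tvar: "tvar \<in> ratfuns_over K"
  unfolding tvar_def using subfield_complexD(1,2)[OF K]
  by (intro ratfuns_over_to_fract) (auto simp: coeff_pCons split: nat.splits)

lemma ratfuns_over_add:
  assumes "x \<in> ratfuns_over K" "y \<in> ratfuns_over K"
  shows "x + y \<in> ratfuns_over K"
proof -
  obtain p q where x: "x = to_fract p / to_fract q" "q \<noteq> 0" "\<And>n. Polynomial.coeff p n \<in> K" "\<And>n. Polynomial.coeff q n \<in> K"
    using ratfuns_overE[OF assms(1)] by blast
  obtain r s where y: "y = to_fract r / to_fract s" "s \<noteq> 0" "\<And>n. Polynomial.coeff r n \<in> K" "\<And>n. Polynomial.coeff s n \<in> K"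
    using ratfuns_overE[OF assms(2)] by blast
  have "x + y = to_fract (p * s + r * q) / to_fract (q * s)" using x y by (simp add: add_frac_eq)
  also have "\<dots> \<in> ratfuns_over K"
    using x y by (intro ratfuns_overI) (auto intro!: subfield_complexD(3)[OF K] coeff_mult_in)
  finally show ?thesis .
qed

lemma ratfuns_over_mult:
  assumes "x \<in> ratfuns_over K" "y \<in> ratfuns_over K"
  shows "x * y \<in> ratfuns_over K" "x / y \<in> ratfuns_over K"
proof -
  obtain p q where x: "x = to_fract p / to_fract q" "q \<noteq> 0" "\<And>n. Polynomial.coeff p n \<in> K" "\<And>n. Polynomial.coeff q n \<in> K"
    using ratfuns_overE[OF assms(1)] by blast
  obtain r s where y: "y = to_fract r / to_fract s" "s \<noteq> 0" "\<And>n. Polynomial.coeff r n \<in> K" "\<And>n. Polynomial.coeff s n \<in> K"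
    using ratfuns_overE[OF assms(2)] by blast
  have "x * y = to_fract (p * r) / to_fract (q * s)" "x / y = to_fract (p * s) / to_fract (q * r)"
    using x y by simp_all
  moreover have "to_fract (p * r) / to_fract (q * s) \<in> ratfuns_over K" "to_fract (p * s) / to_fract (q * r) \<in> ratfuns_over K"
    using x y by (auto intro!: ratfuns_overI coeff_mult_in simp del: to_fract_mult)
  ultimately show "x * y \<in> ratfuns_over K" "x / y \<in> ratfuns_over K" by simp_all
qed

lemma ratfuns_over_minus:
  assumes "x \<in> ratfuns_over K"
  shows "- x \<in> ratfuns_over K"
  using ratfuns_over_mult(1)[OF ratfuns_over_const assms, of "- 1"] subfield_complexD(2,4)[OF K] by simp

lemma ratfuns_over_diff: "x \<in> ratfuns_over K \<Longrightarrow> y \<in> ratfuns_over K \<Longrightarrow> x - y \<in> ratfuns_over K"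
  using ratfuns_over_add[of x "- y"] ratfuns_over_minus by simp

lemma ratfuns_over_numeral: "numeral n \<in> ratfuns_over K"
proof -
  have "of_nat k \<in> ratfuns_over K" for k
    using ratfuns_over_const[of 0] ratfuns_over_const[of 1] subfield_complexD(1,2)[OF K]
    by (induction k) (auto intro: ratfuns_over_add)
  thus ?thesis by (metis of_nat_numeral)
qed

lemma ratfuns_over_power2: "x \<in> ratfuns_over K \<Longrightarrow> x ^ 2 \<in> ratfuns_over K"
  by (simp add: power2_eq_square ratfuns_over_mult)

text \<open>From p = c q, the constant c is the quotient of the coefficients of p and q at the
  degree of q. This lets constant coordinates of points be read off in K.\<close>

lemma const_in_ratfuns_over_iff: "ratfun_const c \<in> ratfuns_over K \<longleftrightarrow> c \<in> K"
proof
  assume "ratfun_const c \<in> ratfuns_over K"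
  then obtain p q where pq: "ratfun_const c = to_fract p / to_fract q" "q \<noteq> 0"
    "\<And>n. Polynomial.coeff p n \<in> K" "\<And>n. Polynomial.coeff q n \<in> K"
    by (elim ratfuns_overE) blast
  hence "to_fract p = ratfun_const c * to_fract q" by simp
  hence "to_fract p = to_fract ([:c:] * q)" by (simp only: ratfun_const_def to_fract_mult)
  hence "p = [:c:] * q" by (simp only: to_fract_eq_iff)
  hence p: "p = Polynomial.smult c q" by simp
  define n where "n = Polynomial.degree q"
  have "Polynomial.coeff q n \<noteq> 0" using pq(2) by (simp add: n_def)
  hence "c = Polynomial.coeff p n * inverse (Polynomial.coeff q n)" by (simp add: p)
  also have "\<dots> \<in> K" using pq by (intro subfield_complexD[OF K])
  finally show "c \<in> K" .
qed (rule ratfuns_over_const)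

end

text \<open>The chord-tangent formulas are rational operations with integer coefficients.
  Rationality of a whole group over K(t) can thus be checked on generators.\<close>

lemma (in mordell_curve) subgroup_rational_points:
  assumes K: "subfield K complex_field"
  shows "subgroup (rational_points E (ratfuns_over K)) G"
proof
  let ?F = "ratfuns_over K"
  have closed: "ec_add E P Q \<in> rational_points E ?F"
    if "P \<in> rational_points E ?F" "Q \<in> rational_points E ?F" for P Q
  proof -
    have "P \<in> points" "Q \<in> points" using that by (auto simp: rational_points_def)
    hence on: "ec_add E P Q \<in> points" by (rule ec_add_points)
    have zero: "0 \<in> ?F" using ratfuns_over_const[OF K, of 0] subfield_complexD(1)[OF K] by simp
    have coords: "x3 \<in> ?F \<and> y3 \<in> ?F" if "ec_add E P Q = Affine x3 y3" for x3 y3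
    proof (cases P; cases Q)
      fix x1 y1 x2 y2 assume PQ: "P = Affine x1 y1" "Q = Affine x2 y2"
      have xy: "x1 \<in> ?F" "y1 \<in> ?F" "x2 \<in> ?F" "y2 \<in> ?F"
        using \<open>P \<in> rational_points E ?F\<close> \<open>Q \<in> rational_points E ?F\<close> by (auto simp: PQ rational_points_def)
      show ?thesis using that xy zero
        by (auto simp: PQ Let_def split: if_splits intro!: ratfuns_over_diff[OF K] ratfuns_over_mult[OF K] ratfuns_over_add[OF K]
              ratfuns_over_power2[OF K] ratfuns_over_numeral[OF K])
    qed (use that \<open>P \<in> rational_points E ?F\<close> \<open>Q \<in> rational_points E ?F\<close> in \<open>auto simp: rational_points_def\<close>)
    show ?thesis using on coords by (cases "ec_add E P Q") (auto simp: rational_points_def)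
  qed
  show "rational_points E ?F \<subseteq> carrier G" by (auto simp: rational_points_def)
  show "x \<otimes>\<^bsub>G\<^esub> y \<in> rational_points E ?F" if "x \<in> rational_points E ?F" "y \<in> rational_points E ?F" for x y
    using closed[OF that] by simp
  show "\<one>\<^bsub>G\<^esub> \<in> rational_points E ?F" by (simp add: rational_points_def)
  show "inv\<^bsub>G\<^esub> P \<in> rational_points E ?F" if P: "P \<in> rational_points E ?F" for P
  proof -
    have "P \<in> points" using P by (auto simp: rational_points_def)
    thus ?thesis using P by (cases P) (auto simp: inv_eq_opp rational_points_def ratfuns_over_minus[OF K])
  qed
qed


section \<open>The splitting field of the second curve\<close>

lemma field_K2: "subfield field_K2 complex_field" "\<rat> \<subseteq> field_K2" "zeta3 \<in> field_K2" "cbrt2 \<in> field_K2"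
proof -
  interpret C: Ring.field complex_field by (rule field_complex_field)
  show "subfield field_K2 complex_field"
    unfolding field_K2_def by (rule C.generate_field_is_subfield) simp
  have "\<rat> \<union> {zeta3, cbrt2} \<subseteq> field_K2"
    unfolding field_K2_def by (rule C.generate_fieldE(2)) auto
  thus "\<rat> \<subseteq> field_K2" "zeta3 \<in> field_K2" "cbrt2 \<in> field_K2" by auto
qed

lemma field_K2_least:
  assumes "subfield L complex_field" "\<rat> \<subseteq> L" "zeta3 \<in> L" "cbrt2 \<in> L"
  shows "field_K2 \<subseteq> L"
proof -
  interpret C: Ring.field complex_field by (rule field_complex_field)
  show ?thesis unfolding field_K2_def by (rule C.generate_field_min_subfield1) (use assms in auto)
qed

lemma finite_dimension_field_K2: "ring.finite_dimension complex_field \<rat> field_K2"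
proof -
  interpret C: Ring.field complex_field by (rule field_complex_field)
  have alg_zeta3: "(C.algebraic over \<rat>) zeta3"
  proof (rule C.algebraicI)
    \<comment> \<open>Coefficient lists start with the leading coefficient: X^2 + X + 1 here, X^3 -
      2 below.\<close>
    show "[1, 1, 1] \<in> carrier (univ_poly complex_field \<rat>)" by (simp add: univ_poly_def polynomial_def)
    show "C.eval [1, 1, 1] zeta3 = \<zero>\<^bsub>complex_field\<^esub>" using zeta3_cubic by (simp add: add.assoc power2_eq_square)
  qed simp
  have alg_cbrt2: "(C.algebraic over \<rat>) cbrt2"
  proof (rule C.algebraicI)
    show "[1, 0, 0, - 2] \<in> carrier (univ_poly complex_field \<rat>)" by (simp add: univ_poly_def polynomial_def)
    show "C.eval [1, 0, 0, - 2] cbrt2 = \<zero>\<^bsub>complex_field\<^esub>" using cbrt2_cube by (simp add: power3_eq_cube)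
  qed simp
  let ?L = "C.finite_extension \<rat> [zeta3, cbrt2]"
  have alg: "(C.algebraic over \<rat>) x" if "x \<in> set [zeta3, cbrt2]" for x
    using that alg_zeta3 alg_cbrt2 by auto
  have "set [zeta3, cbrt2] \<subseteq> carrier complex_field" by simp
  note L = C.finite_extension_is_subfield[OF subfield_Rats this alg]
    C.finite_extension_finite_dimension(1)[OF subfield_Rats this alg]
    C.finite_extension_mem[OF subfieldE(1)[OF subfield_Rats] this]
    C.finite_extension_incl[OF subfieldE(3)[OF subfield_Rats] this]
  have "?L = field_K2"
  proof
    show "?L \<subseteq> field_K2"
      using field_K2 by (intro C.finite_extension_subring_incl subfieldE(1)) auto
    show "field_K2 \<subseteq> ?L" using L(3,4) by (intro field_K2_least L(1)) auto
  qed
  thus ?thesis using L(2) by simp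
qed

lemma rational_points_field_K2: "rational_points E2.E (ratfuns_over field_K2) = E2.points"
proof
  let ?F = "ratfuns_over field_K2"
  note K = field_K2(1)
  have const_in: "ratfun_const c \<in> ?F" if "c \<in> field_K2" for c by (rule ratfuns_over_const[OF K that])
  have one: "1 \<in> ?F" using const_in[of 1] subfield_complexD(2)[OF K] by simp
  have t: "tvar + 1 / tvar \<in> ?F" "tvar - 1 / tvar \<in> ?F"
    using one ratfuns_over_tvar[OF K]
    by (auto intro!: ratfuns_over_add[OF K] ratfuns_over_diff[OF K] ratfuns_over_mult[OF K])
  have "{point_P1, point_P2, point_P3, point_P4} \<subseteq> rational_points E2.E ?F"
  proof -
    have x: "cbrt2 \<in> field_K2" "zeta3 * cbrt2 \<in> field_K2" "- cbrt2 \<in> field_K2" "- (zeta3 ^ 2) * cbrt2 \<in> field_K2"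
      unfolding power2_eq_square using field_K2(3,4) by (auto intro!: subfield_complexD[OF K])
    have "P \<in> rational_points E2.E ?F" if "P \<in> E2.points" "P = Affine x y" "x \<in> ?F" "y \<in> ?F" for P x y
      using that by (auto simp: rational_points_def)
    thus ?thesis using E2_points const_in[OF x(1)] const_in[OF x(2)] const_in[OF x(3)] const_in[OF x(4)] t
      unfolding point_P1_def point_P2_def point_P3_def point_P4_def by blast
  qed
  hence "generate E2.G {point_P1, point_P2, point_P3, point_P4} \<subseteq> rational_points E2.E ?F"
    by (rule E2.G.generate_subgroup_incl[OF _ E2.subgroup_rational_points[OF K]])
  thus "E2.points \<subseteq> rational_points E2.E ?F" by (simp only: generate_E2)
qed (auto simp: rational_points_def)

lemma is_splitting_field_K2: "is_splitting_field \<rat> E2.E field_K2"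
  unfolding is_splitting_field_def
proof (intro conjI allI impI)
  show "splits_over \<rat> E2.E field_K2"
    unfolding splits_over_def using field_K2 finite_dimension_field_K2 rational_points_field_K2 by simp
next
  fix L assume L: "splits_over \<rat> E2.E L"
  hence sub: "subfield L complex_field" "\<rat> \<subseteq> L" and eq: "E2.points = rational_points E2.E (ratfuns_over L)"
    by (auto simp: splits_over_def)
  \<comment> \<open>For minimality the constant x-coordinates of \<open>point_P1\<close> and
    \<open>point_P2\<close> suffice; their quotient is zeta3.\<close>
  have "ratfun_const cbrt2 \<in> ratfuns_over L" "ratfun_const (zeta3 * cbrt2) \<in> ratfuns_over L"
    using E2_points(1,2) unfolding eq by (auto simp: rational_points_def point_P1_def point_P2_def)
  hence c: "cbrt2 \<in> L" "zeta3 * cbrt2 \<in> L" by (simp_all only: const_in_ratfuns_over_iff[OF sub(1)])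
  hence "zeta3 * cbrt2 * inverse cbrt2 \<in> L" 
    using subfield_complexD(5)[OF sub(1)] subfield_complexD(6)[OF sub(1)] by blast
  hence "zeta3 \<in> L" by (simp add: mult.assoc)
  thus "field_K2 \<subseteq> L" using sub c by (intro field_K2_least)
qed

theorem theorem1p1:
  "abelian_rank (rational_points_group (curve_E 1) UNIV) = 0 \<and>
   is_splitting_field \<rat> (curve_E 2) field_K2 \<and>
   rational_points (curve_E 2) UNIV = rational_points (curve_E 2) (ratfuns_over field_K2) \<and>
   abelian_rank (rational_points_group (curve_E 2) (ratfuns_over field_K2)) = 4 \<and>
   card {point_P1, point_P2, point_P3, point_P4} = 4 \<and>
   independent_generators (rational_points_group (curve_E 2) (ratfuns_over field_K2))
     {point_P1, point_P2, point_P3, point_P4}"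
proof -
  have G: "rational_points_group E2.E (ratfuns_over field_K2) = E2.G"
    by (simp add: rational_points_group_def rational_points_field_K2)
  have "card {point_P1, point_P2, point_P3, point_P4} = 4"
    using distinct_card[OF points_distinct] by simp
  thus ?thesis
    using rank_E1 rank_E2 is_splitting_field_K2 rational_points_field_K2 int_independent_E2 generate_E2
    unfolding curve_E_eq G independent_generators_def E2.G_simps by blast
qed

end
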